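(* Let $P_{S^1\times S^1}$ be the bounded operator on $L^2_{\mathbb{C}}(S^1\times S^1)$, where $S^1\times S^1=(\mathbb{R}/2\pi\mathbb{Z})^2$ is the flat torus, that is the unique bounded extension of $d^\ast\circ D^{-1}_{S^1\times S^1}$ from the span $\Lambda$ of the exponentials $e^{ik\theta_1}e^{im\theta_2}$, $(k,m)\in\mathbb{Z}^2$, with $d^\ast=\frac{\partial}{\partial\theta_1}+\frac{\partial}{\partial\theta_2}$ and $D^{-1}_{S^1\times S^1}$ the inverse Laplace operator. For every even positive integer $n>2$, the operator $P^n_{S^1\times S^1}$ ($n$-fold composition) is trace class, with $$\mathrm{Tr}\left(P^n_{S^1\times S^1}\right)=i^n\sum_{(k,m)\in\mathbb{Z}^2\setminus\{(0,0)\}}\frac{(k+m)^n}{(k^2+m^2)^n}.$$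
   Context: The torus $S^1\times S^1=(\mathbb{R}/2\pi\mathbb{Z})^2$ carries the flat metric descended from $\mathbb{R}^2$ (so $g_{ij}=\delta_{ij}$ in the angular coordinates $\theta_1,\theta_2$). Inverse Laplace operator. Let $(M,g)$ be a smooth, oriented, closed, connected Riemannian manifold. The Laplacian is $\Delta=\mathrm{div}\circ\mathrm{grad}$ on real-valued functions in $C^\infty(M)$; on the flat torus, $\Delta=\partial^2/\partial\theta_1^2+\partial^2/\partial\theta_2^2$. $H^1(M)$ is the real Sobolev space obtained by completing $C^\infty(M)$ with respect to $\langle u,v\rangle_{H^1}=\int_M uv+\int_M\langle \mathrm{grad}\,u,\mathrm{grad}\,v\rangle_g$, identified with a subspace of $L^2_{\mathbb{R}}(M)$. $B:H^1(M)\times H^1(M)\to\mathbb{R}$ is the continuous bilinear extension of $B(u,v)=\int_M \Delta u\cdot v$, $u,v\in C^\infty(M)$. Let $K=\{u\in H^1(M): B(u,v)=0 \text{ for all } v\in H^1(M)\}$ and let $K^\perp$ be its orthogonal complement in $H^1(M)$. For $h\in L^2_{\mathbb{R}}(M)$, $D^{-1}(h)$ is the unique element of $K^\perp$ satisfying $B(D^{-1}(h),v)=\int_M h\cdot v$ for all $v\in K^\perp$. The inverse Laplace operator $D^{-1}:L^2_{\mathbb{C}}(M)\to L^2_{\mathbb{C}}(M)$ is the $\mathbb{C}$-linear extension $D^{-1}(f_0+if_1)=D^{-1}(f_0)+iD^{-1}(f_1)$, a bounded operator. The operator $P_{S^1\times S^1}$. Let $\Lambda\subset L^2_{\mathbb{C}}(S^1\times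 S^1)$ be the finite $\mathbb{C}$-span of $\{\frac{1}{2\pi}e^{ik\theta_1}e^{im\theta_2}\}_{(k,m)\in\mathbb{Z}^2}$ (an orthonormal basis of $L^2_{\mathbb{C}}(S^1\times S^1)$), and let $d^\ast=\frac{\partial}{\partial\theta_1}+\frac{\partial}{\partial\theta_2}$ on $\Lambda$. The operator $d^\ast\circ D^{-1}_{S^1\times S^1}:\Lambda\to\Lambda$ is bounded in the $L^2$ norm, and $P_{S^1\times S^1}$ denotes its unique bounded linear extension to $L^2_{\mathbb{C}}(S^1\times S^1)$. Trace class. A bounded operator $A$ on a separable complex Hilbert space is trace class if $\sum_j\langle\varphi_j,|A|\varphi_j\rangle<\infty$ for some orthonormal basis $\{\varphi_j\}$, where $|A|=\sqrt{A^*A}$; then $\mathrm{Tr}(A)=\sum_j\langle\varphi_j,A\varphi_j\rangle$ for any orthonormal basis. *)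

theory Defs
  imports "HOL-Analysis.Analysis"
begin

section \<open>Complex Hilbert spaces and trace class operators\<close>

text \<open>The complex inner product is conjugate-linear in the first argument.\<close>

class scaleC = scaleR +
  fixes scaleC :: "complex \<Rightarrow> 'a \<Rightarrow> 'a" (infixr \<open>*\<^sub>C\<close> 75)

class complex_inner = real_inner + scaleC +
  fixes cinner :: "'a \<Rightarrow> 'a \<Rightarrow> complex"
  assumes scaleR_eq_scaleC: "r *\<^sub>R x = complex_of_real r *\<^sub>C x"
    and scaleC_add_right: "a *\<^sub>C (x + y) = a *\<^sub>C x + a *\<^sub>C y"
    and scaleC_add_left: "(a + b) *\<^sub>C x = a *\<^sub>C x + b *\<^sub>C x"
    and scaleC_scaleC: "a *\<^sub>C (b *\<^sub>C x) = (a * b) *\<^sub>C x"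
    and cinner_commute: "cinner x y = cnj (cinner y x)"
    and cinner_add_right: "cinner x (y + z) = cinner x y + cinner x z"
    and cinner_scaleC_right: "cinner x (a *\<^sub>C y) = a * cinner x y"
    and inner_eq_Re_cinner: "inner x y = Re (cinner x y)"

class chilbert_space = complex_inner + complete_space

lemma scaleC_one [simp]: "1 *\<^sub>C x = (x :: 'a::complex_inner)"
  using scaleR_eq_scaleC[of 1 x] by simp

interpretation complex_vector: vector_space "scaleC :: complex \<Rightarrow> 'a \<Rightarrow> 'a::complex_inner"
  by unfold_locales (auto simp: scaleC_add_right scaleC_add_left scaleC_scaleC)

abbreviation cspan :: "'a::complex_inner set \<Rightarrow> 'a set" where
  "cspan \<equiv> complex_vector.span"

lemma cinner_eq_inner:
  "cinner x y = Complex (inner x y) (- inner x (\<i> *\<^sub>C y))"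
  by (simp add: inner_eq_Re_cinner cinner_scaleC_right complex_eq_iff)

lemma cinner_scaleC_left: "cinner (a *\<^sub>C x) y = cnj a * cinner x y"
  by (metis cinner_commute cinner_scaleC_right complex_cnj_mult)

lemma norm_scaleC: "norm (a *\<^sub>C x) = cmod a * norm (x :: 'a::complex_inner)"
proof -
  have "cinner (a *\<^sub>C x) (a *\<^sub>C x) = (a * cnj a) * cinner x x"
    by (simp add: cinner_scaleC_left cinner_scaleC_right mult_ac)
  also have "a * cnj a = complex_of_real ((cmod a)\<^sup>2)"
    by (rule complex_norm_square[symmetric])
  finally have "inner (a *\<^sub>C x) (a *\<^sub>C x) = (cmod a)\<^sup>2 * inner x x"
    by (simp add: inner_eq_Re_cinner)
  then have "(norm (a *\<^sub>C x))\<^sup>2 = (cmod a * norm x)\<^sup>2"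
    by (simp only: power2_norm_eq_inner power_mult_distrib)
  then show ?thesis
    by (simp add: power2_eq_iff_nonneg)
qed

lemma bounded_linear_scaleC: "bounded_linear (\<lambda>x :: 'a::complex_inner. a *\<^sub>C x)"
  by (rule bounded_linear_intro[where K = "cmod a"])
     (auto simp: scaleC_add_right norm_scaleC scaleR_eq_scaleC scaleC_scaleC mult_ac)

definition bounded_clinear :: "('a::complex_inner \<Rightarrow> 'a) \<Rightarrow> bool" where
  "bounded_clinear A \<longleftrightarrow> bounded_linear A \<and> (\<forall>c x. A (c *\<^sub>C x) = c *\<^sub>C A x)"

definition adjoint_op :: "('a::chilbert_space \<Rightarrow> 'a) \<Rightarrow> 'a \<Rightarrow> 'a" where
  "adjoint_op A = (THE B. bounded_clinear B \<and> (\<forall>x y. cinner (B x) y = cinner x (A y)))"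

definition positive_op :: "('a::chilbert_space \<Rightarrow> 'a) \<Rightarrow> bool" where
  "positive_op A \<longleftrightarrow>
     bounded_clinear A \<and> (\<forall>x. Im (cinner x (A x)) = 0 \<and> 0 \<le> Re (cinner x (A x)))"

definition sqrt_op :: "('a::chilbert_space \<Rightarrow> 'a) \<Rightarrow> 'a \<Rightarrow> 'a" where
  "sqrt_op A = (THE S. positive_op S \<and> S \<circ> S = A)"

definition abs_op :: "('a::chilbert_space \<Rightarrow> 'a) \<Rightarrow> 'a \<Rightarrow> 'a" where
  "abs_op A = sqrt_op (adjoint_op A \<circ> A)"

definition is_orthonormal_basis :: "'a::chilbert_space set \<Rightarrow> bool" where
  "is_orthonormal_basis E \<longleftrightarrow>
     (\<forall>x\<in>E. \<forall>y\<in>E. cinner x y = (if x = y then 1 else 0)) \<and> closure (cspan E) = UNIV"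

definition trace_class :: "('a::chilbert_space \<Rightarrow> 'a) \<Rightarrow> bool" where
  "trace_class A \<longleftrightarrow> bounded_clinear A \<and>
     (\<exists>E. is_orthonormal_basis E \<and> (\<lambda>\<phi>. cinner \<phi> (abs_op A \<phi>)) summable_on E)"

text \<open>The trace is the value common to all orthonormal bases.\<close>

definition trace_op :: "('a::chilbert_space \<Rightarrow> 'a) \<Rightarrow> complex" where
  "trace_op A =
     (THE t. \<forall>E. is_orthonormal_basis E \<longrightarrow> ((\<lambda>\<phi>. cinner \<phi> (A \<phi>)) has_sum t) E)"

instantiation complex :: chilbert_space
begin

definition scaleC_complex :: "complex \<Rightarrow> complex \<Rightarrow> complex" where
  "scaleC_complex = (*)"

definition cinner_complex :: "complex \<Rightarrow> complex \<Rightarrow> complex" where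
  "cinner_complex x y = cnj x * y"

instance
  by standard
     (auto simp: scaleC_complex_def cinner_complex_def algebra_simps scaleR_conv_of_real
       inner_complex_def)

end


section \<open>The space of square-integrable functions on the flat torus\<close>

text \<open>
  Functions on the torus are functions on the plane of the angular coordinates; up to null sets
  only their values on the fundamental domain of the following measure matter.
\<close>

definition torus_measure :: "(real \<times> real) measure" where
  "torus_measure = restrict_space lborel ({0..<2*pi} \<times> {0..<2*pi})"

lemma fundamental_domain_measurable [measurable]:
  "({0..<2*pi} \<times> {0..<2*pi} :: (real \<times> real) set) \<in> sets borel"
  by (rule borel_Times) auto

lemma finite_measure_torus: "finite_measure torus_measure"
proof (rule finite_measureI)
  let ?Q = "{0..<2*pi} \<times> {0..<2*pi} :: (real \<times> real) set"
  have "bounded ?Q"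
    by (intro bounded_Times) auto
  then have "emeasure lborel ?Q < \<infinity>"
    by (rule emeasure_bounded_finite)
  moreover have "emeasure torus_measure (space torus_measure) = emeasure lborel ?Q"
    unfolding torus_measure_def space_restrict_space space_lborel space_borel Int_UNIV_right
    by (rule emeasure_restrict_space) simp_all
  ultimately show "emeasure torus_measure (space torus_measure) \<noteq> \<infinity>"
    by simp
qed

interpretation torus: finite_measure torus_measure
  by (rule finite_measure_torus)

definition square_integrable :: "(real \<times> real \<Rightarrow> 'a::euclidean_space) \<Rightarrow> bool" where
  "square_integrable f \<longleftrightarrow> f \<in> borel_measurable torus_measure \<and>
     integrable torus_measure (\<lambda>p. (norm (f p))\<^sup>2)"

definition torus_AE_eq ::
  "(real \<times> real \<Rightarrow> 'a::euclidean_space) \<Rightarrow> (real \<times> real \<Rightarrow> 'a) \<Rightarrow> bool" where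
  "torus_AE_eq f g \<longleftrightarrow> square_integrable f \<and> square_integrable g \<and>
     (AE p in torus_measure. f p = g p)"

lemma square_integrable_measurable :
  "square_integrable f \<Longrightarrow> f \<in> borel_measurable torus_measure"
  by (simp add: square_integrable_def)

lemma square_integrable_0: "square_integrable (\<lambda>p. 0)"
  by (simp add: square_integrable_def)

lemma square_integrable_bound:
  assumes "square_integrable f" "g \<in> borel_measurable torus_measure"
    and "\<And>p. norm (g p) \<le> c * norm (f p)"
  shows "square_integrable g"
  unfolding square_integrable_def
proof
  show "integrable torus_measure (\<lambda>p. (norm (g p))\<^sup>2)"
  proof (rule Bochner_Integration.integrable_bound)
    show "integrable torus_measure (\<lambda>p. c\<^sup>2 * (norm (f p))\<^sup>2)"
      using assms(1) by (auto simp: square_integrable_def)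
    show "AE p in torus_measure. norm ((norm (g p))\<^sup>2) \<le> norm (c\<^sup>2 * (norm (f p))\<^sup>2)"
    proof (intro AE_I2)
      fix p
      have "(norm (g p))\<^sup>2 \<le> (c * norm (f p))\<^sup>2"
        using assms(3)[of p] by (intro power_mono) auto
      then show "norm ((norm (g p))\<^sup>2) \<le> norm (c\<^sup>2 * (norm (f p))\<^sup>2)"
        by (simp add: power_mult_distrib)
    qed
  qed (use assms(2) in measurable)
qed (fact assms(2))

lemma square_integrable_bounded_linear:
  assumes "bounded_linear T" "square_integrable f"
  shows "square_integrable (\<lambda>p. T (f p))"
proof -
  obtain K where K: "\<And>x. norm (T x) \<le> norm x * K"
    using bounded_linear.bounded[OF assms(1)] by blast
  have [measurable]: "T \<in> borel_measurable borel" "f \<in> borel_measurable torus_measure"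
    using assms by (auto intro!: borel_measurable_continuous_onI linear_continuous_on
        simp: square_integrable_def)
  show ?thesis
  proof (rule square_integrable_bound[OF assms(2)])
    show "(\<lambda>p. T (f p)) \<in> borel_measurable torus_measure"
      by measurable
    show "norm (T (f p)) \<le> K * norm (f p)" for p
      using K[of "f p"] by (simp only: mult.commute)
  qed
qed

lemma square_integrable_add:
  assumes "square_integrable f" "square_integrable g"
  shows "square_integrable (\<lambda>p. f p + g p)"
  unfolding square_integrable_def
proof
  have [measurable]: "f \<in> borel_measurable torus_measure" "g \<in> borel_measurable torus_measure"
    using assms by (auto simp: square_integrable_def)
  show "(\<lambda>p. f p + g p) \<in> borel_measurable torus_measure"
    by measurable
  show "integrable torus_measure (\<lambda>p. (norm (f p + g p))\<^sup>2)"
  proof (rule Bochner_Integration.integrable_bound)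
    show "integrable torus_measure (\<lambda>p. 2 * (norm (f p))\<^sup>2 + 2 * (norm (g p))\<^sup>2)"
      using assms by (auto simp: square_integrable_def)
    show "AE p in torus_measure. norm ((norm (f p + g p))\<^sup>2)
        \<le> norm (2 * (norm (f p))\<^sup>2 + 2 * (norm (g p))\<^sup>2)"
    proof (intro AE_I2)
      fix p
      have "(norm (f p + g p))\<^sup>2 \<le> (norm (f p) + norm (g p))\<^sup>2"
        by (intro power_mono norm_triangle_ineq) auto
      also have "\<dots> \<le> 2 * (norm (f p))\<^sup>2 + 2 * (norm (g p))\<^sup>2"
        using zero_le_power2[of "norm (f p) - norm (g p)"]
        by (simp add: power2_eq_square algebra_simps)
      finally show "norm ((norm (f p + g p))\<^sup>2)
        \<le> norm (2 * (norm (f p))\<^sup>2 + 2 * (norm (g p))\<^sup>2)"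
        by simp
    qed
  qed measurable
qed

lemma square_integrable_uminus: "square_integrable f \<Longrightarrow> square_integrable (\<lambda>p. - f p)"
  by (intro square_integrable_bounded_linear[of uminus] bounded_linear_minus bounded_linear_ident)

lemma square_integrable_diff:
  "square_integrable f \<Longrightarrow> square_integrable g \<Longrightarrow> square_integrable (\<lambda>p. f p - g p)"
  using square_integrable_add[OF _ square_integrable_uminus, of f g] by simp

lemma integrable_inner_torus:
  assumes "square_integrable f" "square_integrable g"
  shows "integrable torus_measure (\<lambda>p. inner (f p) (g p))"
proof (rule Bochner_Integration.integrable_bound)
  have [measurable]: "f \<in> borel_measurable torus_measure" "g \<in> borel_measurable torus_measure"
    using assms by (auto simp: square_integrable_def)
  show "(\<lambda>p. inner (f p) (g p)) \<in> borel_measurable torus_measure"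
    by measurable
  show "integrable torus_measure (\<lambda>p. (norm (f p))\<^sup>2 + (norm (g p))\<^sup>2)"
    using assms by (auto simp: square_integrable_def)
  show "AE p in torus_measure. norm (inner (f p) (g p)) \<le> norm ((norm (f p))\<^sup>2 + (norm (g p))\<^sup>2)"
  proof (intro AE_I2)
    fix p
    have "norm (inner (f p) (g p)) \<le> norm (f p) * norm (g p)"
      using Cauchy_Schwarz_ineq2 by auto
    also have "\<dots> \<le> (norm (f p))\<^sup>2 + (norm (g p))\<^sup>2"
      using sum_squares_bound[of "norm (f p)" "norm (g p)"]
        mult_nonneg_nonneg[OF norm_ge_zero[of "f p"] norm_ge_zero[of "g p"]]
      by linarith
    finally show "norm (inner (f p) (g p)) \<le> norm ((norm (f p))\<^sup>2 + (norm (g p))\<^sup>2)"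
      by simp
  qed
qed

lemma part_equivp_torus_AE_eq: "part_equivp (torus_AE_eq :: (real \<times> real \<Rightarrow> 'a::euclidean_space) \<Rightarrow> _)"
proof (rule part_equivpI)
  show "\<exists>f :: real \<times> real \<Rightarrow> 'a. torus_AE_eq f f"
    by (rule exI[of _ "\<lambda>p. 0"]) (simp add: torus_AE_eq_def square_integrable_0)
  show "symp (torus_AE_eq :: (real \<times> real \<Rightarrow> 'a) \<Rightarrow> _)"
    by (rule sympI) (auto simp: torus_AE_eq_def eq_commute)
  show "transp (torus_AE_eq :: (real \<times> real \<Rightarrow> 'a) \<Rightarrow> _)"
  proof (rule transpI)
    fix f g h :: "real \<times> real \<Rightarrow> 'a"
    assume fg: "torus_AE_eq f g" and gh: "torus_AE_eq g h"
    then have "AE p in torus_measure. f p = g p" "AE p in torus_measure. g p = h p"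
      by (auto simp: torus_AE_eq_def)
    then have "AE p in torus_measure. f p = h p"
      by eventually_elim simp
    with fg gh show "torus_AE_eq f h"
      by (auto simp: torus_AE_eq_def)
  qed
qed

text \<open>
  The elements are the classes of square-integrable functions under almost everywhere equality;
  \<open>real torus_L2\<close> is the real and \<open>complex torus_L2\<close> the complex space.
\<close>

quotient_type (overloaded) 'a torus_L2 = "real \<times> real \<Rightarrow> 'a::euclidean_space"
  / partial: torus_AE_eq
  by (rule part_equivp_torus_AE_eq)

abbreviation L2_class :: "(real \<times> real \<Rightarrow> 'a::euclidean_space) \<Rightarrow> 'a torus_L2" where
  "L2_class \<equiv> abs_torus_L2"


lemma torus_L2_eq_iff:
  fixes f g :: "real \<times> real \<Rightarrow> 'a::euclidean_space"
  assumes "square_integrable f" "square_integrable g"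
  shows "L2_class f = L2_class g \<longleftrightarrow> (AE p in torus_measure. f p = g p)"
  using Quotient3_rel[OF Quotient3_torus_L2, of f g] assms
  by (auto simp: torus_AE_eq_def)

lemma torus_L2_cases:
  obtains f :: "real \<times> real \<Rightarrow> 'a::euclidean_space"
  where "square_integrable f" "x = L2_class f"
proof
  show "square_integrable (rep_torus_L2 x)"
    using Quotient3_rel_rep[OF Quotient3_torus_L2, of x x] by (simp add: torus_AE_eq_def)
  show "x = L2_class (rep_torus_L2 x)"
    by (rule Quotient3_abs_rep[OF Quotient3_torus_L2, symmetric])
qed

lemma torus_AE_eqI:
  "square_integrable f \<Longrightarrow> square_integrable g \<Longrightarrow> AE p in torus_measure. f p = g p \<Longrightarrow>
    torus_AE_eq f g"
  by (simp add: torus_AE_eq_def)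

lemma torus_AE_eq_refl [simp]: "torus_AE_eq f f \<longleftrightarrow> square_integrable f"
  by (simp add: torus_AE_eq_def)

instantiation torus_L2 :: (euclidean_space) real_vector
begin

lift_definition zero_torus_L2 :: "'a torus_L2" is "\<lambda>p. 0"
  by (simp add: square_integrable_0)

lift_definition plus_torus_L2 :: "'a torus_L2 \<Rightarrow> 'a torus_L2 \<Rightarrow> 'a torus_L2"
  is "\<lambda>f g p. f p + g p"
  by (auto simp: torus_AE_eq_def square_integrable_add)

lift_definition minus_torus_L2 :: "'a torus_L2 \<Rightarrow> 'a torus_L2 \<Rightarrow> 'a torus_L2"
  is "\<lambda>f g p. f p - g p"
  by (auto simp: torus_AE_eq_def square_integrable_diff)

lift_definition uminus_torus_L2 :: "'a torus_L2 \<Rightarrow> 'a torus_L2" is "\<lambda>f p. - f p"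
  by (auto simp: torus_AE_eq_def square_integrable_uminus)

lift_definition scaleR_torus_L2 :: "real \<Rightarrow> 'a torus_L2 \<Rightarrow> 'a torus_L2" is "\<lambda>r f p. r *\<^sub>R f p"
  by (auto simp: torus_AE_eq_def
      intro!: square_integrable_bounded_linear[OF bounded_linear_scaleR_right])

instance
proof
  fix x y z :: "'a torus_L2" and r s :: real
  show "x + y + z = x + (y + z)"
    by transfer (auto simp: torus_AE_eq_def add.assoc intro!: square_integrable_add)
  show "x + y = y + x"
    by transfer (auto simp: torus_AE_eq_def add.commute intro!: square_integrable_add)
  show "0 + x = x"
    by transfer (auto simp: torus_AE_eq_def)
  show "- x + x = 0"
    by transfer (auto simp: torus_AE_eq_def square_integrable_0)
  show "x - y = x + - y"
    by transfer (auto simp: torus_AE_eq_def intro!: square_integrable_diff)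
  show "r *\<^sub>R (x + y) = r *\<^sub>R x + r *\<^sub>R y"
    by transfer (auto simp: torus_AE_eq_def scaleR_add_right intro!: square_integrable_add
        square_integrable_bounded_linear[OF bounded_linear_scaleR_right])
  show "(r + s) *\<^sub>R x = r *\<^sub>R x + s *\<^sub>R x"
    by transfer (auto simp: torus_AE_eq_def scaleR_add_left intro!: square_integrable_add
        square_integrable_bounded_linear[OF bounded_linear_scaleR_right])
  show "r *\<^sub>R s *\<^sub>R x = (r * s) *\<^sub>R x"
    by transfer (auto simp: torus_AE_eq_def
        intro!: square_integrable_bounded_linear[OF bounded_linear_scaleR_right])
  show "1 *\<^sub>R x = x"
    by transfer (auto simp: torus_AE_eq_def)
qed

end

instantiation torus_L2 :: (euclidean_space) real_inner
begin

lift_definition inner_torus_L2 :: "'a torus_L2 \<Rightarrow> 'a torus_L2 \<Rightarrow> real"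
  is "\<lambda>f g. \<integral>p. inner (f p) (g p) \<partial>torus_measure"
proof -
  fix f f' g g' :: "real \<times> real \<Rightarrow> 'a"
  assume eq: "torus_AE_eq f f'" "torus_AE_eq g g'"
  then have [measurable]: "f \<in> borel_measurable torus_measure" "f' \<in> borel_measurable torus_measure"
    "g \<in> borel_measurable torus_measure" "g' \<in> borel_measurable torus_measure"
    by (auto simp: torus_AE_eq_def square_integrable_def)
  have "AE p in torus_measure. f p = f' p" "AE p in torus_measure. g p = g' p"
    using eq by (auto simp: torus_AE_eq_def)
  then have "AE p in torus_measure. inner (f p) (g p) = inner (f' p) (g' p)"
    by eventually_elim simp
  then show "(\<integral>p. inner (f p) (g p) \<partial>torus_measure) = (\<integral>p. inner (f' p) (g' p) \<partial>torus_measure)"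
    by (intro integral_cong_AE) measurable
qed

definition norm_torus_L2 :: "'a torus_L2 \<Rightarrow> real" where
  "norm_torus_L2 x = sqrt (inner x x)"

definition dist_torus_L2 :: "'a torus_L2 \<Rightarrow> 'a torus_L2 \<Rightarrow> real" where
  "dist_torus_L2 x y = norm (x - y)"

definition sgn_torus_L2 :: "'a torus_L2 \<Rightarrow> 'a torus_L2" where
  "sgn_torus_L2 x = x /\<^sub>R norm x"

definition uniformity_torus_L2 :: "('a torus_L2 \<times> 'a torus_L2) filter" where
  "uniformity_torus_L2 = (INF e\<in>{0<..}. principal {(x, y). dist x y < e})"

definition open_torus_L2 :: "'a torus_L2 set \<Rightarrow> bool" where
  "open_torus_L2 U \<longleftrightarrow> (\<forall>x\<in>U. eventually (\<lambda>(x', y). x' = x \<longrightarrow> y \<in> U) uniformity)"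

instance
proof
  fix x y z :: "'a torus_L2" and r s :: real
  show "dist x y = norm (x - y)"
    by (rule dist_torus_L2_def)
  show "sgn x = x /\<^sub>R norm x"
    by (rule sgn_torus_L2_def)
  show "uniformity = (INF e\<in>{0<..}. principal {(x :: 'a torus_L2, y). dist x y < e})"
    by (rule uniformity_torus_L2_def)
  show "open U \<longleftrightarrow> (\<forall>x\<in>U. eventually (\<lambda>(x', y). x' = x \<longrightarrow> y \<in> U) uniformity)"
    for U :: "'a torus_L2 set"
    by (rule open_torus_L2_def)
  show "inner x y = inner y x"
    by transfer (simp add: inner_commute)
  show "inner (x + y) z = inner x z + inner y z"
    by transfer (simp add: inner_add_left integrable_inner_torus)
  show "inner (r *\<^sub>R x) y = r * inner x y"
    by transfer simp
  show "0 \<le> inner x x"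
    by transfer simp
  show "inner x x = 0 \<longleftrightarrow> x = 0"
  proof transfer
    fix f :: "real \<times> real \<Rightarrow> 'a"
    assume "torus_AE_eq f f"
    then show "(\<integral>p. inner (f p) (f p) \<partial>torus_measure) = 0 \<longleftrightarrow> torus_AE_eq f (\<lambda>p. 0)"
      using integral_nonneg_eq_0_iff_AE[OF integrable_inner_torus, of f f]
      by (auto simp: torus_AE_eq_def square_integrable_0)
  qed
  show "norm x = sqrt (inner x x)"
    by (rule norm_torus_L2_def)
qed

end


lemma L2_class_diff:
  "square_integrable f \<Longrightarrow> square_integrable g \<Longrightarrow>
    L2_class f - L2_class g = L2_class (\<lambda>p. f p - g p)"
  by (simp add: minus_torus_L2.abs_eq)

lemma inner_L2_class:
  "square_integrable f \<Longrightarrow> square_integrable g \<Longrightarrow>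
    inner (L2_class f) (L2_class g) = (\<integral>p. inner (f p) (g p) \<partial>torus_measure)"
  by (simp add: inner_torus_L2.abs_eq)

lemma norm_L2_class_power2:
  "square_integrable f \<Longrightarrow> (norm (L2_class f))\<^sup>2 = (\<integral>p. (norm (f p))\<^sup>2 \<partial>torus_measure)"
  by (simp add: power2_norm_eq_inner inner_L2_class)

lemma square_integrable_norm: "square_integrable f \<Longrightarrow> square_integrable (\<lambda>p. norm (f p))"
  by (auto simp: square_integrable_def)

lemma square_integrable_const: "square_integrable (\<lambda>p. c)"
  by (simp add: square_integrable_def)

lemma integral_norm_le_norm_L2:
  assumes "square_integrable f"
  shows "integrable torus_measure (\<lambda>p. norm (f p))"
    and "(\<integral>p. norm (f p) \<partial>torus_measure)
      \<le> norm (L2_class f) * norm (L2_class (\<lambda>p. 1 :: real))"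
proof -
  note si = square_integrable_norm[OF assms] square_integrable_const[of "1 :: real"]
  show "integrable torus_measure (\<lambda>p. norm (f p))"
    using integrable_inner_torus[OF si] by simp
  have "(\<integral>p. norm (f p) \<partial>torus_measure)
      = inner (L2_class (\<lambda>p. norm (f p))) (L2_class (\<lambda>p. 1 :: real))"
    by (simp add: inner_L2_class[OF si])
  also have "\<dots> \<le> norm (L2_class (\<lambda>p. norm (f p))) * norm (L2_class (\<lambda>p. 1 :: real))"
    by (rule norm_cauchy_schwarz)
  also have "norm (L2_class (\<lambda>p. norm (f p))) = norm (L2_class f)"
  proof -
    have "(norm (L2_class (\<lambda>p. norm (f p))))\<^sup>2 = (norm (L2_class f))\<^sup>2"
      by (simp add: norm_L2_class_power2 assms square_integrable_norm)
    then show ?thesis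
      by (simp add: power2_eq_iff_nonneg)
  qed
  finally show "(\<integral>p. norm (f p) \<partial>torus_measure)
      \<le> norm (L2_class f) * norm (L2_class (\<lambda>p. 1 :: real))" .
qed

lemma square_integrable_Fatou:
  fixes g :: "nat \<Rightarrow> real \<times> real \<Rightarrow> 'a::euclidean_space"
  assumes g: "\<And>n. square_integrable (g n)" and h: "h \<in> borel_measurable torus_measure"
    and lim: "AE p in torus_measure. (\<lambda>n. g n p) \<longlonglongrightarrow> h p"
    and bound: "eventually (\<lambda>n. norm (L2_class (g n)) \<le> e) sequentially" and "0 \<le> e"
  shows "square_integrable h" "norm (L2_class h) \<le> e"
proof -
  have [measurable]: "g n \<in> borel_measurable torus_measure" "h \<in> borel_measurable torus_measure" for n
    using g h by (auto simp: square_integrable_def)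
  have nn: "(\<integral>\<^sup>+p. ennreal ((norm (g n p))\<^sup>2) \<partial>torus_measure) = ennreal ((norm (L2_class (g n)))\<^sup>2)" for n
    using g[of n] by (simp add: norm_L2_class_power2 nn_integral_eq_integral square_integrable_def)
  have "(\<integral>\<^sup>+p. ennreal ((norm (h p))\<^sup>2) \<partial>torus_measure)
      = (\<integral>\<^sup>+p. liminf (\<lambda>n. ennreal ((norm (g n p))\<^sup>2)) \<partial>torus_measure)"
  proof (rule nn_integral_cong_AE)
    show "AE p in torus_measure. ennreal ((norm (h p))\<^sup>2) = liminf (\<lambda>n. ennreal ((norm (g n p))\<^sup>2))"
      using lim
    proof eventually_elim
      case (elim p)
      then have "(\<lambda>n. ennreal ((norm (g n p))\<^sup>2)) \<longlonglongrightarrow> ennreal ((norm (h p))\<^sup>2)"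
        by (intro tendsto_ennrealI tendsto_intros)
      then show ?case
        by (intro lim_imp_Liminf[symmetric]) auto
    qed
  qed
  also have "\<dots> \<le> liminf (\<lambda>n. \<integral>\<^sup>+p. ennreal ((norm (g n p))\<^sup>2) \<partial>torus_measure)"
    by (intro nn_integral_liminf) measurable
  also have "\<dots> \<le> liminf (\<lambda>n :: nat. ennreal (e\<^sup>2))"
  proof (rule Liminf_mono)
    show "\<forall>\<^sub>F n in sequentially. (\<integral>\<^sup>+p. ennreal ((norm (g n p))\<^sup>2) \<partial>torus_measure) \<le> ennreal (e\<^sup>2)"
      using bound by eventually_elim (auto simp: nn intro!: ennreal_leI power_mono)
  qed
  also have "\<dots> = ennreal (e\<^sup>2)"
    by (intro Liminf_const) simp
  finally have le: "(\<integral>\<^sup>+p. ennreal ((norm (h p))\<^sup>2) \<partial>torus_measure) \<le> ennreal (e\<^sup>2)" .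
  have "integrable torus_measure (\<lambda>p. (norm (h p))\<^sup>2)"
  proof (rule integrableI_bounded)
    show "(\<integral>\<^sup>+p. ennreal (norm ((norm (h p))\<^sup>2)) \<partial>torus_measure) < \<infinity>"
      using le ennreal_less_top by (simp add: order_le_less_trans)
  qed measurable
  then show si: "square_integrable h"
    by (simp add: square_integrable_def h)
  have "ennreal ((norm (L2_class h))\<^sup>2) \<le> ennreal (e\<^sup>2)"
    using le si by (simp add: norm_L2_class_power2 nn_integral_eq_integral square_integrable_def)
  then have "(norm (L2_class h))\<^sup>2 \<le> e\<^sup>2"
    by (simp add: ennreal_le_iff)
  then show "norm (L2_class h) \<le> e"
    using \<open>0 \<le> e\<close> by (rule power2_le_imp_le)
qed

instance torus_L2 :: (euclidean_space) complete_space
proof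
  fix X :: "nat \<Rightarrow> 'a torus_L2"
  assume X: "Cauchy X"
  define F where "F n = rep_torus_L2 (X n)" for n
  have F: "square_integrable (F n)" and XF: "X n = L2_class (F n)" for n
    using Quotient3_rel_rep[OF Quotient3_torus_L2, of "X n" "X n"]
      Quotient3_abs_rep[OF Quotient3_torus_L2, of "X n"]
    by (simp_all add: F_def torus_AE_eq_def)
  have "\<exists>N. \<forall>m\<ge>N. \<forall>k\<ge>N. dist (X m) (X k) < (1/2)^n" for n :: nat
    using X by (intro metric_CauchyD) auto
  then obtain N where N: "\<And>n m k. N n \<le> m \<Longrightarrow> N n \<le> k \<Longrightarrow> dist (X m) (X k) < (1/2)^n"
    by metis
  define r where "r n = (\<Sum>i\<le>n. N i) + n" for n
  have r_N: "N n \<le> r n" and r_Suc: "r n \<le> r (Suc n)" and r_ge: "n \<le> r n" for n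
    using member_le_sum[of n "{..n}" N] by (auto simp: r_def intro: trans_le_add1)
  define g where "g n = F (r n)" for n
  have g: "square_integrable (g n)" for n
    by (simp add: g_def F)
  have [measurable]: "g n \<in> borel_measurable torus_measure" "F n \<in> borel_measurable torus_measure" for n
    using g F by (auto simp: square_integrable_def)
  let ?C = "norm (L2_class (\<lambda>p. 1 :: real))"
  let ?h = "\<lambda>n p. norm (g (Suc n) p - g n p)"
  have step: "(\<integral>\<^sup>+p. ennreal (?h n p) \<partial>torus_measure) \<le> ennreal ((1/2)^n * ?C)" for n
  proof -
    have si: "square_integrable (\<lambda>p. g (Suc n) p - g n p)"
      by (intro square_integrable_diff g)
    have "norm (L2_class (\<lambda>p. g (Suc n) p - g n p)) = dist (X (r (Suc n))) (X (r n))"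
      by (simp add: L2_class_diff[symmetric] g dist_norm XF) (simp add: g_def)
    also have "\<dots> \<le> (1/2)^n"
      using N[of n "r (Suc n)" "r n"] r_N[of n] r_Suc[of n] by auto
    finally have "(\<integral>p. ?h n p \<partial>torus_measure) \<le> (1/2)^n * ?C"
      using integral_norm_le_norm_L2(2)[OF si] by (meson mult_right_mono norm_ge_zero order_trans)
    then show ?thesis
      using integral_norm_le_norm_L2(1)[OF si] by (simp add: nn_integral_eq_integral ennreal_leI)
  qed
  have "(\<integral>\<^sup>+p. (\<Sum>n. ennreal (?h n p)) \<partial>torus_measure)
      = (\<Sum>n. \<integral>\<^sup>+p. ennreal (?h n p) \<partial>torus_measure)"
    by (rule nn_integral_suminf) measurable
  also have "\<dots> \<le> (\<Sum>n. ennreal ((1/2)^n * ?C))"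
    by (intro suminf_le step) auto
  also have "\<dots> = ennreal (\<Sum>n. (1/2)^n * ?C)"
    by (intro suminf_ennreal2 summable_mult2 summable_geometric) auto
  finally have fin: "(\<integral>\<^sup>+p. (\<Sum>n. ennreal (?h n p)) \<partial>torus_measure) \<noteq> \<infinity>"
    by (auto simp: top_unique)
  have conv: "AE p in torus_measure. convergent (\<lambda>n. g n p)"
  proof -
    have "AE p in torus_measure. (\<Sum>n. ennreal (?h n p)) \<noteq> \<infinity>"
      by (intro nn_integral_PInf_AE fin) measurable
    then show ?thesis
    proof eventually_elim
      case (elim p)
      then have "summable (\<lambda>n. ?h n p)"
        by (intro summable_suminf_not_top) auto
      then have "summable (\<lambda>n. g (Suc n) p - g n p)"
        by (rule summable_norm_cancel)
      then have "convergent (\<lambda>n. \<Sum>i<n. g (Suc i) p - g i p)"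
        by (simp add: summable_iff_convergent)
      then have "convergent (\<lambda>n. g n p - g 0 p)"
        by (simp only: sum_lessThan_telescope[of "\<lambda>n. g n p"])
      then show ?case
        by (simp add: convergent_diff_const_right_iff)
    qed
  qed
  define G where "G p = lim (\<lambda>n. g n p)" for p
  have [measurable]: "G \<in> borel_measurable torus_measure"
    unfolding G_def by measurable
  have est: "square_integrable (\<lambda>p. G p - F k p) \<and> norm (L2_class (\<lambda>p. G p - F k p)) \<le> e"
    if "0 < e" and M: "\<And>m. m \<ge> M \<Longrightarrow> dist (X m) (X k) < e" for k M e
  proof -
    have 1: "square_integrable (\<lambda>p. g n p - F k p)" for n
      by (intro square_integrable_diff g F)
    have 2: "AE p in torus_measure. (\<lambda>n. g n p - F k p) \<longlonglongrightarrow> G p - F k p"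
      using conv
    proof eventually_elim
      case (elim p)
      then have "(\<lambda>n. g n p) \<longlonglongrightarrow> G p"
        by (simp add: G_def convergent_LIMSEQ_iff)
      then show ?case
        by (intro tendsto_intros)
    qed
    have 3: "eventually (\<lambda>n. norm (L2_class (\<lambda>p. g n p - F k p)) \<le> e) sequentially"
    proof (rule eventually_sequentiallyI)
      fix n assume "M \<le> n"
      then have "dist (X (r n)) (X k) < e"
        using r_ge[of n] by (intro M) auto
      moreover have "dist (X (r n)) (X k) = norm (L2_class (\<lambda>p. g n p - F k p))"
        unfolding dist_norm XF by (simp add: L2_class_diff F g_def)
      ultimately show "norm (L2_class (\<lambda>p. g n p - F k p)) \<le> e"
        by simp
    qed
    show ?thesis
      using square_integrable_Fatou[OF 1 _ 2 3] \<open>0 < e\<close> by auto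
  qed
  have GF: "square_integrable G"
  proof -
    have "square_integrable (\<lambda>p. G p - F (N 0) p)"
      using est[of 1 "N 0" "N 0"] N[of 0 _ "N 0"] by auto
    from square_integrable_add[OF this F[of "N 0"]] show ?thesis
      by simp
  qed
  have "X \<longlonglongrightarrow> L2_class G"
  proof (rule metric_LIMSEQ_I)
    fix e :: real assume "0 < e"
    then obtain M where M: "\<And>m k. m \<ge> M \<Longrightarrow> k \<ge> M \<Longrightarrow> dist (X m) (X k) < e / 2"
      using X by (meson half_gt_zero metric_CauchyD)
    have "dist (X k) (L2_class G) < e" if "k \<ge> M" for k
    proof -
      have "norm (L2_class (\<lambda>p. G p - F k p)) \<le> e / 2"
        using est[of "e / 2" M k] M that \<open>0 < e\<close> by auto
      moreover have "dist (X k) (L2_class G) = norm (L2_class (\<lambda>p. G p - F k p))"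
        unfolding XF by (subst dist_commute) (simp only: dist_norm L2_class_diff F GF)
      ultimately show ?thesis
        using \<open>0 < e\<close> by simp
    qed
    then show "\<exists>no. \<forall>n\<ge>no. dist (X n) (L2_class G) < e"
      by blast
  qed
  then show "convergent X"
    by (rule convergentI)
qed

lemma integrable_cinner_torus:
  fixes f g :: "real \<times> real \<Rightarrow> 'a::{euclidean_space,complex_inner}"
  assumes "square_integrable f" "square_integrable g"
  shows "integrable torus_measure (\<lambda>p. cinner (f p) (g p))"
  unfolding cinner_eq_inner Complex_eq
  using assms by (intro Bochner_Integration.integrable_add integrable_of_real
      Bochner_Integration.integrable_mult_right Bochner_Integration.integrable_minus
      integrable_inner_torus square_integrable_bounded_linear[OF bounded_linear_scaleC])

instantiation torus_L2 :: ("{euclidean_space,complex_inner}") chilbert_space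
begin

lift_definition scaleC_torus_L2 :: "complex \<Rightarrow> 'a torus_L2 \<Rightarrow> 'a torus_L2"
  is "\<lambda>c f p. c *\<^sub>C f p"
  by (auto simp: torus_AE_eq_def intro!: square_integrable_bounded_linear[OF bounded_linear_scaleC])

lift_definition cinner_torus_L2 :: "'a torus_L2 \<Rightarrow> 'a torus_L2 \<Rightarrow> complex"
  is "\<lambda>f g. \<integral>p. cinner (f p) (g p) \<partial>torus_measure"
proof -
  fix f f' g g' :: "real \<times> real \<Rightarrow> 'a"
  assume eq: "torus_AE_eq f f'" "torus_AE_eq g g'"
  then have "AE p in torus_measure. f p = f' p" "AE p in torus_measure. g p = g' p"
    by (auto simp: torus_AE_eq_def)
  then have "AE p in torus_measure. cinner (f p) (g p) = cinner (f' p) (g' p)"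
    by eventually_elim simp
  moreover have "integrable torus_measure (\<lambda>p. cinner (f p) (g p))"
    "integrable torus_measure (\<lambda>p. cinner (f' p) (g' p))"
    using eq by (auto simp: torus_AE_eq_def intro!: integrable_cinner_torus)
  ultimately show "(\<integral>p. cinner (f p) (g p) \<partial>torus_measure) = (\<integral>p. cinner (f' p) (g' p) \<partial>torus_measure)"
    by (intro integral_cong_AE) auto
qed

instance
proof
  fix x y z :: "'a torus_L2" and a b :: complex and r :: real
  show "r *\<^sub>R x = complex_of_real r *\<^sub>C x"
    by transfer (auto simp: torus_AE_eq_def scaleR_eq_scaleC
        intro!: square_integrable_bounded_linear[OF bounded_linear_scaleC])
  show "a *\<^sub>C (x + y) = a *\<^sub>C x + a *\<^sub>C y"
    by transfer (auto simp: torus_AE_eq_def scaleC_add_right intro!: square_integrable_add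
        square_integrable_bounded_linear[OF bounded_linear_scaleC])
  show "(a + b) *\<^sub>C x = a *\<^sub>C x + b *\<^sub>C x"
    by transfer (auto simp: torus_AE_eq_def scaleC_add_left intro!: square_integrable_add
        square_integrable_bounded_linear[OF bounded_linear_scaleC])
  show "a *\<^sub>C (b *\<^sub>C x) = (a * b) *\<^sub>C x"
    by transfer (auto simp: torus_AE_eq_def scaleC_scaleC
        intro!: square_integrable_bounded_linear[OF bounded_linear_scaleC])
  show "cinner x y = cnj (cinner y x)"
  proof transfer
    fix f g :: "real \<times> real \<Rightarrow> 'a"
    show "(\<integral>p. cinner (f p) (g p) \<partial>torus_measure) = cnj (\<integral>p. cinner (g p) (f p) \<partial>torus_measure)"
      unfolding integral_cnj[symmetric] by (subst cinner_commute) simp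
  qed
  show "cinner x (y + z) = cinner x y + cinner x z"
    by transfer (simp add: cinner_add_right integrable_cinner_torus)
  show "cinner x (a *\<^sub>C y) = a * cinner x y"
    by transfer (simp add: cinner_scaleC_right)
  show "inner x y = Re (cinner x y)"
    by transfer (simp add: inner_eq_Re_cinner integrable_cinner_torus)
qed

end


section \<open>Smooth functions and the inverse Laplace operator on the flat torus\<close>

text \<open>
  For finite-dimensional domains this is the class $C^k$: it suffices that every directional
  derivative is of class $C^{k-1}$.
\<close>

primrec Ck :: "nat \<Rightarrow> ('a::real_normed_vector \<Rightarrow> 'b::real_normed_vector) \<Rightarrow> bool" where
  "Ck 0 f \<longleftrightarrow> continuous_on UNIV f"
| "Ck (Suc k) f \<longleftrightarrow> (\<forall>x. f differentiable (at x)) \<and> (\<forall>v. Ck k (\<lambda>x. frechet_derivative f (at x) v))"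

definition torus_smooth :: "(real \<times> real \<Rightarrow> 'a::euclidean_space) \<Rightarrow> bool" where
  "torus_smooth f \<longleftrightarrow> (\<forall>k. Ck k f) \<and>
     (\<forall>x y. f (x + 2 * pi, y) = f (x, y) \<and> f (x, y + 2 * pi) = f (x, y))"

definition partial1 :: "(real \<times> real \<Rightarrow> 'a::real_normed_vector) \<Rightarrow> real \<times> real \<Rightarrow> 'a" where
  "partial1 f p = frechet_derivative f (at p) (1, 0)"

definition partial2 :: "(real \<times> real \<Rightarrow> 'a::real_normed_vector) \<Rightarrow> real \<times> real \<Rightarrow> 'a" where
  "partial2 f p = frechet_derivative f (at p) (0, 1)"

definition torus_grad :: "(real \<times> real \<Rightarrow> real) \<Rightarrow> real \<times> real \<Rightarrow> real \<times> real" where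
  "torus_grad f p = (partial1 f p, partial2 f p)"

definition torus_div :: "(real \<times> real \<Rightarrow> real \<times> real) \<Rightarrow> real \<times> real \<Rightarrow> real" where
  "torus_div V p = partial1 (\<lambda>q. fst (V q)) p + partial2 (\<lambda>q. snd (V q)) p"

definition laplacian :: "(real \<times> real \<Rightarrow> real) \<Rightarrow> real \<times> real \<Rightarrow> real" where
  "laplacian f = torus_div (torus_grad f)"

definition H1_inner_smooth :: "(real \<times> real \<Rightarrow> real) \<Rightarrow> (real \<times> real \<Rightarrow> real) \<Rightarrow> real" where
  "H1_inner_smooth u v =
     (\<integral>p. u p * v p \<partial>torus_measure) + (\<integral>p. inner (torus_grad u p) (torus_grad v p) \<partial>torus_measure)"

definition B_smooth :: "(real \<times> real \<Rightarrow> real) \<Rightarrow> (real \<times> real \<Rightarrow> real) \<Rightarrow> real" where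
  "B_smooth u v = (\<integral>p. laplacian u p * v p \<partial>torus_measure)"

text \<open>
  The completion of the smooth functions, as a subspace of the real $L^2$ space: \<open>u\<close> is
  represented by the \<open>H1\<close>-Cauchy sequences of smooth functions that converge to it in $L^2$.
  A bilinear form on smooth functions is extended by continuity along such sequences.
\<close>

definition H1_represents :: "(nat \<Rightarrow> real \<times> real \<Rightarrow> real) \<Rightarrow> real torus_L2 \<Rightarrow> bool" where
  "H1_represents \<phi> u \<longleftrightarrow> (\<forall>n. torus_smooth (\<phi> n)) \<and>
     (\<forall>e>0. \<exists>N. \<forall>m\<ge>N. \<forall>n\<ge>N.
        H1_inner_smooth (\<lambda>p. \<phi> m p - \<phi> n p) (\<lambda>p. \<phi> m p - \<phi> n p) < e) \<and>
     (\<lambda>n. L2_class (\<phi> n)) \<longlonglongrightarrow> u"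

definition H1 :: "real torus_L2 set" where
  "H1 = {u. \<exists>\<phi>. H1_represents \<phi> u}"

definition H1_extension ::
  "((real \<times> real \<Rightarrow> real) \<Rightarrow> (real \<times> real \<Rightarrow> real) \<Rightarrow> real) \<Rightarrow> real torus_L2 \<Rightarrow> real torus_L2 \<Rightarrow> real"
where
  "H1_extension b u v = (THE l. \<forall>\<phi> \<psi>. H1_represents \<phi> u \<longrightarrow> H1_represents \<psi> v \<longrightarrow>
     (\<lambda>n. b (\<phi> n) (\<psi> n)) \<longlonglongrightarrow> l)"

definition H1_inner :: "real torus_L2 \<Rightarrow> real torus_L2 \<Rightarrow> real" where
  "H1_inner = H1_extension H1_inner_smooth"

definition B_form :: "real torus_L2 \<Rightarrow> real torus_L2 \<Rightarrow> real" where
  "B_form = H1_extension B_smooth"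

definition K_space :: "real torus_L2 set" where
  "K_space = {u \<in> H1. \<forall>v\<in>H1. B_form u v = 0}"

definition K_perp :: "real torus_L2 set" where
  "K_perp = {u \<in> H1. \<forall>w\<in>K_space. H1_inner u w = 0}"

definition Dinv_real :: "real torus_L2 \<Rightarrow> real torus_L2" where
  "Dinv_real h = (THE u. u \<in> K_perp \<and> (\<forall>v\<in>K_perp. B_form u v = inner h v))"

lift_definition Re_L2 :: "complex torus_L2 \<Rightarrow> real torus_L2" is "\<lambda>f p. Re (f p)"
  by (auto simp: torus_AE_eq_def intro!: square_integrable_bounded_linear[OF bounded_linear_Re])

lift_definition Im_L2 :: "complex torus_L2 \<Rightarrow> real torus_L2" is "\<lambda>f p. Im (f p)"
  by (auto simp: torus_AE_eq_def intro!: square_integrable_bounded_linear[OF bounded_linear_Im])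

lift_definition of_real_L2 :: "real torus_L2 \<Rightarrow> complex torus_L2" is "\<lambda>f p. complex_of_real (f p)"
  by (auto simp: torus_AE_eq_def intro!: square_integrable_bounded_linear[OF bounded_linear_of_real])

definition Dinv :: "complex torus_L2 \<Rightarrow> complex torus_L2" where
  "Dinv f = of_real_L2 (Dinv_real (Re_L2 f)) + \<i> *\<^sub>C of_real_L2 (Dinv_real (Im_L2 f))"


section \<open>The operator $P$ on the torus\<close>

definition torus_exponential :: "int \<Rightarrow> int \<Rightarrow> real \<times> real \<Rightarrow> complex" where
  "torus_exponential k m p =
     complex_of_real (1 / (2 * pi)) * exp (\<i> * of_int k * of_real (fst p)) *
       exp (\<i> * of_int m * of_real (snd p))"

definition Lambda :: "complex torus_L2 set" where
  "Lambda = cspan (range (\<lambda>(k, m). L2_class (torus_exponential k m)))"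

text \<open>The derivative is taken of the smooth representative, which is unique.\<close>

definition dstar :: "complex torus_L2 \<Rightarrow> complex torus_L2" where
  "dstar f = (THE h. \<exists>g. torus_smooth g \<and> f = L2_class g \<and>
     h = L2_class (\<lambda>p. partial1 g p + partial2 g p))"

definition P_torus :: "complex torus_L2 \<Rightarrow> complex torus_L2" where
  "P_torus = (THE A. bounded_clinear A \<and> (\<forall>f\<in>Lambda. A f = dstar (Dinv f)))"

end

theory Submission
  imports Defs
begin

text \<open>
  The exponentials form an orthonormal basis of eigenvectors of the operator: the Laplacian
  multiplies the exponential with frequencies \<open>k\<close>, \<open>m\<close> by \<open>- (k\<^sup>2 + m\<^sup>2)\<close> and
  \<open>d\<^sup>*\<close> multiplies it by \<open>\<i> (k + m)\<close>. So \<open>P_torus\<close> has the eigenvalue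
  \<open>- \<i> (k + m) / (k\<^sup>2 + m\<^sup>2)\<close> there, and it annihilates constants
  (\<open>P_torus_diagonal\<close>). The eigenvalues of the power \<open>n\<close> are absolutely summable once
  \<open>n \<ge> 4\<close> (\<open>torus_eigenvalue_power_summable\<close>), and for even \<open>n\<close> their factor
  \<open>(- \<i>) ^ n\<close> equals \<open>\<i> ^ n\<close>. The trace is the sum of the eigenvalues.

  Three ingredients turn this into a proof. The first is about an arbitrary complex Hilbert space:
  an operator that is diagonal in some orthonormal basis with absolutely summable eigenvalues is
  trace class, and its diagonal matrix elements in any other basis sum to the sum of the
  eigenvalues (\<open>diagonal_op_trace_class\<close>, \<open>diagonal_op_trace\<close>). The absolute value of
  such an operator is determined directly on eigenvectors (\<open>positive_sqrt_eigenvector\<close>).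

  The second is the completeness of the exponentials (\<open>closure_Lambda\<close>): the
  Stone--Weierstrass theorem on a product of two circles approximates continuous functions, and
  measure theory passes from these to indicators of Borel sets and to all square-integrable functions.

  The third is the evaluation of the inverse Laplace operator on trigonometric polynomials. It is
  defined through extensions by continuity to the Sobolev space, which are well defined because the
  gradient is closable (\<open>gradient_closable\<close>), a consequence of integration by parts. If
  \<open>q\<close> is a trigonometric polynomial, then a trigonometric polynomial \<open>w\<close> with Laplacian
  \<open>q\<close> up to a constant, which is itself a Laplacian, is the value at \<open>q\<close>
  (\<open>Dinv_smooth\<close>).
\<close>

section \<open>Complex inner products\<close>

lemma cinner_add_left: "cinner (x + y) z = cinner x z + cinner y z"
  by (metis cinner_add_right cinner_commute complex_cnj_add)

lemma cinner_zero_right [simp]: "cinner x 0 = 0"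
  using cinner_add_right[of x 0 0] by simp

lemma cinner_minus_right: "cinner x (- y) = - cinner x y"
  using cinner_add_right[of x y "- y"] by (simp add: eq_neg_iff_add_eq_0 add.commute)

lemma cinner_diff_right: "cinner x (y - z) = cinner x y - cinner x z"
  using cinner_add_right[of x y "- z"] by (simp add: cinner_minus_right)

lemma cinner_diff_left: "cinner (x - y) z = cinner x z - cinner y z"
  by (metis cinner_commute cinner_diff_right complex_cnj_diff)

lemma cinner_sum_right: "cinner x (\<Sum>i\<in>I. f i) = (\<Sum>i\<in>I. cinner x (f i))"
  by (induction I rule: infinite_finite_induct) (auto simp: cinner_add_right)

lemma cinner_self: "cinner x x = complex_of_real ((norm x)\<^sup>2)"
proof -
  have "cinner x x = cnj (cinner x x)"
    by (rule cinner_commute)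
  then have "Im (cinner x x) = 0"
    by (simp add: complex_eq_iff)
  then show ?thesis
    by (simp add: complex_eq_iff power2_norm_eq_inner inner_eq_Re_cinner)
qed

lemma cinner_cauchy_schwarz: "cmod (cinner x y) \<le> norm x * norm y"
proof (cases "cinner x y = 0")
  case False
  define u where "u = cnj (cinner x y) / complex_of_real (cmod (cinner x y))"
  have u: "cmod u = 1"
    using False by (simp add: u_def norm_divide)
  have "cinner x (u *\<^sub>C y) = complex_of_real (cmod (cinner x y))"
    using False complex_norm_square[of "cinner x y"]
    by (simp add: u_def cinner_scaleC_right mult.commute power2_eq_square field_simps)
  then have "cmod (cinner x y) = inner x (u *\<^sub>C y)"
    by (simp add: inner_eq_Re_cinner)
  also have "\<dots> \<le> norm x * norm (u *\<^sub>C y)"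
    by (rule norm_cauchy_schwarz)
  finally show ?thesis
    by (simp add: norm_scaleC u)
qed auto

lemma bounded_linear_cinner_right: "bounded_linear (cinner x)"
proof (rule bounded_linear_intro[where K = "norm x"])
  show "norm (cinner x y) \<le> norm y * norm x" for y
    using cinner_cauchy_schwarz[of x y] by (simp only: mult.commute)
qed (auto simp: cinner_add_right cinner_scaleC_right scaleR_eq_scaleC scaleC_complex_def)

lemma bounded_clinear_bounded_linear: "bounded_clinear A \<Longrightarrow> bounded_linear A"
  by (simp add: bounded_clinear_def)

lemma bounded_clinear_scaleC: "bounded_clinear A \<Longrightarrow> A (c *\<^sub>C x) = c *\<^sub>C A x"
  by (simp add: bounded_clinear_def)

lemma bounded_clinear_id: "bounded_clinear (\<lambda>x. x)"
  by (simp add: bounded_clinear_def bounded_linear_ident)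

lemma bounded_clinear_compose: "bounded_clinear A \<Longrightarrow> bounded_clinear B \<Longrightarrow> bounded_clinear (A \<circ> B)"
  by (auto simp: bounded_clinear_def o_def intro: bounded_linear_compose)

lemma bounded_clinear_eq_on_dense_span:
  assumes A: "bounded_clinear A" and B: "bounded_clinear B"
    and E: "closure (cspan E) = UNIV" and eq: "\<And>e. e \<in> E \<Longrightarrow> A e = B e"
  shows "A = B"
proof
  fix x
  interpret A: bounded_linear A by (rule bounded_clinear_bounded_linear[OF A])
  interpret B: bounded_linear B by (rule bounded_clinear_bounded_linear[OF B])
  have span: "A y = B y" if "y \<in> cspan E" for y
    using that
    by (induction rule: complex_vector.span_induct_alt)
       (auto simp: A.zero B.zero A.add B.add bounded_clinear_scaleC[OF A]
         bounded_clinear_scaleC[OF B] eq)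
  have "closed {x. A x = B x}"
    by (intro closed_Collect_eq A.continuous_on B.continuous_on continuous_on_id)
  then have "closure (cspan E) \<subseteq> {x. A x = B x}"
    using span by (intro closure_minimal) auto
  then show "A x = B x"
    using E by auto
qed

section \<open>Orthonormal bases\<close>

definition orthonormal_set :: "'a::complex_inner set \<Rightarrow> bool" where
  "orthonormal_set E \<longleftrightarrow> (\<forall>x\<in>E. \<forall>y\<in>E. cinner x y = (if x = y then 1 else 0))"

lemma onb_orthonormal: "is_orthonormal_basis E \<Longrightarrow> orthonormal_set E"
  by (simp add: is_orthonormal_basis_def orthonormal_set_def)

lemma onb_cinner:
  "is_orthonormal_basis E \<Longrightarrow> x \<in> E \<Longrightarrow> y \<in> E \<Longrightarrow> cinner x y = (if x = y then 1 else 0)"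
  by (simp add: is_orthonormal_basis_def)

lemma norm_sum_orthonormal:
  assumes "orthonormal_set E"
    and "finite F" "F \<subseteq> E"
  shows "(norm (\<Sum>e\<in>F. c e *\<^sub>C e))\<^sup>2 = (\<Sum>e\<in>F. (cmod (c e))\<^sup>2)"
  using assms(2,3)
proof (induction F rule: finite_induct)
  case (insert e F)
  let ?s = "\<Sum>e\<in>F. c e *\<^sub>C e"
  have "cinner (c e *\<^sub>C e) ?s = 0"
    using insert assms(1) unfolding orthonormal_set_def
    by (auto simp: cinner_sum_right cinner_scaleC_left cinner_scaleC_right intro!: sum.neutral)
  then have orth: "inner (c e *\<^sub>C e) ?s = 0"
    by (simp add: inner_eq_Re_cinner)
  have "inner e e = 1"
    using assms(1) insert by (simp add: inner_eq_Re_cinner orthonormal_set_def)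
  then have "norm e = 1"
    by (simp add: norm_eq_1)
  then show ?case
    using insert orth norm_add_Pythagorean[of "c e *\<^sub>C e" ?s]
    by (simp add: orthogonal_def norm_scaleC)
qed auto

text \<open>
  Completing the square separates the error of the best approximation, whose coefficients are
  the Fourier coefficients of \<open>x\<close>, from the cost of choosing other coefficients. Bessel's
  inequality and the convergence of Fourier expansions are both read off from this identity.
\<close>

lemma norm_diff_orthonormal_sum:
  assumes orth: "orthonormal_set E"
    and F: "finite F" "F \<subseteq> E"
  shows "(norm (x - (\<Sum>e\<in>F. c e *\<^sub>C e)))\<^sup>2 =
    (norm x)\<^sup>2 - (\<Sum>e\<in>F. (cmod (cinner e x))\<^sup>2) + (\<Sum>e\<in>F. (cmod (c e - cinner e x))\<^sup>2)"
proof -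
  have "(cmod (w - z))\<^sup>2 = (cmod w)\<^sup>2 - 2 * Re (w * cnj z) + (cmod z)\<^sup>2" for w z
    by (simp only: cmod_power2) (simp add: power2_eq_square algebra_simps)
  then have eq: "(cmod (c e - cinner e x))\<^sup>2
      = (cmod (c e))\<^sup>2 - 2 * Re (c e * cinner x e) + (cmod (cinner e x))\<^sup>2" for e
    by (metis cinner_commute)
  have square: "(norm (x - s))\<^sup>2 = (norm x)\<^sup>2 - 2 * inner x s + (norm s)\<^sup>2" for s
    by (simp add: power2_norm_eq_inner inner_diff_left inner_diff_right inner_commute)
  have "inner x (\<Sum>e\<in>F. c e *\<^sub>C e) = (\<Sum>e\<in>F. Re (c e * cinner x e))"
    by (simp add: inner_eq_Re_cinner cinner_sum_right cinner_scaleC_right)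
  then have "(norm (x - (\<Sum>e\<in>F. c e *\<^sub>C e)))\<^sup>2
      = (norm x)\<^sup>2 - 2 * (\<Sum>e\<in>F. Re (c e * cinner x e)) + (\<Sum>e\<in>F. (cmod (c e))\<^sup>2)"
    unfolding square norm_sum_orthonormal[OF orth F] by simp
  then show ?thesis
    unfolding eq by (simp add: sum.distrib sum_subtractf sum_distrib_left)
qed

lemma bessel_inequality:
  assumes "orthonormal_set E"
    and "finite F" "F \<subseteq> E"
  shows "(\<Sum>e\<in>F. (cmod (cinner e x))\<^sup>2) \<le> (norm x)\<^sup>2"
  using norm_diff_orthonormal_sum[OF assms, of x "\<lambda>e. cinner e x"]
    zero_le_power2[of "norm (x - (\<Sum>e\<in>F. cinner e x *\<^sub>C e))"]
  by simp

text \<open>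
  Density provides some combination of basis vectors close to \<open>x\<close>. The Fourier sum over any
  larger finite set is at least as close, which makes the approximation uniform in \<open>G\<close>.
\<close>

lemma onb_approx:
  assumes E: "is_orthonormal_basis E" and "0 < \<epsilon>"
  obtains F where "finite F" "F \<subseteq> E"
    "\<And>G. finite G \<Longrightarrow> F \<subseteq> G \<Longrightarrow> G \<subseteq> E \<Longrightarrow> norm (x - (\<Sum>e\<in>G. cinner e x *\<^sub>C e)) < \<epsilon>"
proof -
  note orth = onb_orthonormal[OF E]
  have "x \<in> closure (cspan E)"
    using E by (simp add: is_orthonormal_basis_def)
  then obtain y where y: "y \<in> cspan E" "norm (x - y) < \<epsilon>"
    using \<open>0 < \<epsilon>\<close> unfolding closure_approachable by (metis dist_norm norm_minus_commute)
  from y(1) obtain F c where F: "finite F" "F \<subseteq> E" "y = (\<Sum>e\<in>F. c e *\<^sub>C e)"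
    unfolding complex_vector.span_explicit by blast
  have "norm (x - (\<Sum>e\<in>G. cinner e x *\<^sub>C e)) < \<epsilon>" if G: "finite G" "F \<subseteq> G" "G \<subseteq> E" for G
  proof -
    define d where "d e = (if e \<in> F then c e else 0)" for e
    have "y = (\<Sum>e\<in>G. d e *\<^sub>C e)"
      unfolding F(3) d_def using G by (intro sum.mono_neutral_cong_left) auto
    then have "(norm (x - (\<Sum>e\<in>G. cinner e x *\<^sub>C e)))\<^sup>2 \<le> (norm (x - y))\<^sup>2"
      by (simp add: norm_diff_orthonormal_sum[OF orth G(1,3)] sum_nonneg)
    then have "norm (x - (\<Sum>e\<in>G. cinner e x *\<^sub>C e)) \<le> norm (x - y)"
      by (rule power2_le_imp_le) simp
    with y(2) show ?thesis
      by simp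
  qed
  with F show ?thesis
    using that by blast
qed

lemma onb_expansion:
  assumes E: "is_orthonormal_basis E"
  shows "((\<lambda>e. cinner e x *\<^sub>C e) has_sum x) E"
  unfolding has_sum_def tendsto_iff eventually_finite_subsets_at_top
proof (intro allI impI)
  fix \<epsilon> :: real assume "0 < \<epsilon>"
  obtain F where "finite F" "F \<subseteq> E"
    "\<And>G. finite G \<Longrightarrow> F \<subseteq> G \<Longrightarrow> G \<subseteq> E \<Longrightarrow> norm (x - (\<Sum>e\<in>G. cinner e x *\<^sub>C e)) < \<epsilon>"
    using onb_approx[OF E \<open>0 < \<epsilon>\<close>, of x] by metis
  then show "\<exists>X. finite X \<and> X \<subseteq> E \<and> (\<forall>Y. finite Y \<and> X \<subseteq> Y \<and> Y \<subseteq> E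
      \<longrightarrow> dist (\<Sum>e\<in>Y. cinner e x *\<^sub>C e) x < \<epsilon>)"
    by (metis dist_commute dist_norm)
qed

lemma onb_parseval_cinner:
  assumes E: "is_orthonormal_basis E"
  shows "((\<lambda>e. cinner e x * cinner y e) has_sum cinner y x) E"
  using has_sum_bounded_linear[OF bounded_linear_cinner_right onb_expansion[OF E, of x], of y]
  by (simp add: cinner_scaleC_right o_def)

lemma onb_parseval:
  assumes E: "is_orthonormal_basis E"
  shows "((\<lambda>e. (cmod (cinner e x))\<^sup>2) has_sum (norm x)\<^sup>2) E"
proof -
  have "cinner e x * cinner x e = complex_of_real ((cmod (cinner e x))\<^sup>2)" for e
    by (metis cinner_commute complex_norm_square)
  then have "((\<lambda>e. complex_of_real ((cmod (cinner e x))\<^sup>2)) has_sum complex_of_real ((norm x)\<^sup>2)) E"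
    using onb_parseval_cinner[OF E, of x x] by (simp only: cinner_self)
  from has_sum_Re[OF this] show ?thesis
    by (simp only: Re_complex_of_real)
qed

text \<open>
  Such a series need not converge absolutely. By Pythagoras its tails are controlled by the tails
  of the sum of the \<open>(cmod (c e))\<^sup>2\<close>, so its partial sums are Cauchy, and completeness
  of the space yields a limit.
\<close>

lemma summable_on_orthonormal:
  fixes c :: "'a::chilbert_space \<Rightarrow> complex"
  assumes orth: "orthonormal_set E"
    and c: "(\<lambda>e. (cmod (c e))\<^sup>2) summable_on E"
  shows "(\<lambda>e. c e *\<^sub>C e) summable_on E"
proof -
  let ?S = "\<lambda>F. \<Sum>e\<in>F. c e *\<^sub>C e"
  have "\<exists>P. eventually P (finite_subsets_at_top E) \<and>
      (\<forall>F G. P F \<and> P G \<longrightarrow> dist (?S F) (?S G) < \<epsilon>)" if "0 < \<epsilon>" for \<epsilon> :: real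
  proof -
    obtain t where t: "((\<lambda>e. (cmod (c e))\<^sup>2) has_sum t) E"
      using c by (auto simp: summable_on_def)
    obtain H where H: "finite H" "H \<subseteq> E"
      "\<And>G. finite G \<Longrightarrow> H \<subseteq> G \<Longrightarrow> G \<subseteq> E \<Longrightarrow> dist (\<Sum>e\<in>G. (cmod (c e))\<^sup>2) t < (\<epsilon> / 2)\<^sup>2 / 2"
      using t \<open>0 < \<epsilon>\<close> unfolding has_sum_def tendsto_iff eventually_finite_subsets_at_top by (metis half_gt_zero zero_less_power)
    define P where "P F \<longleftrightarrow> finite F \<and> H \<subseteq> F \<and> F \<subseteq> E" for F
    have "eventually P (finite_subsets_at_top E)"
      unfolding P_def eventually_finite_subsets_at_top using H by blast
    moreover have near: "dist (?S F) (?S H) < \<epsilon> / 2" if "P F" for F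
    proof -
      have F: "finite F" "H \<subseteq> F" "F \<subseteq> E"
        using that by (auto simp: P_def)
      have "?S F - ?S H = ?S (F - H)"
        using F by (simp add: sum_diff)
      then have "(dist (?S F) (?S H))\<^sup>2 = (\<Sum>e\<in>F - H. (cmod (c e))\<^sup>2)"
        using F norm_sum_orthonormal[OF orth, of "F - H" c]
        by (simp add: dist_norm subset_iff)
      also have "\<dots> = (\<Sum>e\<in>F. (cmod (c e))\<^sup>2) - (\<Sum>e\<in>H. (cmod (c e))\<^sup>2)"
        using F H by (simp add: sum_diff)
      also have "\<dots> < (\<epsilon> / 2)\<^sup>2"
        using H(3)[OF F] H(3)[OF H(1) order_refl H(2)] unfolding dist_real_def by argo
      finally show ?thesis
        by (rule power_less_imp_less_base) (use \<open>0 < \<epsilon>\<close> in simp)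
    qed
    moreover have "dist (?S F) (?S G) < \<epsilon>" if "P F" "P G" for F G
      using near[OF that(1)] near[OF that(2)] dist_triangle2[of "?S F" "?S G" "?S H"] by linarith
    ultimately show ?thesis
      by blast
  qed
  then have "cauchy_filter (filtermap ?S (finite_subsets_at_top E))"
    by (simp add: cauchy_filter_metric_filtermap)
  moreover have "complete (UNIV :: 'a set)"
    by (meson Cauchy_convergent UNIV_I complete_def convergent_def)
  ultimately obtain l where "(?S \<longlongrightarrow> l) (finite_subsets_at_top E)"
    using complete_uniform[where S = "UNIV :: 'a set"] by (force simp add: filterlim_def)
  then show ?thesis
    by (auto simp: summable_on_def has_sum_def)
qed

section \<open>Diagonal operators\<close>

text \<open>
  Orthonormal bases are unindexed sets, so the eigenvalue is a function of the basis vector itself.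
\<close>

definition diagonal_op :: "'a::chilbert_space set \<Rightarrow> ('a \<Rightarrow> complex) \<Rightarrow> ('a \<Rightarrow> 'a) \<Rightarrow> bool" where
  "diagonal_op E l A \<longleftrightarrow> bounded_clinear A \<and> (\<forall>e\<in>E. A e = l e *\<^sub>C e)"

lemma diagonal_op_unique:
  assumes "is_orthonormal_basis E" "diagonal_op E l A" "diagonal_op E l B"
  shows "A = B"
  using assms bounded_clinear_eq_on_dense_span[of A B E]
  by (auto simp: diagonal_op_def is_orthonormal_basis_def)

text \<open>
  The operator multiplies Fourier coefficients by the eigenvalues; these being bounded, the
  new coefficients are again square summable.
\<close>

lemma diagonal_op_exists:
  assumes E: "is_orthonormal_basis E" and l: "\<And>e. e \<in> E \<Longrightarrow> cmod (l e) \<le> C"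
  obtains A where "diagonal_op E l A"
proof
  note orth = onb_orthonormal[OF E]
  define A where "A x = (\<Sum>\<^sub>\<infinity>e\<in>E. (l e * cinner e x) *\<^sub>C e)" for x
  have sq: "(\<lambda>e. (cmod (l e * cinner e x))\<^sup>2) summable_on E" for x
  proof (rule summable_on_comparison_test)
    show "(\<lambda>e. C\<^sup>2 * (cmod (cinner e x))\<^sup>2) summable_on E"
      using onb_parseval[OF E, of x] by (intro summable_on_cmult_right) (auto simp: summable_on_def)
    show "(cmod (l e * cinner e x))\<^sup>2 \<le> C\<^sup>2 * (cmod (cinner e x))\<^sup>2" if "e \<in> E" for e
      using l[OF that] by (auto simp: norm_mult power_mult_distrib intro!: mult_right_mono power_mono)
  qed auto
  have A: "((\<lambda>e. (l e * cinner e x) *\<^sub>C e) has_sum A x) E" for x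
    unfolding A_def by (intro has_sum_infsum summable_on_orthonormal[OF orth] sq)
  have add: "A (x + y) = A x + A y" for x y
    using has_sum_add[OF A[of x] A[of y]] A[of "x + y"] has_sum_unique
    by (fastforce simp: cinner_add_right distrib_left scaleC_add_left)
  have scale: "A (c *\<^sub>C x) = c *\<^sub>C A x" for c x
  proof -
    have eq: "c *\<^sub>C (l e * cinner e x) *\<^sub>C e = (l e * cinner e (c *\<^sub>C x)) *\<^sub>C e" for e
      by (simp add: cinner_scaleC_right scaleC_scaleC mult_ac)
    have "((\<lambda>e. (l e * cinner e (c *\<^sub>C x)) *\<^sub>C e) has_sum c *\<^sub>C A x) E"
      using has_sum_bounded_linear[OF bounded_linear_scaleC A[of x], of c] by (simp only: o_def eq)
    then show ?thesis
      using A[of "c *\<^sub>C x"] has_sum_unique by blast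
  qed
  have bound: "norm (A x) \<le> norm x * \<bar>C\<bar>" for x
  proof (rule tendsto_upperbound)
    show "((\<lambda>F. norm (\<Sum>e\<in>F. (l e * cinner e x) *\<^sub>C e)) \<longlongrightarrow> norm (A x)) (finite_subsets_at_top E)"
      using A[of x] unfolding has_sum_def by (rule tendsto_norm)
    show "\<forall>\<^sub>F F in finite_subsets_at_top E. norm (\<Sum>e\<in>F. (l e * cinner e x) *\<^sub>C e) \<le> norm x * \<bar>C\<bar>"
    proof (rule eventually_finite_subsets_at_top_weakI)
      fix F assume F: "finite F" "F \<subseteq> E"
      have "(norm (\<Sum>e\<in>F. (l e * cinner e x) *\<^sub>C e))\<^sup>2 = (\<Sum>e\<in>F. (cmod (l e * cinner e x))\<^sup>2)"
        by (rule norm_sum_orthonormal[OF orth F])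
      also have "\<dots> \<le> (\<Sum>e\<in>F. C\<^sup>2 * (cmod (cinner e x))\<^sup>2)"
        using F l by (intro sum_mono)
          (auto simp: norm_mult power_mult_distrib intro!: mult_right_mono power_mono)
      also have "\<dots> \<le> C\<^sup>2 * (norm x)\<^sup>2"
        using bessel_inequality[OF orth F, of x] by (simp add: sum_distrib_left[symmetric] mult_left_mono)
      also have "\<dots> = (norm x * \<bar>C\<bar>)\<^sup>2"
        by (simp add: power_mult_distrib)
      finally show "norm (\<Sum>e\<in>F. (l e * cinner e x) *\<^sub>C e) \<le> norm x * \<bar>C\<bar>"
        by (rule power2_le_imp_le) simp
    qed
  qed simp
  have "A e = l e *\<^sub>C e" if "e \<in> E" for e
  proof -
    have "((\<lambda>f. (l f * cinner f e) *\<^sub>C f) has_sum (\<Sum>f\<in>{e}. (l f * cinner f e) *\<^sub>C f)) E"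
      using that by (intro has_sum_finite_neutralI[of "{e}"]) (auto simp: onb_cinner[OF E])
    then have "A e = (\<Sum>f\<in>{e}. (l f * cinner f e) *\<^sub>C f)"
      using A[of e] has_sum_unique by blast
    then show ?thesis
      using onb_cinner[OF E that that] by simp
  qed
  moreover have "bounded_linear A"
    by (rule bounded_linear_intro[where K = "\<bar>C\<bar>"]) (auto simp: add scale scaleR_eq_scaleC bound)
  ultimately show "diagonal_op E l A"
    by (simp add: diagonal_op_def bounded_clinear_def scale)
qed

text \<open>
  The matrix element of a diagonal operator is the Parseval series weighted by the eigenvalues.
  Adjoints, positivity and traces are all computed from this series.
\<close>

lemma diagonal_op_cinner:
  assumes E: "is_orthonormal_basis E" and A: "diagonal_op E l A"
  shows "((\<lambda>e. l e * (cinner e x * cinner y e)) has_sum cinner y (A x)) E"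
proof -
  have A': "bounded_clinear A" "\<And>e. e \<in> E \<Longrightarrow> A e = l e *\<^sub>C e"
    using A by (auto simp: diagonal_op_def)
  have "((\<lambda>e. cinner y (A (cinner e x *\<^sub>C e))) has_sum cinner y (A x)) E"
    using has_sum_bounded_linear[OF bounded_linear_compose[OF bounded_linear_cinner_right
          bounded_clinear_bounded_linear[OF A'(1)]] onb_expansion[OF E, of x], of y]
    by (simp add: o_def)
  then show ?thesis
    by (rule has_sum_cong[THEN iffD1, rotated])
       (simp add: A' bounded_clinear_scaleC cinner_scaleC_right mult_ac)
qed

lemma diagonal_op_adjoint:
  assumes E: "is_orthonormal_basis E" and A: "diagonal_op E l A"
    and B: "diagonal_op E (\<lambda>e. cnj (l e)) B"
  shows "adjoint_op A = B"
proof -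
  have adj: "cinner (B x) y = cinner x (A y)" for x y
  proof -
    have "((\<lambda>e. cnj (cnj (l e) * (cinner e x * cinner y e))) has_sum cnj (cinner y (B x))) E"
      using diagonal_op_cinner[OF E B, of x y] by (simp only: has_sum_cnj_iff)
    then have "((\<lambda>e. l e * (cinner e y * cinner x e)) has_sum cinner (B x) y) E"
      by (simp add: cinner_commute[symmetric] mult_ac)
    with diagonal_op_cinner[OF E A, of y x] show ?thesis
      using has_sum_unique by blast
  qed
  have uniq: "B' = B" if "\<And>x y. cinner (B' x) y = cinner x (A y)" for B'
  proof
    fix x
    have "cinner (B' x - B x) (B' x - B x) = 0"
      by (simp add: cinner_diff_left that adj)
    then show "B' x = B x"
      by (simp add: cinner_self)
  qed
  show ?thesis
    unfolding adjoint_op_def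
    using B adj uniq by (intro the_equality) (auto simp: diagonal_op_def)
qed

lemma diagonal_op_compose:
  assumes "diagonal_op E l A" "diagonal_op E m B"
  shows "diagonal_op E (\<lambda>e. m e * l e) (A \<circ> B)"
  using assms by (auto simp: diagonal_op_def bounded_clinear_compose bounded_clinear_scaleC scaleC_scaleC)

lemma diagonal_op_funpow:
  assumes "diagonal_op E l A"
  shows "diagonal_op E (\<lambda>e. l e ^ n) (A ^^ n)"
proof (induction n)
  case 0
  show ?case by (simp add: diagonal_op_def bounded_clinear_id id_def)
next
  case (Suc n)
  from diagonal_op_compose[OF assms this] show ?case
    by (simp add: mult.commute comp_def)
qed

section \<open>Absolute value and trace of a diagonal operator\<close>

text \<open>
  Polarization: the quadratic form is real at \<open>x + y\<close> and at \<open>x + \<i> *\<^sub>C y\<close>,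
  which gives the imaginary and the real part of the claim.
\<close>

lemma positive_op_symmetric:
  assumes "positive_op S"
  shows "cinner (S x) y = cinner x (S y)"
proof -
  have S: "bounded_clinear S" and real: "\<And>z. Im (cinner z (S z)) = 0"
    using assms by (auto simp: positive_op_def)
  interpret S: bounded_linear S by (rule bounded_clinear_bounded_linear[OF S])
  have "Im (cinner (x + y) (S (x + y))) = 0"
    by (rule real)
  then have 1: "Im (cinner x (S y)) + Im (cinner y (S x)) = 0"
    using real[of x] real[of y] by (simp add: S.add cinner_add_left cinner_add_right)
  have "Im (cinner (x + \<i> *\<^sub>C y) (S (x + \<i> *\<^sub>C y))) = 0"
    by (rule real)
  then have 2: "Re (cinner x (S y)) - Re (cinner y (S x)) = 0"
    using real[of x] real[of y]
    by (simp add: S.add bounded_clinear_scaleC[OF S] cinner_add_left cinner_add_right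
        cinner_scaleC_left cinner_scaleC_right)
  show ?thesis
    using 1 2 unfolding cinner_commute[of "S x" y] by (simp add: complex_eq_iff)
qed

text \<open>
  This makes the square root in the definition of \<open>abs_op\<close> unique for diagonal operators.
  Since \<open>(S + t) (S - t) e = 0\<close>, the vector
  \<open>(S - t) e\<close> is either zero or an eigenvector for the eigenvalue \<open>- t\<close>, and the latter
  contradicts positivity when \<open>t > 0\<close>. For \<open>t = 0\<close> symmetry gives
  \<open>cinner (S e) (S e) = cinner e (S (S e)) = 0\<close>.
\<close>

lemma positive_sqrt_eigenvector:
  assumes S: "positive_op S" and t: "0 \<le> t"
    and e: "S (S e) = complex_of_real (t\<^sup>2) *\<^sub>C e"
  shows "S e = complex_of_real t *\<^sub>C e"
proof -
  have bS: "bounded_clinear S" and pos: "\<And>z. 0 \<le> Re (cinner z (S z))"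
    using S by (auto simp: positive_op_def)
  interpret S: bounded_linear S by (rule bounded_clinear_bounded_linear[OF bS])
  show ?thesis
  proof (cases "t = 0")
    case True
    have "cinner (S e) (S e) = cinner e (S (S e))"
      by (rule positive_op_symmetric[OF S])
    also have "\<dots> = 0"
      using e True by (simp add: cinner_scaleC_right)
    finally show ?thesis
      using True by (simp add: cinner_self)
  next
    case False
    define x where "x = S e - complex_of_real t *\<^sub>C e"
    have "S x = complex_of_real (t\<^sup>2) *\<^sub>C e - complex_of_real t *\<^sub>C S e"
      by (simp add: x_def S.diff e bounded_clinear_scaleC[OF bS])
    also have "\<dots> = - (complex_of_real t *\<^sub>C x)"
      by (simp add: x_def complex_vector.scale_right_diff_distrib scaleC_scaleC power2_eq_square)
    finally have "Re (cinner x (S x)) = - (t * (norm x)\<^sup>2)"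
      by (simp add: cinner_minus_right cinner_scaleC_right cinner_self)
    with pos[of x] have "t * (norm x)\<^sup>2 \<le> 0"
      by simp
    then have "x = 0"
      using False t by (auto simp: mult_le_0_iff)
    then show ?thesis
      by (simp add: x_def)
  qed
qed

lemma diagonal_op_positive:
  assumes E: "is_orthonormal_basis E" and A: "diagonal_op E (\<lambda>e. complex_of_real (t e)) A"
    and t: "\<And>e. e \<in> E \<Longrightarrow> 0 \<le> t e"
  shows "positive_op A"
  unfolding positive_op_def
proof (intro conjI allI)
  show "bounded_clinear A"
    using A by (simp add: diagonal_op_def)
  fix x
  have eq: "complex_of_real (t e) * (cinner e x * cinner x e)
      = complex_of_real (t e * (cmod (cinner e x))\<^sup>2)" for e
    by (metis cinner_commute complex_norm_square of_real_mult)
  have s: "((\<lambda>e. complex_of_real (t e * (cmod (cinner e x))\<^sup>2)) has_sum cinner x (A x)) E"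
    using diagonal_op_cinner[OF E A, of x x] by (simp only: eq)
  have "((\<lambda>e. 0) has_sum Im (cinner x (A x))) E"
    using has_sum_Im[OF s] by (simp only: Im_complex_of_real)
  then show "Im (cinner x (A x)) = 0"
    by (metis has_sum_0 has_sum_unique)
  have "((\<lambda>e. t e * (cmod (cinner e x))\<^sup>2) has_sum Re (cinner x (A x))) E"
    using has_sum_Re[OF s] by (simp only: Re_complex_of_real)
  then show "0 \<le> Re (cinner x (A x))"
    using t by (auto intro: has_sum_nonneg)
qed

text \<open>
  Every basis vector is an eigenvector of the square of any positive root of
  \<open>adjoint_op A \<circ> A\<close>, with eigenvalue \<open>(cmod (l e))\<^sup>2\<close>. So the root is
  itself diagonal with eigenvalues \<open>cmod (l e)\<close>.
\<close>

lemma diagonal_op_abs: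
  assumes E: "is_orthonormal_basis E"
    and A: "diagonal_op E l A" and T: "diagonal_op E (\<lambda>e. complex_of_real (cmod (l e))) T"
    and B: "diagonal_op E (\<lambda>e. cnj (l e)) B"
  shows "abs_op A = T"
proof -
  have TT: "T \<circ> T = adjoint_op A \<circ> A"
  proof (rule diagonal_op_unique[OF E diagonal_op_compose[OF T T]])
    have eq: "l e * cnj (l e) = complex_of_real (cmod (l e)) * complex_of_real (cmod (l e))" for e
      by (metis complex_norm_square of_real_mult power2_eq_square)
    show "diagonal_op E (\<lambda>e. complex_of_real (cmod (l e)) * complex_of_real (cmod (l e)))
        (adjoint_op A \<circ> A)"
      using diagonal_op_compose[OF B A] unfolding diagonal_op_adjoint[OF E A B] eq .
  qed
  have "S = T" if S: "positive_op S" "S \<circ> S = adjoint_op A \<circ> A" for S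
  proof (rule diagonal_op_unique[OF E _ T])
    have "S e = complex_of_real (cmod (l e)) *\<^sub>C e" if "e \<in> E" for e
    proof (rule positive_sqrt_eigenvector[OF S(1)])
      have "S (S e) = (T \<circ> T) e"
        using S(2) TT by (metis comp_apply)
      also have "\<dots> = complex_of_real ((cmod (l e))\<^sup>2) *\<^sub>C e"
        using diagonal_op_compose[OF T T] that by (simp add: diagonal_op_def power2_eq_square)
      finally show "S (S e) = complex_of_real ((cmod (l e))\<^sup>2) *\<^sub>C e" .
    qed simp
    then show "diagonal_op E (\<lambda>e. complex_of_real (cmod (l e))) S"
      using S(1) by (simp add: diagonal_op_def positive_op_def)
  qed
  moreover have "positive_op T"
    by (rule diagonal_op_positive[OF E T]) simp
  ultimately show ?thesis
    unfolding abs_op_def sqrt_op_def using TT by (intro the_equality conjI) blast+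
qed

theorem diagonal_op_trace_class:
  assumes E: "is_orthonormal_basis E" and A: "diagonal_op E l A" and l: "(\<lambda>e. cmod (l e)) summable_on E"
  shows "trace_class A"
proof -
  have bound: "cmod (l e) \<le> (\<Sum>\<^sub>\<infinity>e\<in>E. cmod (l e))" if "e \<in> E" for e
    using finite_sum_le_infsum[OF l, of "{e}"] that by simp
  obtain T where T: "diagonal_op E (\<lambda>e. complex_of_real (cmod (l e))) T"
    using diagonal_op_exists[OF E, of "\<lambda>e. complex_of_real (cmod (l e))"] bound by auto
  obtain B where B: "diagonal_op E (\<lambda>e. cnj (l e)) B"
    using diagonal_op_exists[OF E, of "\<lambda>e. cnj (l e)"] bound by auto
  have "cinner e (abs_op A e) = complex_of_real (cmod (l e))" if "e \<in> E" for e
    using T that onb_cinner[OF E that that]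
    by (simp add: diagonal_op_abs[OF E A T B] diagonal_op_def cinner_scaleC_right)
  moreover have "(\<lambda>e. complex_of_real (cmod (l e))) summable_on E"
    using l by (rule summable_on_of_real)
  ultimately have "(\<lambda>e. cinner e (abs_op A e)) summable_on E"
    by (simp cong: summable_on_cong)
  then show ?thesis
    using E A by (auto simp: trace_class_def diagonal_op_def)
qed

text \<open>
  For an arbitrary basis \<open>F\<close>, expand each diagonal matrix element in the eigenbasis \<open>E\<close>. The
  resulting double series over \<open>E \<times> F\<close> converges absolutely, because the absolute values
  in the row of \<open>e\<close> sum to \<open>cmod (l e)\<close> by Parseval with respect to \<open>F\<close>.
  Summing the rows first gives the sum of the eigenvalues.
\<close>

theorem diagonal_op_trace:
  assumes E: "is_orthonormal_basis E" and A: "diagonal_op E l A" and l: "(\<lambda>e. cmod (l e)) summable_on E"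
  shows "trace_op A = (\<Sum>\<^sub>\<infinity>e\<in>E. l e)"
proof -
  have tr: "((\<lambda>\<phi>. cinner \<phi> (A \<phi>)) has_sum (\<Sum>\<^sub>\<infinity>e\<in>E. l e)) F" if F: "is_orthonormal_basis F" for F
  proof -
    define g where "g e \<phi> = l e * complex_of_real ((cmod (cinner \<phi> e))\<^sup>2)" for e \<phi>
    have unit: "norm e = 1" if "e \<in> E" for e
    proof -
      have "complex_of_real ((norm e)\<^sup>2) = complex_of_real 1"
        using onb_cinner[OF E that that] by (simp only: cinner_self of_real_1 if_True simp_thms)
      then have "(norm e)\<^sup>2 = 1"
        by (simp only: of_real_eq_iff)
      then show ?thesis
        using norm_ge_zero[of e] by (auto simp: power2_eq_1_iff)
    qed
    have parseval: "((\<lambda>\<phi>. (cmod (cinner \<phi> e))\<^sup>2) has_sum 1) F" if "e \<in> E" for e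
      using onb_parseval[OF F, of e] unit[OF that] by simp
    have row: "(g e has_sum l e) F" if "e \<in> E" for e
      using has_sum_cmult_right[OF has_sum_of_real[OF parseval[OF that]], of "l e"]
      by (simp add: g_def[abs_def])
    have row_norm: "((\<lambda>\<phi>. norm (g e \<phi>)) has_sum cmod (l e)) F" if "e \<in> E" for e
      using has_sum_cmult_right[OF parseval[OF that], of "cmod (l e)"]
      by (simp add: g_def norm_mult norm_power)
    have "(\<lambda>p. norm (case p of (e, \<phi>) \<Rightarrow> g e \<phi>)) summable_on (E \<times> F)"
    proof (subst Infinite_Sum.abs_summable_on_Sigma_iff, intro conjI ballI)
      show "(\<lambda>\<phi>. norm (case (e, \<phi>) of (e, \<phi>) \<Rightarrow> g e \<phi>)) summable_on F" if "e \<in> E" for e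
        using row_norm[OF that] by (auto simp: summable_on_def)
      have "norm (\<Sum>\<^sub>\<infinity>\<phi>\<in>F. norm (case (e, \<phi>) of (e, \<phi>) \<Rightarrow> g e \<phi>)) = cmod (l e)" if "e \<in> E" for e
        using infsumI[OF row_norm[OF that]] by simp
      then show "(\<lambda>e. norm (\<Sum>\<^sub>\<infinity>\<phi>\<in>F. norm (case (e, \<phi>) of (e, \<phi>) \<Rightarrow> g e \<phi>))) summable_on E"
        using l by (simp cong: summable_on_cong)
    qed
    then have sum: "(\<lambda>(e, \<phi>). g e \<phi>) summable_on (E \<times> F)"
      by (rule abs_summable_summable)
    then have "((\<lambda>(e, \<phi>). g e \<phi>) has_sum (\<Sum>\<^sub>\<infinity>e\<in>E. l e)) (E \<times> F)"
      using row has_sum_infsum[OF abs_summable_summable[OF l]] by (intro has_sum_SigmaI[where g = l]) auto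
    then have swapped: "((\<lambda>(\<phi>, e). g e \<phi>) has_sum (\<Sum>\<^sub>\<infinity>e\<in>E. l e)) (F \<times> E)"
      by (subst has_sum_swap) (simp add: case_prod_unfold)
    have col: "((\<lambda>e. g e \<phi>) has_sum cinner \<phi> (A \<phi>)) E" for \<phi>
    proof -
      have "cinner e \<phi> * cinner \<phi> e = complex_of_real ((cmod (cinner \<phi> e))\<^sup>2)" for e
        unfolding cinner_commute[of e \<phi>] by (metis complex_norm_square mult.commute)
      then show ?thesis
        using diagonal_op_cinner[OF E A, of \<phi> \<phi>] by (simp add: g_def)
    qed
    show ?thesis
      by (rule has_sum_SigmaD[OF swapped]) (use col in auto)
  qed
  show ?thesis
    unfolding trace_op_def
  proof (rule the_equality)
    fix t assume "\<forall>F. is_orthonormal_basis F \<longrightarrow> ((\<lambda>\<phi>. cinner \<phi> (A \<phi>)) has_sum t) F"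
    then show "t = (\<Sum>\<^sub>\<infinity>e\<in>E. l e)"
      using tr[OF E] E has_sum_unique by blast
  qed (use tr in blast)
qed

section \<open>Calculus on the torus\<close>

text \<open>
  Treating the direction as a parameter covers both partial derivatives by the same lemmas.
\<close>

definition dir_deriv ::
  "real \<times> real \<Rightarrow> (real \<times> real \<Rightarrow> 'a::real_normed_vector) \<Rightarrow> real \<times> real \<Rightarrow> 'a" where
  "dir_deriv v f p = frechet_derivative f (at p) v"

lemma partial1_eq_dir_deriv: "partial1 f = dir_deriv (1, 0) f"
  by (simp add: fun_eq_iff partial1_def dir_deriv_def)

lemma partial2_eq_dir_deriv: "partial2 f = dir_deriv (0, 1) f"
  by (simp add: fun_eq_iff partial2_def dir_deriv_def)

lemma dir_deriv_eq: "(f has_derivative f') (at p) \<Longrightarrow> dir_deriv v f p = f' v"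
  using frechet_derivative_at[of f f' p] by (simp add: dir_deriv_def)

lemma Ck_Suc_iff: "Ck (Suc k) f \<longleftrightarrow> (\<forall>p. f differentiable (at p)) \<and> (\<forall>v. Ck k (dir_deriv v f))"
  for f :: "real \<times> real \<Rightarrow> 'a::real_normed_vector"
  by (simp add: dir_deriv_def[abs_def])

lemma Ck_SucD:
  fixes f :: "real \<times> real \<Rightarrow> 'a::real_normed_vector"
  assumes "Ck (Suc k) f"
  shows "f differentiable (at p)" "Ck k (dir_deriv v f)"
  using assms unfolding Ck_Suc_iff by blast+

lemma Ck_SucI:
  fixes f :: "real \<times> real \<Rightarrow> 'a::real_normed_vector"
  assumes "\<And>p. f differentiable (at p)" "\<And>v. Ck k (dir_deriv v f)"
  shows "Ck (Suc k) f"
  using assms unfolding Ck_Suc_iff by blast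

lemma dir_deriv_add:
  assumes "f differentiable (at p)" "g differentiable (at p)"
  shows "dir_deriv v (\<lambda>p. f p + g p) p = dir_deriv v f p + dir_deriv v g p"
  using dir_deriv_eq[OF has_derivative_add[OF assms[unfolded frechet_derivative_works]]]
  by (simp add: dir_deriv_def)

lemma dir_deriv_bounded_linear:
  assumes "bounded_linear T" "f differentiable (at p)"
  shows "dir_deriv v (\<lambda>p. T (f p)) p = T (dir_deriv v f p)"
proof -
  have "((\<lambda>p. T (f p)) has_derivative (\<lambda>h. T (frechet_derivative f (at p) h))) (at p)"
    using assms frechet_derivative_works by (blast intro: bounded_linear.has_derivative)
  from dir_deriv_eq[OF this] show ?thesis
    by (simp add: dir_deriv_def)
qed

lemma dir_deriv_linear_combination:
  assumes "f differentiable (at p)"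
  shows "dir_deriv (a, b) f p = a *\<^sub>R dir_deriv (1, 0) f p + b *\<^sub>R dir_deriv (0, 1) f p"
proof -
  have "linear (frechet_derivative f (at p))"
    using assms by (rule linear_frechet_derivative)
  then have "frechet_derivative f (at p) (a *\<^sub>R (1, 0) + b *\<^sub>R (0, 1))
      = a *\<^sub>R dir_deriv (1, 0) f p + b *\<^sub>R dir_deriv (0, 1) f p"
    by (simp only: dir_deriv_def linear_add linear_cmul)
  then show ?thesis
    by (simp add: dir_deriv_def)
qed

lemma Ck_add:
  fixes f g :: "real \<times> real \<Rightarrow> 'a::real_normed_vector"
  shows "Ck k f \<Longrightarrow> Ck k g \<Longrightarrow> Ck k (\<lambda>p. f p + g p)"
proof (induction k arbitrary: f g)
  case 0
  then show ?case by (auto intro: continuous_on_add)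
next
  case (Suc k)
  note diff = Ck_SucD(1)[OF Suc.prems(1)] Ck_SucD(1)[OF Suc.prems(2)]
  have eq: "dir_deriv v (\<lambda>p. f p + g p) = (\<lambda>p. dir_deriv v f p + dir_deriv v g p)" for v
    using diff by (intro ext dir_deriv_add)
  show ?case
  proof (rule Ck_SucI)
    show "(\<lambda>p. f p + g p) differentiable (at p)" for p
      using diff by (rule differentiable_add)
    show "Ck k (dir_deriv v (\<lambda>p. f p + g p))" for v
      unfolding eq by (intro Suc.IH Ck_SucD(2) Suc.prems)
  qed
qed

lemma Ck_bounded_linear:
  fixes f :: "real \<times> real \<Rightarrow> 'a::real_normed_vector"
  assumes T: "bounded_linear T"
  shows "Ck k f \<Longrightarrow> Ck k (\<lambda>p. T (f p))"
proof (induction k arbitrary: f)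
  case 0
  then show ?case
    by (auto intro: bounded_linear.continuous_on[OF T])
next
  case (Suc k)
  note diff = Ck_SucD(1)[OF Suc.prems]
  have eq: "dir_deriv v (\<lambda>p. T (f p)) = (\<lambda>p. T (dir_deriv v f p))" for v
    using diff by (intro ext dir_deriv_bounded_linear T)
  show ?case
  proof (rule Ck_SucI)
    show "(\<lambda>p. T (f p)) differentiable (at p)" for p
      using diff[of p] bounded_linear.has_derivative[OF T] unfolding differentiable_def by blast
    show "Ck k (dir_deriv v (\<lambda>p. T (f p)))" for v
      unfolding eq by (intro Suc.IH Ck_SucD(2) Suc.prems)
  qed
qed

lemma torus_smooth_add: "torus_smooth f \<Longrightarrow> torus_smooth g \<Longrightarrow> torus_smooth (\<lambda>p. f p + g p)"
  by (simp add: torus_smooth_def Ck_add)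

lemma torus_smooth_bounded_linear:
  "bounded_linear T \<Longrightarrow> torus_smooth f \<Longrightarrow> torus_smooth (\<lambda>p. T (f p))"
  by (simp add: torus_smooth_def Ck_bounded_linear)

lemma torus_smooth_uminus: "torus_smooth f \<Longrightarrow> torus_smooth (\<lambda>p. - f p)"
  by (intro torus_smooth_bounded_linear[of uminus] bounded_linear_minus bounded_linear_ident)

lemma torus_smooth_diff: "torus_smooth f \<Longrightarrow> torus_smooth g \<Longrightarrow> torus_smooth (\<lambda>p. f p - g p)"
  using torus_smooth_add[OF _ torus_smooth_uminus, of f g] by simp

lemma torus_smooth_differentiable: "torus_smooth f \<Longrightarrow> f differentiable (at p)"
  unfolding torus_smooth_def using Ck_SucD(1) by blast

lemma torus_smooth_continuous: "torus_smooth f \<Longrightarrow> continuous_on UNIV f"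
  unfolding torus_smooth_def using Ck.simps(1) by blast

lemma torus_smooth_dir_deriv:
  assumes "torus_smooth f"
  shows "torus_smooth (dir_deriv v f)"
proof -
  have translate: "dir_deriv v f (p + c) = dir_deriv v f p" if "\<And>q. f (q + c) = f q" for p c
  proof -
    have "(f has_derivative frechet_derivative f (at (p + c))) (at (p + c))"
      using torus_smooth_differentiable[OF assms] frechet_derivative_works by blast
    then have "((\<lambda>q. f (q + c)) has_derivative frechet_derivative f (at (p + c))) (at p)"
      by (rule has_derivative_compose[of "\<lambda>q. q + c" "\<lambda>h. h" p UNIV f, rotated])
         (auto intro!: derivative_eq_intros)
    then show ?thesis
      unfolding that using dir_deriv_eq by (metis dir_deriv_def)
  qed
  have "f (q + (2 * pi, 0)) = f q" "f (q + (0, 2 * pi)) = f q" for q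
    using assms unfolding torus_smooth_def by (cases q, simp)+
  with translate[of "(2 * pi, 0)"] translate[of "(0, 2 * pi)"]
  have "dir_deriv v f (x + 2 * pi, y) = dir_deriv v f (x, y)"
    "dir_deriv v f (x, y + 2 * pi) = dir_deriv v f (x, y)" for x y
    by (metis add_Pair add.right_neutral)+
  moreover have "Ck k (dir_deriv v f)" for k
    using assms unfolding torus_smooth_def by (blast intro: Ck_SucD(2))
  ultimately show ?thesis
    by (simp add: torus_smooth_def)
qed

lemma torus_smooth_const: "torus_smooth (\<lambda>p. c)"
proof -
  have "Ck k (\<lambda>p :: real \<times> real. c)" for k and c :: 'a
  proof (induction k arbitrary: c)
    case (Suc k)
    have eq: "dir_deriv v (\<lambda>p. c) = (\<lambda>p. 0)" for v
      using dir_deriv_eq[OF has_derivative_const] by blast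
    show ?case
      by (rule Ck_SucI) (simp_all only: differentiable_const eq Suc.IH)
  qed simp
  then show ?thesis
    by (simp add: torus_smooth_def)
qed

section \<open>Integration on the torus\<close>

text \<open>
  The half-open fundamental square and the closed square differ by a null set. On the latter,
  iterated integrals and the fundamental theorem of calculus are available.
\<close>

lemma torus_integral_continuous:
  fixes f :: "real \<times> real \<Rightarrow> 'a::euclidean_space"
  assumes "continuous_on UNIV f"
  shows "integrable torus_measure f"
    and "(\<integral>p. f p \<partial>torus_measure) = integral (cbox (0, 0) (2 * pi, 2 * pi)) f"
proof -
  let ?Q = "{0..<2*pi} \<times> {0..<2*pi} :: (real \<times> real) set"
  let ?C = "cbox (0, 0) (2 * pi, 2 * pi) :: (real \<times> real) set"
  have sub: "box (0, 0) (2 * pi, 2 * pi) \<subseteq> ?Q" "?Q \<subseteq> ?C"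
    by (auto simp: mem_box Basis_prod_def cbox_Pair_eq box_def)
  have "set_integrable lborel ?C f"
    unfolding set_integrable_def
    using assms by (intro borel_integrable_compact) (auto intro: continuous_on_subset)
  then have int: "set_integrable lborel ?Q f"
    by (rule set_integrable_subset) (use sub in \<open>auto intro: borel_Times\<close>)
  then show "integrable torus_measure f"
    unfolding torus_measure_def set_integrable_def
    by (subst integrable_restrict_space) (simp_all add: borel_Times)
  have "(\<integral>p. f p \<partial>torus_measure) = (LINT p : ?Q | lborel. f p)"
    unfolding torus_measure_def set_lebesgue_integral_def
    by (rule integral_restrict_space) (simp add: borel_Times)
  also have "\<dots> = integral ?Q f"
    by (rule set_borel_integral_eq_integral(2)[OF int])
  also have "\<dots> = integral ?C f"
  proof (rule integral_spike_set)
    have "negligible (?C - box (0, 0) (2 * pi, 2 * pi))"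
      by (rule negligible_frontier_interval)
    then show "negligible {p \<in> ?C - ?Q. f p \<noteq> 0}" "negligible {p \<in> ?Q - ?C. f p \<noteq> 0}"
      using sub by (auto intro: negligible_subset)
  qed
  finally show "(\<integral>p. f p \<partial>torus_measure) = integral ?C f" .
qed

lemma square_integrable_continuous:
  fixes f :: "real \<times> real \<Rightarrow> 'a::euclidean_space"
  assumes "continuous_on UNIV f"
  shows "square_integrable f"
  unfolding square_integrable_def
proof
  show "f \<in> borel_measurable torus_measure"
    using torus_integral_continuous(1)[OF assms] by (rule borel_measurable_integrable)
  show "integrable torus_measure (\<lambda>p. (norm (f p))\<^sup>2)"
    by (intro torus_integral_continuous(1) continuous_intros assms)
qed

lemma square_integrable_smooth: "torus_smooth f \<Longrightarrow> square_integrable f"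
  by (intro square_integrable_continuous torus_smooth_continuous)

lemma torus_measure_total: "measure torus_measure (space torus_measure) = (2 * pi)\<^sup>2"
proof -
  have "measure torus_measure (space torus_measure) = (\<integral>p. 1 \<partial>torus_measure)"
    by simp
  also have "\<dots> = (2 * pi)\<^sup>2"
    by (subst torus_integral_continuous(2)) (auto simp: content_Pair power2_eq_square)
  finally show ?thesis .
qed

text \<open>
  For a coordinate direction, integrate along that direction first: the fundamental theorem of
  calculus leaves a difference of boundary values, which vanishes by periodicity. The general case
  follows by linearity in the direction.
\<close>

lemma integral_dir_deriv_zero:
  fixes f :: "real \<times> real \<Rightarrow> 'a::euclidean_space"
  assumes diff: "\<And>p. f differentiable (at p)" and cont: "\<And>v. continuous_on UNIV (dir_deriv v f)"
    and per: "\<And>x y. f (x + 2 * pi, y) = f (x, y)" "\<And>x y. f (x, y + 2 * pi) = f (x, y)"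
  shows "(\<integral>p. dir_deriv v f p \<partial>torus_measure) = 0"
proof -
  have deriv: "(f has_derivative frechet_derivative f (at p)) (at p)" for p
    using diff frechet_derivative_works by blast
  have lin: "linear (frechet_derivative f (at p))" for p
    using diff by (rule linear_frechet_derivative)
  have d1: "((\<lambda>x. f (x, y)) has_vector_derivative dir_deriv (1, 0) f (x, y)) (at x)" for x y
  proof -
    have "((\<lambda>x. f (x, y)) has_derivative (\<lambda>h. frechet_derivative f (at (x, y)) (h, 0))) (at x)"
      by (rule has_derivative_compose[OF _ deriv, where f = "\<lambda>x. (x, y)"])
         (auto intro!: derivative_eq_intros)
    moreover have "frechet_derivative f (at (x, y)) (h, 0) = h *\<^sub>R dir_deriv (1, 0) f (x, y)" for h
      using linear_cmul[OF lin, of "(x, y)" h "(1, 0)"] by (simp add: dir_deriv_def)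
    ultimately show ?thesis
      by (simp add: has_vector_derivative_def)
  qed
  have d2: "((\<lambda>y. f (x, y)) has_vector_derivative dir_deriv (0, 1) f (x, y)) (at y)" for x y
  proof -
    have "((\<lambda>y. f (x, y)) has_derivative (\<lambda>h. frechet_derivative f (at (x, y)) (0, h))) (at y)"
      by (rule has_derivative_compose[OF _ deriv, where f = "\<lambda>y. (x, y)"])
         (auto intro!: derivative_eq_intros)
    moreover have "frechet_derivative f (at (x, y)) (0, h) = h *\<^sub>R dir_deriv (0, 1) f (x, y)" for h
      using linear_cmul[OF lin, of "(x, y)" h "(0, 1)"] by (simp add: dir_deriv_def)
    ultimately show ?thesis
      by (simp add: has_vector_derivative_def)
  qed
  have i1: "integral {0..2 * pi} (\<lambda>x. dir_deriv (1, 0) f (x, y)) = 0" for y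
  proof -
    have "((\<lambda>x. dir_deriv (1, 0) f (x, y)) has_integral f (2 * pi, y) - f (0, y)) {0..2 * pi}"
      by (rule fundamental_theorem_of_calculus)
         (auto intro: has_vector_derivative_at_within d1)
    then show ?thesis
      using per(1)[of 0 y] by (simp add: integral_unique)
  qed
  have i2: "integral {0..2 * pi} (\<lambda>y. dir_deriv (0, 1) f (x, y)) = 0" for x
  proof -
    have "((\<lambda>y. dir_deriv (0, 1) f (x, y)) has_integral f (x, 2 * pi) - f (x, 0)) {0..2 * pi}"
      by (rule fundamental_theorem_of_calculus)
         (auto intro: has_vector_derivative_at_within d2)
    then show ?thesis
      using per(2)[of x 0] by (simp add: integral_unique)
  qed
  have cont': "continuous_on S (dir_deriv w f)" for S w
    using cont by (rule continuous_on_subset) simp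
  have z1: "(\<integral>p. dir_deriv (1, 0) f p \<partial>torus_measure) = 0"
    unfolding torus_integral_continuous(2)[OF cont] integral_prod_continuous[OF cont']
    by (subst integral_swap_continuous) (auto simp: i1 case_prod_beta' intro: cont')
  have z2: "(\<integral>p. dir_deriv (0, 1) f p \<partial>torus_measure) = 0"
    unfolding torus_integral_continuous(2)[OF cont] integral_prod_continuous[OF cont']
    by (simp add: i2)
  obtain a b where v: "v = (a, b)"
    by (cases v)
  have eq: "dir_deriv v f p = a *\<^sub>R dir_deriv (1, 0) f p + b *\<^sub>R dir_deriv (0, 1) f p" for p
    unfolding v by (rule dir_deriv_linear_combination[OF diff])
  show ?thesis
    unfolding eq by (simp add: z1 z2 torus_integral_continuous(1)[OF cont])
qed

text \<open>
  The integral of the derivative of \<open>inner u v\<close> vanishes. The passage from smooth functions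
  to classes in the square-integrable space rests on this identity: it expresses the derivative of
  a class through the class itself, tested against smooth functions.
\<close>

lemma inner_dir_deriv_by_parts:
  fixes u v :: "real \<times> real \<Rightarrow> 'a::euclidean_space"
  assumes u: "torus_smooth u" and v: "torus_smooth v"
  shows "inner (L2_class (dir_deriv d u)) (L2_class v) = - inner (L2_class u) (L2_class (dir_deriv d v))"
proof -
  have du: "(u has_derivative frechet_derivative u (at p)) (at p)"
    and dv: "(v has_derivative frechet_derivative v (at p)) (at p)" for p
    using u v torus_smooth_differentiable frechet_derivative_works by blast+
  have prod: "dir_deriv d (\<lambda>p. inner (u p) (v p)) p
      = inner (u p) (dir_deriv d v p) + inner (dir_deriv d u p) (v p)" for d p
    using dir_deriv_eq[OF has_derivative_inner[OF du dv]] by (simp add: dir_deriv_def)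
  have cont: "continuous_on UNIV u" "continuous_on UNIV v"
    "continuous_on UNIV (dir_deriv d u)" "continuous_on UNIV (dir_deriv d v)" for d
    using u v by (auto intro: torus_smooth_continuous torus_smooth_dir_deriv)
  have "(\<integral>p. dir_deriv d (\<lambda>p. inner (u p) (v p)) p \<partial>torus_measure) = 0"
  proof (rule integral_dir_deriv_zero)
    show "(\<lambda>p. inner (u p) (v p)) differentiable (at p)" for p
      using has_derivative_inner[OF du dv] unfolding differentiable_def by blast
    show "continuous_on UNIV (dir_deriv w (\<lambda>p. inner (u p) (v p)))" for w
      unfolding prod by (intro continuous_intros cont)
  qed (use u v in \<open>auto simp: torus_smooth_def\<close>)
  moreover have "integrable torus_measure (\<lambda>p. inner (u p) (dir_deriv d v p))"
    "integrable torus_measure (\<lambda>p. inner (dir_deriv d u p) (v p))"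
    by (intro torus_integral_continuous(1) continuous_intros cont)+
  ultimately have "(\<integral>p. inner (u p) (dir_deriv d v p) \<partial>torus_measure)
      + (\<integral>p. inner (dir_deriv d u p) (v p) \<partial>torus_measure) = 0"
    unfolding prod by simp
  then show ?thesis
    by (simp add: inner_L2_class square_integrable_smooth torus_smooth_dir_deriv u v
        del: split_paired_All)
qed

section \<open>The exponentials\<close>

lemma torus_exponential_has_derivative:
  "(torus_exponential k m has_derivative
    (\<lambda>v. \<i> * complex_of_real (of_int k * fst v + of_int m * snd v) * torus_exponential k m p)) (at p)"
proof -
  let ?L = "\<lambda>v :: real \<times> real. \<i> * complex_of_real (of_int k * fst v + of_int m * snd v)"
  have eq: "torus_exponential k m = (\<lambda>p. complex_of_real (1 / (2 * pi)) * exp (?L p))"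
    by (simp add: fun_eq_iff torus_exponential_def exp_add[symmetric] algebra_simps)
  have "(?L has_derivative ?L) (at p)"
    by (auto intro!: derivative_eq_intros)
  from has_derivative_compose[OF this DERIV_exp[unfolded has_field_derivative_def]]
  have "((\<lambda>p. exp (?L p)) has_derivative (\<lambda>v. exp (?L p) * ?L v)) (at p)" .
  from has_derivative_mult_right[OF this, of "complex_of_real (1 / (2 * pi))"] show ?thesis
    unfolding eq by (simp add: mult_ac)
qed

lemma dir_deriv_exponential:
  "dir_deriv v (\<lambda>p. c * torus_exponential k m p) p
    = c * (\<i> * complex_of_real (of_int k * fst v + of_int m * snd v)) * torus_exponential k m p"
  using dir_deriv_eq[OF has_derivative_mult_right[OF torus_exponential_has_derivative]]
  by (simp add: mult.assoc)

text \<open>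
  Every directional derivative of an exponential is a multiple of the same exponential, so the
  induction on the order of differentiability has to allow an arbitrary factor.
\<close>

lemma torus_smooth_exponential: "torus_smooth (\<lambda>p. c * torus_exponential k m p)"
proof -
  have "Ck j (\<lambda>p. c * torus_exponential k m p)" for j
  proof (induction j arbitrary: c)
    case 0
    then show ?case
      by (auto simp: torus_exponential_def[abs_def] intro!: continuous_intros)
  next
    case (Suc j)
    show ?case
    proof (rule Ck_SucI)
      show "(\<lambda>p. c * torus_exponential k m p) differentiable (at p)" for p
        using has_derivative_mult_right[OF torus_exponential_has_derivative]
        unfolding differentiable_def by blast
      show "Ck j (dir_deriv v (\<lambda>p. c * torus_exponential k m p))" for v
        unfolding dir_deriv_exponential[abs_def] by (rule Suc.IH)
    qed
  qed
  moreover have "exp (\<i> * of_int j * of_real (x + 2 * pi)) = exp (\<i> * of_int j * of_real x)" for j x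
  proof -
    have "\<i> * of_int j * of_real (x + 2 * pi) = \<i> * of_int j * of_real x + \<i> * (of_int j * (of_real pi * 2))"
      by (simp add: algebra_simps)
    then show ?thesis
      by (simp only: exp_plus_2pin)
  qed
  ultimately show ?thesis
    by (simp add: torus_smooth_def torus_exponential_def)
qed

lemma torus_exponential_mult:
  "torus_exponential k m p * torus_exponential k' m' p
    = complex_of_real (1 / (2 * pi)) * torus_exponential (k + k') (m + m') p"
  by (simp add: torus_exponential_def exp_add[symmetric] algebra_simps)

lemma cnj_torus_exponential: "cnj (torus_exponential k m p) = torus_exponential (- k) (- m) p"
  by (simp add: torus_exponential_def exp_cnj)

lemma integral_torus_exponential:
  "(\<integral>p. torus_exponential k m p \<partial>torus_measure) = (if k = 0 \<and> m = 0 then 2 * pi else 0)"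
proof (cases "k = 0 \<and> m = 0")
  case True
  then have "torus_exponential k m = (\<lambda>p. complex_of_real (1 / (2 * pi)))"
    by (simp add: fun_eq_iff torus_exponential_def)
  then show ?thesis
    using True by (simp add: torus_measure_total power2_eq_square scaleR_conv_of_real)
next
  case False
  let ?e = "\<lambda>p. 1 * torus_exponential k m p"
  let ?v = "(of_int k, of_int m) :: real \<times> real"
  define r :: real where "r = of_int k * of_int k + of_int m * of_int m"
  have smooth: "torus_smooth ?e"
    by (rule torus_smooth_exponential)
  \<comment> \<open>In the direction \<open>(k, m)\<close> the derivative is \<open>\<i> (k\<^sup>2 + m\<^sup>2)\<close> times the function itself.\<close>
  have "(\<integral>p. dir_deriv ?v ?e p \<partial>torus_measure) = 0"
    using smooth by (intro integral_dir_deriv_zero torus_smooth_differentiable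
        torus_smooth_continuous torus_smooth_dir_deriv) (auto simp: torus_smooth_def)
  then have "\<i> * complex_of_real r * (\<integral>p. torus_exponential k m p \<partial>torus_measure) = 0"
    unfolding dir_deriv_exponential r_def by simp
  moreover have "r \<noteq> 0"
    unfolding r_def using False by (simp add: sum_squares_eq_zero_iff)
  ultimately have "(\<integral>p. torus_exponential k m p \<partial>torus_measure) = 0"
    by simp
  then show ?thesis
    using False by simp
qed

abbreviation exponential_class :: "int \<Rightarrow> int \<Rightarrow> complex torus_L2" where
  "exponential_class k m \<equiv> L2_class (torus_exponential k m)"

lemma square_integrable_exponential: "square_integrable (torus_exponential k m)"
  using square_integrable_smooth[OF torus_smooth_exponential[of 1 k m]] by simp

lemma cinner_L2_class:
  "square_integrable f \<Longrightarrow> square_integrable g \<Longrightarrow>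
    cinner (L2_class f) (L2_class g) = (\<integral>p. cinner (f p) (g p) \<partial>torus_measure)"
  by (simp add: cinner_torus_L2.abs_eq)

lemma cinner_exponential_class:
  "cinner (exponential_class k m) (exponential_class k' m') = (if k = k' \<and> m = m' then 1 else 0)"
proof -
  have "cinner (exponential_class k m) (exponential_class k' m')
      = (\<integral>p. complex_of_real (1 / (2 * pi)) * torus_exponential (k' - k) (m' - m) p \<partial>torus_measure)"
    using torus_exponential_mult[of "- k" "- m" _ k' m']
    by (simp add: cinner_L2_class square_integrable_exponential cinner_complex_def
        cnj_torus_exponential)
  then show ?thesis
    by (auto simp: integral_torus_exponential)
qed

section \<open>Trigonometric polynomials\<close>

text \<open>
  The functions whose classes form \<open>Lambda\<close>. Generating them by sums of scaled exponentials
  makes additive properties amenable to rule induction.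
\<close>

inductive trig_poly :: "(real \<times> real \<Rightarrow> complex) \<Rightarrow> bool" where
  exponential: "trig_poly (\<lambda>p. c * torus_exponential k m p)"
| add: "trig_poly f \<Longrightarrow> trig_poly g \<Longrightarrow> trig_poly (\<lambda>p. f p + g p)"

lemma trig_poly_smooth: "trig_poly f \<Longrightarrow> torus_smooth f"
  by (induction rule: trig_poly.induct) (auto intro: torus_smooth_exponential torus_smooth_add)

lemma trig_poly_scale: "trig_poly f \<Longrightarrow> trig_poly (\<lambda>p. c * f p)"
proof (induction rule: trig_poly.induct)
  case (exponential d k m)
  show ?case
    using trig_poly.exponential[of "c * d" k m] by (simp add: mult.assoc)
next
  case (add f g)
  then show ?case
    using trig_poly.add[of "\<lambda>p. c * f p" "\<lambda>p. c * g p"] by (simp add: distrib_left)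
qed

lemma trig_poly_const: "trig_poly (\<lambda>p. c)"
  using trig_poly.exponential[of "c * (2 * pi)" 0 0] by (simp add: torus_exponential_def)

lemma trig_poly_exponential_mult: "trig_poly f \<Longrightarrow> trig_poly (\<lambda>p. torus_exponential k m p * f p)"
proof (induction rule: trig_poly.induct)
  case (exponential d k' m')
  have "torus_exponential k m p * (d * torus_exponential k' m' p)
      = (d * complex_of_real (1 / (2 * pi))) * torus_exponential (k + k') (m + m') p" for p
    using torus_exponential_mult[of k m p k' m'] by (simp add: mult.left_commute mult.assoc)
  then show ?case
    by (simp only: trig_poly.exponential)
next
  case (add f g)
  then show ?case
    using trig_poly.add[OF add.IH] by (simp add: distrib_left)
qed

lemma trig_poly_mult: "trig_poly f \<Longrightarrow> trig_poly g \<Longrightarrow> trig_poly (\<lambda>p. f p * g p)"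
proof (induction rule: trig_poly.induct)
  case (exponential c k m)
  from trig_poly_scale[OF trig_poly_exponential_mult[OF exponential], of c k m] show ?case
    by (simp add: mult.assoc)
next
  case (add f h)
  then show ?case
    using trig_poly.add[of "\<lambda>p. f p * g p" "\<lambda>p. h p * g p"] by (simp add: distrib_right)
qed

lemma trig_poly_cos_sin:
  "trig_poly (\<lambda>p. complex_of_real (cos (fst p)))" "trig_poly (\<lambda>p. complex_of_real (sin (fst p)))"
  "trig_poly (\<lambda>p. complex_of_real (cos (snd p)))" "trig_poly (\<lambda>p. complex_of_real (sin (snd p)))"
proof -
  have combine: "trig_poly (\<lambda>p. a * torus_exponential k m p + b * torus_exponential k' m' p)"
    for a b k m k' m'
    by (intro trig_poly.intros)
  have cos: "complex_of_real (cos x) = (exp (\<i> * x) + exp (- (\<i> * x))) / 2"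
    and sin: "complex_of_real (sin x) = (\<i> * exp (- (\<i> * x)) - \<i> * exp (\<i> * x)) / 2" for x :: real
    by (simp_all add: cos_of_real[symmetric] sin_of_real[symmetric] cos_exp_eq sin_exp_eq field_simps)
  show "trig_poly (\<lambda>p. complex_of_real (cos (fst p)))"
    using combine[of pi 1 0 pi "- 1" 0] by (simp add: cos torus_exponential_def field_simps)
  show "trig_poly (\<lambda>p. complex_of_real (sin (fst p)))"
    using combine[of "pi / \<i>" 1 0 "- pi / \<i>" "- 1" 0]
    by (simp add: sin torus_exponential_def field_simps)
  show "trig_poly (\<lambda>p. complex_of_real (cos (snd p)))"
    using combine[of pi 0 1 pi 0 "- 1"] by (simp add: cos torus_exponential_def field_simps)
  show "trig_poly (\<lambda>p. complex_of_real (sin (snd p)))"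
    using combine[of "pi / \<i>" 0 1 "- pi / \<i>" 0 "- 1"]
    by (simp add: sin torus_exponential_def field_simps)
qed

lemma L2_class_add:
  "square_integrable f \<Longrightarrow> square_integrable g \<Longrightarrow>
    L2_class f + L2_class g = L2_class (\<lambda>p. f p + g p)"
  by (simp add: plus_torus_L2.abs_eq)

lemma L2_class_scaleC:
  "square_integrable f \<Longrightarrow> c *\<^sub>C L2_class f = L2_class (\<lambda>p. c *\<^sub>C f p)"
  by (simp add: scaleC_torus_L2.abs_eq)

lemma L2_class_mult:
  fixes f :: "real \<times> real \<Rightarrow> complex"
  shows "square_integrable f \<Longrightarrow> c *\<^sub>C L2_class f = L2_class (\<lambda>p. c * f p)"
  by (simp add: L2_class_scaleC scaleC_complex_def)

lemma L2_class_sum: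
  fixes f :: "'i \<Rightarrow> real \<times> real \<Rightarrow> 'a::euclidean_space"
  assumes "\<And>i. i \<in> I \<Longrightarrow> square_integrable (f i)"
  shows "square_integrable (\<lambda>p. \<Sum>i\<in>I. f i p) \<and> L2_class (\<lambda>p. \<Sum>i\<in>I. f i p) = (\<Sum>i\<in>I. L2_class (f i))"
  using assms
proof (induction I rule: infinite_finite_induct)
  case (insert i I)
  then have "square_integrable (f i)" "square_integrable (\<lambda>p. \<Sum>i\<in>I. f i p)"
    "L2_class (\<lambda>p. \<Sum>i\<in>I. f i p) = (\<Sum>i\<in>I. L2_class (f i))"
    by simp_all
  then show ?case
    using insert(1,2) L2_class_add[of "f i" "\<lambda>p. \<Sum>i\<in>I. f i p"] by (simp add: square_integrable_add)
qed (simp_all add: square_integrable_0 zero_torus_L2_def)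

abbreviation exponential_classes :: "complex torus_L2 set" where
  "exponential_classes \<equiv> range (\<lambda>(k, m). exponential_class k m)"

lemma Lambda_eq_trig_poly: "Lambda = {L2_class f | f. trig_poly f}"
proof (intro set_eqI iffI)
  fix x assume "x \<in> Lambda"
  then show "x \<in> {L2_class f | f. trig_poly f}"
    unfolding Lambda_def
  proof (induction rule: complex_vector.span_induct_alt)
    case base
    have "L2_class (\<lambda>p. 0 :: complex) = 0"
      by (simp add: zero_torus_L2_def)
    then show ?case
      using trig_poly_const[of 0] by (auto intro!: exI[of _ "\<lambda>p. 0"])
  next
    case (step c x y)
    then obtain k m f where x: "x = exponential_class k m" and f: "y = L2_class f" "trig_poly f"
      by auto
    have "c *\<^sub>C x + y = L2_class (\<lambda>p. c * torus_exponential k m p + f p)"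
      using f by (simp add: x L2_class_mult square_integrable_exponential L2_class_add
          square_integrable_smooth torus_smooth_exponential trig_poly_smooth)
    moreover have "trig_poly (\<lambda>p. c * torus_exponential k m p + f p)"
      using f by (intro trig_poly.intros)
    ultimately show ?case
      by blast
  qed
next
  have "L2_class f \<in> Lambda" if "trig_poly f" for f
    using that
  proof (induction rule: trig_poly.induct)
    case (exponential c k m)
    have "exponential_class k m \<in> Lambda"
      unfolding Lambda_def by (rule complex_vector.span_base) (auto intro!: rev_image_eqI[of "(k, m)"])
    then show ?case
      unfolding Lambda_def L2_class_mult[OF square_integrable_exponential, symmetric]
      by (rule complex_vector.span_scale)
  next
    case (add f g)
    then show ?case
      unfolding Lambda_def
      by (simp add: L2_class_add[symmetric] square_integrable_smooth trig_poly_smooth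
          complex_vector.span_add)
  qed
  then show "x \<in> Lambda" if "x \<in> {L2_class f | f. trig_poly f}" for x
    using that by blast
qed

section \<open>Completeness of the exponentials\<close>

lemma closure_cspan_add:
  assumes "x \<in> closure (cspan X)" "y \<in> closure (cspan X)"
  shows "x + y \<in> closure (cspan X)"
proof -
  obtain f g where "\<And>n. f n \<in> cspan X" "f \<longlonglongrightarrow> x" "\<And>n. g n \<in> cspan X" "g \<longlonglongrightarrow> y"
    using assms unfolding closure_sequential by blast
  then show ?thesis
    unfolding closure_sequential
    by (intro exI[of _ "\<lambda>n. f n + g n"]) (auto intro: complex_vector.span_add tendsto_add)
qed

lemma closure_cspan_scale:
  assumes "x \<in> closure (cspan X)"
  shows "c *\<^sub>C x \<in> closure (cspan X)"
proof -
  have "(\<lambda>x. c *\<^sub>C x) ` closure (cspan X) \<subseteq> closure ((\<lambda>x. c *\<^sub>C x) ` cspan X)"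
    by (rule closure_bounded_linear_image_subset) (rule bounded_linear_scaleC)
  also have "\<dots> \<subseteq> closure (cspan X)"
    by (intro closure_mono) (auto intro: complex_vector.span_scale)
  finally show ?thesis
    using assms by blast
qed

lemma closure_cspan_sum:
  "(\<And>i. i \<in> I \<Longrightarrow> f i \<in> closure (cspan X)) \<Longrightarrow> (\<Sum>i\<in>I. f i) \<in> closure (cspan X)"
proof (induction I rule: infinite_finite_induct)
  case empty
  then show ?case
    using closure_subset complex_vector.span_zero by auto
next
  case (insert i I)
  then show ?case
    by (auto intro: closure_cspan_add)
next
  case (infinite I)
  then show ?case
    using closure_subset complex_vector.span_zero by auto
qed

lemma norm_L2_class_le:
  assumes f: "square_integrable f" and bound: "\<And>p. norm (f p) \<le> c" and c: "0 \<le> c"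
  shows "norm (L2_class f) \<le> c * (2 * pi)"
proof -
  have "(norm (L2_class f))\<^sup>2 = (\<integral>p. (norm (f p))\<^sup>2 \<partial>torus_measure)"
    by (rule norm_L2_class_power2[OF f])
  also have "\<dots> \<le> (\<integral>p. c\<^sup>2 \<partial>torus_measure)"
    using f by (intro integral_mono) (auto simp: square_integrable_def intro: power_mono bound)
  also have "\<dots> = (c * (2 * pi))\<^sup>2"
    by (simp add: torus_measure_total power_mult_distrib)
  finally show ?thesis
    by (rule power2_le_imp_le) (simp add: c)
qed

lemma L2_dominated_convergence:
  fixes f :: "nat \<Rightarrow> real \<times> real \<Rightarrow> 'a::euclidean_space"
  assumes f: "\<And>n. square_integrable (f n)" and g: "square_integrable g" and h: "square_integrable h"
    and lim: "\<And>p. p \<in> space torus_measure \<Longrightarrow> (\<lambda>n. f n p) \<longlonglongrightarrow> g p"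
    and bound: "\<And>n p. p \<in> space torus_measure \<Longrightarrow> norm (f n p) \<le> norm (h p)"
  shows "(\<lambda>n. L2_class (f n)) \<longlonglongrightarrow> L2_class g"
proof -
  have [measurable]: "f n \<in> borel_measurable torus_measure" "g \<in> borel_measurable torus_measure" for n
    using f g by (auto simp: square_integrable_def)
  have "(\<lambda>n. \<integral>p. (norm (f n p - g p))\<^sup>2 \<partial>torus_measure) \<longlonglongrightarrow> (\<integral>p. 0 \<partial>torus_measure)"
  proof (rule integral_dominated_convergence)
    show "integrable torus_measure (\<lambda>p. 4 * (norm (h p))\<^sup>2)"
      using h by (simp add: square_integrable_def)
    show "AE p in torus_measure. (\<lambda>n. (norm (f n p - g p))\<^sup>2) \<longlonglongrightarrow> 0"
    proof (rule AE_I2)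
      fix p assume "p \<in> space torus_measure"
      from tendsto_power[OF tendsto_norm[OF LIM_zero[OF lim[OF this]]], of 2]
      show "(\<lambda>n. (norm (f n p - g p))\<^sup>2) \<longlonglongrightarrow> 0"
        by simp
    qed
    show "AE p in torus_measure. norm ((norm (f n p - g p))\<^sup>2) \<le> 4 * (norm (h p))\<^sup>2" for n
    proof (rule AE_I2)
      fix p assume p: "p \<in> space torus_measure"
      have "norm (g p) \<le> norm (h p)"
        by (rule tendsto_upperbound[OF tendsto_norm[OF lim[OF p]]]) (simp_all add: bound p)
      then have "norm (f n p - g p) \<le> 2 * norm (h p)"
        using norm_triangle_ineq4[of "f n p" "g p"] bound[OF p, of n] by linarith
      then have "(norm (f n p - g p))\<^sup>2 \<le> (2 * norm (h p))\<^sup>2"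
        by (intro power_mono) auto
      then show "norm ((norm (f n p - g p))\<^sup>2) \<le> 4 * (norm (h p))\<^sup>2"
        by (simp add: power_mult_distrib)
    qed
  qed measurable
  then have "(\<lambda>n. (norm (L2_class (f n) - L2_class g))\<^sup>2) \<longlonglongrightarrow> 0"
    by (simp add: L2_class_diff f g norm_L2_class_power2 square_integrable_diff)
  then have "(\<lambda>n. norm (L2_class (f n) - L2_class g)) \<longlonglongrightarrow> 0"
    using tendsto_real_sqrt by fastforce
  then show ?thesis
    by (simp add: LIM_zero_iff tendsto_norm_zero_iff)
qed

text \<open>
  This identifies the torus with the product of two unit circles, a compact subset of
  \<open>complex \<times> complex\<close> to which the Stone--Weierstrass theorem applies. Functions composed
  with this map are periodic automatically.
\<close>

definition torus_embedding :: "real \<times> real \<Rightarrow> complex \<times> complex" where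
  "torus_embedding p = (cis (fst p), cis (snd p))"

lemma continuous_torus_embedding: "continuous_on S torus_embedding"
  unfolding torus_embedding_def[abs_def] cis_conv_exp by (intro continuous_intros)

text \<open>
  The real coordinates of a point of the embedded torus are the cosines and sines of the two angles,
  and trigonometric polynomials form an algebra.
\<close>

lemma trig_poly_real_polynomial:
  "real_polynomial_function g \<Longrightarrow> trig_poly (\<lambda>p. complex_of_real (g (torus_embedding p)))"
proof (induction rule: real_polynomial_function.induct)
  case (linear f)
  interpret f: bounded_linear f by fact
  have f_eq: "f (z, w) = Re z * f (1, 0) + Im z * f (\<i>, 0) + (Re w * f (0, 1) + Im w * f (0, \<i>))" for z w
  proof -
    have "(z, w) = Re z *\<^sub>R (1, 0) + Im z *\<^sub>R (\<i>, 0) + (Re w *\<^sub>R (0, 1) + Im w *\<^sub>R (0, \<i>))"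
      by (simp add: complex_eq_iff)
    then show ?thesis
      by (simp only: f.add f.scaleR real_scaleR_def)
  qed
  have "complex_of_real (f (torus_embedding p))
      = f (1, 0) * complex_of_real (cos (fst p)) + f (\<i>, 0) * complex_of_real (sin (fst p))
        + (f (0, 1) * complex_of_real (cos (snd p)) + f (0, \<i>) * complex_of_real (sin (snd p)))" for p
    unfolding torus_embedding_def f_eq[of "cis (fst p)" "cis (snd p)"]
    by (simp add: mult.commute)
  then show ?case
    by (simp only: trig_poly.add trig_poly_scale trig_poly_cos_sin)
next
  case (const c)
  show ?case by (rule trig_poly_const)
next
  case (add f g)
  then show ?case by (simp add: trig_poly.add)
next
  case (mult f g)
  then show ?case by (simp add: trig_poly_mult)
qed

text \<open>
  By Stone--Weierstrass the function is a uniform limit of polynomials on the embedded torus, and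
  uniform approximation implies approximation in norm as the torus has finite measure.
\<close>

lemma continuous_in_closure_Lambda:
  fixes F :: "complex \<times> complex \<Rightarrow> real"
  assumes F: "continuous_on UNIV F"
  shows "L2_class (\<lambda>p. complex_of_real (F (torus_embedding p))) \<in> closure Lambda"
  unfolding closure_approachable
proof (intro allI impI)
  fix \<epsilon> :: real assume "0 < \<epsilon>"
  let ?S = "sphere 0 1 \<times> sphere 0 1 :: (complex \<times> complex) set"
  let ?f = "\<lambda>p. complex_of_real (F (torus_embedding p))"
  define \<delta> where "\<delta> = \<epsilon> / (4 * pi)"
  have \<delta>: "0 < \<delta>"
    using \<open>0 < \<epsilon>\<close> by (simp add: \<delta>_def)
  have "compact ?S"
    by (intro compact_Times compact_sphere)
  moreover have "continuous_on ?S F"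
    using F by (rule continuous_on_subset) simp
  ultimately obtain g where g: "real_polynomial_function g" "\<And>z. z \<in> ?S \<Longrightarrow> \<bar>F z - g z\<bar> < \<delta>"
    using Stone_Weierstrass_real_polynomial_function[OF _ _ \<delta>] by blast
  let ?g = "\<lambda>p. complex_of_real (g (torus_embedding p))"
  have tg: "trig_poly ?g"
    by (rule trig_poly_real_polynomial[OF g(1)])
  have "continuous_on UNIV ?f"
    by (intro continuous_on_of_real continuous_on_compose2[OF F continuous_torus_embedding]) simp
  then have si: "square_integrable ?f" "square_integrable ?g"
    by (simp_all only: square_integrable_continuous square_integrable_smooth trig_poly_smooth tg)
  have "norm (?g p - ?f p) \<le> \<delta>" for p
  proof -
    have "torus_embedding p \<in> ?S"
      by (simp add: torus_embedding_def)
    from g(2)[OF this] show ?thesis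
      by (simp add: of_real_diff[symmetric] abs_minus_commute del: of_real_diff)
  qed
  then have "dist (L2_class ?g) (L2_class ?f) \<le> \<delta> * (2 * pi)"
    unfolding dist_norm L2_class_diff[OF si(2,1)]
    using si \<delta> by (intro norm_L2_class_le square_integrable_diff) auto
  also have "\<dots> < \<epsilon>"
    using \<open>0 < \<epsilon>\<close> by (simp add: \<delta>_def)
  finally show "\<exists>y\<in>Lambda. dist y (L2_class ?f) < \<epsilon>"
    using tg unfolding Lambda_eq_trig_poly by blast
qed

lemma square_integrable_bounded:
  fixes f :: "real \<times> real \<Rightarrow> 'a::euclidean_space"
  assumes "f \<in> borel_measurable torus_measure" "\<And>p. norm (f p) \<le> c"
  shows "square_integrable f"
  using square_integrable_bound[OF square_integrable_const[of "1 :: real"] assms(1), of c] assms(2)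
  by simp

lemma measurable_torus_measureI:
  "f \<in> borel_measurable borel \<Longrightarrow> f \<in> borel_measurable torus_measure"
  unfolding torus_measure_def by (intro measurable_restrict_space1) simp

lemma measurable_torus_embedding: "torus_embedding \<in> borel_measurable borel"
  by (intro borel_measurable_continuous_onI continuous_torus_embedding)

lemma square_integrable_indicator_embedding:
  assumes "B \<in> sets borel"
  shows "square_integrable (\<lambda>p. indicator B (torus_embedding p) :: complex)"
proof (rule square_integrable_bounded[where c = 1])
  show "(\<lambda>p. indicator B (torus_embedding p) :: complex) \<in> borel_measurable torus_measure"
    by (intro measurable_torus_measureI
        measurable_compose[OF measurable_torus_embedding borel_measurable_indicator] assms)
qed (simp add: indicator_def)

text \<open>
  The indicator of an open set is the limit of the bounded continuous functions
  \<open>min 1 (n * infdist z (- U))\<close>.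
\<close>

lemma open_indicator_in_closure_Lambda:
  assumes U: "open U"
  shows "L2_class (\<lambda>p. indicator U (torus_embedding p)) \<in> closure Lambda"
proof (cases "U = UNIV")
  case True
  then show ?thesis
    using continuous_in_closure_Lambda[of "\<lambda>z. 1"] by simp
next
  case False
  define F where "F n z = min 1 (real n * infdist z (- U))" for n z
  have contF: "continuous_on UNIV (F n)" for n
    unfolding F_def[abs_def] by (intro continuous_intros)
  have F01: "0 \<le> F n z" "F n z \<le> 1" for n z
    by (auto simp: F_def infdist_nonneg)
  have lim: "(\<lambda>n. F n z) \<longlonglongrightarrow> indicator U z" for z
  proof (cases "z \<in> U")
    case True
    then have "0 < infdist z (- U)"
      using U False in_closed_iff_infdist_zero[of "- U" z] infdist_nonneg[of z "- U"]
      by (auto simp: less_le)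
    then obtain N where N: "1 \<le> real N * infdist z (- U)"
      using ex_less_of_nat_mult[of "infdist z (- U)" 1] by (auto intro: less_imp_le)
    have "F n z = 1" if "N \<le> n" for n
      using N mult_right_mono[of "real N" "real n" "infdist z (- U)"] that infdist_nonneg[of z "- U"]
      unfolding F_def by linarith
    then show ?thesis
      using True by (intro tendsto_eventually) (auto simp: eventually_sequentially)
  qed (simp add: F_def)
  have "(\<lambda>n. L2_class (\<lambda>p. complex_of_real (F n (torus_embedding p))))
      \<longlonglongrightarrow> L2_class (\<lambda>p. indicator U (torus_embedding p))"
  proof (rule L2_dominated_convergence)
    show "square_integrable (\<lambda>p. complex_of_real (F n (torus_embedding p)))" for n
      by (intro square_integrable_continuous continuous_intros
          continuous_on_compose2[OF contF continuous_torus_embedding]) simp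
    show "square_integrable (\<lambda>p. indicator U (torus_embedding p) :: complex)"
      using U by (intro square_integrable_indicator_embedding) simp
    show "square_integrable (\<lambda>p. 1 :: complex)"
      by (rule square_integrable_const)
    show "(\<lambda>n. complex_of_real (F n (torus_embedding p))) \<longlonglongrightarrow> indicator U (torus_embedding p)" for p
      using tendsto_of_real[OF lim[of "torus_embedding p"]] by (simp add: of_real_indicator)
    show "norm (complex_of_real (F n (torus_embedding p))) \<le> norm (1 :: complex)" for n p
      using F01 by simp
  qed
  then show ?thesis
    using continuous_in_closure_Lambda[OF contF] by (rule closed_sequentially[OF closed_closure, rotated])
qed

text \<open>
  Dynkin's argument: the sets whose indicator lies in the closure contain the open sets, which are
  stable under intersection, and they are closed under complements and, by dominated convergence,
  under countable disjoint unions.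
\<close>

lemma borel_indicator_in_closure_Lambda:
  assumes "B \<in> sets borel"
  shows "L2_class (\<lambda>p. indicator B (torus_embedding p)) \<in> closure Lambda"
proof -
  let ?I = "\<lambda>B p. indicator B (torus_embedding p) :: complex"
  have B: "B \<in> sigma_sets UNIV (Collect open)"
    using assms by (simp add: sets_borel)
  have borel: "A \<in> sets borel" if "A \<in> sigma_sets UNIV (Collect open)" for A :: "(complex \<times> complex) set"
    using that by (simp add: sets_borel)
  have stable: "Int_stable (Collect open :: (complex \<times> complex) set set)"
    by (auto simp: Int_stable_def)
  have pow: "(Collect open :: (complex \<times> complex) set set) \<subseteq> Pow UNIV"
    by simp
  note add = closure_cspan_add[of _ exponential_classes, folded Lambda_def]
  note scale = closure_cspan_scale[of _ exponential_classes, folded Lambda_def]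
  note sums = closure_cspan_sum[of _ _ exponential_classes, folded Lambda_def]
  show ?thesis
    using stable pow B
  proof (induction rule: sigma_sets_induct_disjoint)
    case (basic A)
    then show ?case
      by (simp add: open_indicator_in_closure_Lambda)
  next
    case empty
    show ?case
      by (rule open_indicator_in_closure_Lambda) simp
  next
    case (compl A)
    have si: "square_integrable (?I UNIV)" "square_integrable (?I A)"
      using square_integrable_indicator_embedding[of UNIV]
        square_integrable_indicator_embedding[OF borel[OF compl(1)]] by simp_all
    have "L2_class (?I (UNIV - A)) = L2_class (?I UNIV) - L2_class (?I A)"
      unfolding L2_class_diff[OF si] by (simp add: indicator_diff)
    also have "\<dots> = L2_class (?I UNIV) + (- 1) *\<^sub>C L2_class (?I A)"
      by (simp add: complex_vector.scale_minus_left)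
    finally have "L2_class (?I (UNIV - A)) = L2_class (?I UNIV) + (- 1) *\<^sub>C L2_class (?I A)" .
    moreover have "L2_class (?I UNIV) \<in> closure Lambda"
      by (rule open_indicator_in_closure_Lambda) simp
    ultimately show ?case
      using compl by (metis add scale)
  next
    case (union A)
    let ?f = "\<lambda>n p. \<Sum>i<n. ?I (A i) p"
    have si: "square_integrable (?I (A i))" for i
      using union by (intro square_integrable_indicator_embedding borel) auto
    have part: "?f n p = ?I (\<Union>i<n. A i) p" for n p
      using union(1) by (intro indicator_UN_disjoint[symmetric]) (auto simp: disjoint_family_on_def)
    have "(\<lambda>n. L2_class (?f n)) \<longlonglongrightarrow> L2_class (?I (\<Union>i. A i))"
    proof (rule L2_dominated_convergence)
      show "square_integrable (?f n)" for n
        unfolding part using union by (intro square_integrable_indicator_embedding sets.finite_UN borel) auto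
      show "square_integrable (?I (\<Union>i. A i))"
        using union by (intro square_integrable_indicator_embedding sets.countable_UN) (auto intro: borel)
      show "square_integrable (\<lambda>p. 1 :: complex)"
        by (rule square_integrable_const)
      show "(\<lambda>n. ?f n p) \<longlonglongrightarrow> ?I (\<Union>i. A i) p" for p
        unfolding part by (rule LIMSEQ_indicator_UN)
      show "norm (?f n p) \<le> norm (1 :: complex)" for n p
        unfolding part by (simp add: indicator_def)
    qed
    moreover have "L2_class (?f n) \<in> closure Lambda" for n
    proof -
      have "L2_class (?f n) = (\<Sum>i<n. L2_class (?I (A i)))"
        using L2_class_sum[of "{..<n}" "\<lambda>i. ?I (A i)"] si by simp
      then show ?thesis
        using union(3) by (simp add: sums)
    qed
    ultimately show ?case
      by (rule closed_sequentially[OF closed_closure, rotated])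
  qed
qed

text \<open>
  A left inverse of \<open>torus_embedding\<close> on the fundamental square. It jumps along the cuts, but
  it is Borel measurable, and so every Borel subset of the square is the trace of a preimage under
  \<open>torus_embedding\<close>.
\<close>

definition torus_chart :: "complex \<times> complex \<Rightarrow> real \<times> real" where
  "torus_chart z = (Arg2pi (fst z), Arg2pi (snd z))"

lemma measurable_torus_chart: "torus_chart \<in> borel_measurable borel"
proof -
  have A: "Arg2pi \<in> borel_measurable borel"
    unfolding borel_measurable_iff_greater using open_Arg2pi2pi_gt by auto
  show ?thesis
    unfolding torus_chart_def[abs_def]
    by (intro borel_measurable_Pair measurable_compose[OF _ A] borel_measurable_continuous_onI
        continuous_intros)
qed

lemma space_torus_measure: "space torus_measure = {0..<2*pi} \<times> {0..<2*pi}"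
  by (simp add: torus_measure_def space_restrict_space)

lemma torus_chart_embedding: "p \<in> space torus_measure \<Longrightarrow> torus_chart (torus_embedding p) = p"
  using Arg2pi_unique[of 1]
  by (cases p) (auto simp: space_torus_measure torus_chart_def torus_embedding_def cis_conv_exp)

lemma indicator_in_closure_Lambda:
  assumes A: "A \<in> sets torus_measure"
  shows "L2_class (indicator A :: _ \<Rightarrow> complex) \<in> closure Lambda"
proof -
  have A': "A \<in> sets borel"
    using A unfolding torus_measure_def by (auto simp: sets_restrict_space intro: borel_Times)
  define B where "B = torus_chart -` A"
  have B: "B \<in> sets borel"
    using measurable_sets[OF measurable_torus_chart A'] by (simp add: B_def)
  have "square_integrable (indicator A :: _ \<Rightarrow> complex)"
    using A by (intro square_integrable_bounded[where c = 1]) (auto simp: indicator_def)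
  then have "L2_class (indicator A :: _ \<Rightarrow> complex) = L2_class (\<lambda>p. indicator B (torus_embedding p))"
    using square_integrable_indicator_embedding[OF B]
    by (subst torus_L2_eq_iff) (auto intro!: AE_I2 simp: B_def torus_chart_embedding indicator_def)
  then show ?thesis
    using borel_indicator_in_closure_Lambda[OF B] by simp
qed

lemma simple_function_in_closure_Lambda:
  fixes s :: "real \<times> real \<Rightarrow> complex"
  assumes s: "simple_function torus_measure s"
  shows "square_integrable s \<and> L2_class s \<in> closure Lambda"
proof -
  define A where "A y = s -` {y} \<inter> space torus_measure" for y
  define I where "I = s ` space torus_measure"
  let ?t = "\<lambda>p. \<Sum>y\<in>I. y * indicator (A y) p :: complex"
  have A: "A y \<in> sets torus_measure" for y
    unfolding A_def using s by (rule simple_functionD)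
  have si: "square_integrable (indicator (A y) :: _ \<Rightarrow> complex)" for y
    by (rule square_integrable_bounded[OF borel_measurable_indicator[OF A], of _ 1])
       (simp add: indicator_def)
  have t: "square_integrable ?t" "L2_class ?t = (\<Sum>y\<in>I. y *\<^sub>C L2_class (indicator (A y)))"
    using L2_class_sum[of I "\<lambda>y p. y * indicator (A y) p"]
      square_integrable_bounded_linear[OF bounded_linear_mult_right si]
    unfolding L2_class_mult[OF si] by blast+
  have eq: "s p = ?t p" if "p \<in> space torus_measure" for p
    using simple_function_indicator_representation_banach[OF s that]
    unfolding A_def I_def by (simp only: scaleR_conv_of_real of_real_indicator mult.commute)
  have "integrable torus_measure (\<lambda>p. (norm (s p))\<^sup>2) \<longleftrightarrow>
      integrable torus_measure (\<lambda>p. (norm (?t p))\<^sup>2)"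
    by (intro Bochner_Integration.integrable_cong) (auto simp only: eq[symmetric])
  with t(1) borel_measurable_simple_function[OF s] have ss: "square_integrable s"
    by (simp only: square_integrable_def)
  have "L2_class s = L2_class ?t"
    using eq by (subst torus_L2_eq_iff[OF ss t(1)]) (rule AE_I2)
  also have "\<dots> \<in> closure Lambda"
    unfolding t(2) Lambda_def
    by (intro closure_cspan_sum closure_cspan_scale)
       (use indicator_in_closure_Lambda[OF A] in \<open>simp add: Lambda_def\<close>)
  finally show ?thesis
    using ss by simp
qed

theorem closure_Lambda: "closure Lambda = UNIV"
proof -
  have "x \<in> closure Lambda" for x
  proof -
    obtain f where f: "square_integrable f" "x = L2_class f"
      by (rule torus_L2_cases)
    obtain s where "\<forall>i. simple_function torus_measure (s i)"
      "\<forall>p\<in>space torus_measure. (\<lambda>i. s i p) \<longlonglongrightarrow> f p"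
      "\<forall>i. \<forall>p\<in>space torus_measure. dist (s i p) 0 \<le> 2 * dist (f p) 0"
      using borel_measurable_implies_sequence_metric[OF square_integrable_measurable[OF f(1)], of 0]
      by blast
    then have s: "simple_function torus_measure (s i)"
      "p \<in> space torus_measure \<Longrightarrow> (\<lambda>i. s i p) \<longlonglongrightarrow> f p"
      "p \<in> space torus_measure \<Longrightarrow> norm (s i p) \<le> 2 * norm (f p)" for i p
      by (simp_all add: dist_norm)
    have "(\<lambda>i. L2_class (s i)) \<longlonglongrightarrow> L2_class f"
    proof (rule L2_dominated_convergence[where h = "\<lambda>p. 2 * norm (f p)"])
      show "square_integrable (\<lambda>p. 2 * norm (f p))"
        by (intro square_integrable_bounded_linear[OF bounded_linear_mult_right]
            square_integrable_norm f)
    qed (use s f simple_function_in_closure_Lambda in auto)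
    then show ?thesis
      unfolding f(2)
      by (rule closed_sequentially[OF closed_closure, rotated])
         (use s simple_function_in_closure_Lambda in blast)
  qed
  then show ?thesis
    by blast
qed

theorem exponential_classes_basis: "is_orthonormal_basis exponential_classes"
  unfolding is_orthonormal_basis_def
proof (intro conjI ballI)
  show "closure (cspan exponential_classes) = UNIV"
    using closure_Lambda by (simp add: Lambda_def)
  fix x y assume "x \<in> exponential_classes" "y \<in> exponential_classes"
  then obtain k m k' m' where xy: "x = exponential_class k m" "y = exponential_class k' m'"
    by auto
  have "x = y \<longleftrightarrow> k = k' \<and> m = m'"
    using cinner_exponential_class[of k m k' m'] cinner_exponential_class[of k m k m]
    unfolding xy by (metis zero_neq_one)
  then show "cinner x y = (if x = y then 1 else 0)"
    by (simp add: xy cinner_exponential_class)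
qed

section \<open>The Sobolev space\<close>

definition lap :: "(real \<times> real \<Rightarrow> 'a::real_normed_vector) \<Rightarrow> real \<times> real \<Rightarrow> 'a" where
  "lap f p = dir_deriv (1, 0) (dir_deriv (1, 0) f) p + dir_deriv (0, 1) (dir_deriv (0, 1) f) p"

lemma laplacian_eq_lap: "laplacian f = lap f"
  by (simp add: fun_eq_iff laplacian_def torus_div_def torus_grad_def lap_def
      partial1_eq_dir_deriv partial2_eq_dir_deriv)

lemma torus_smooth_lap: "torus_smooth f \<Longrightarrow> torus_smooth (lap f)"
  unfolding lap_def[abs_def] by (intro torus_smooth_add torus_smooth_dir_deriv)

definition grad_class :: "(real \<times> real \<Rightarrow> real) \<Rightarrow> real torus_L2 \<times> real torus_L2" where
  "grad_class f = (L2_class (dir_deriv (1, 0) f), L2_class (dir_deriv (0, 1) f))"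

lemma L2_class_dir_deriv_diff:
  assumes "torus_smooth f" "torus_smooth g"
  shows "L2_class (dir_deriv d (\<lambda>p. f p - g p)) = L2_class (dir_deriv d f) - L2_class (dir_deriv d g)"
proof -
  have "dir_deriv d (\<lambda>p. f p + - g p) p = dir_deriv d f p - dir_deriv d g p" for p
    using assms
    by (subst dir_deriv_add) (simp_all add: torus_smooth_differentiable torus_smooth_uminus
        dir_deriv_bounded_linear[OF bounded_linear_minus[OF bounded_linear_ident]])
  then have "dir_deriv d (\<lambda>p. f p - g p) = (\<lambda>p. dir_deriv d f p - dir_deriv d g p)"
    by (simp add: fun_eq_iff)
  then show ?thesis
    by (simp add: L2_class_diff square_integrable_smooth torus_smooth_dir_deriv assms)
qed

lemma grad_class_diff:
  "torus_smooth f \<Longrightarrow> torus_smooth g \<Longrightarrow> grad_class (\<lambda>p. f p - g p) = grad_class f - grad_class g"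
  by (simp add: grad_class_def L2_class_dir_deriv_diff)

lemma H1_inner_smooth_eq:
  assumes "torus_smooth u" "torus_smooth v"
  shows "H1_inner_smooth u v
    = inner (L2_class u) (L2_class v) + inner (grad_class u) (grad_class v)"
proof -
  note si = square_integrable_smooth[OF assms(1)] square_integrable_smooth[OF assms(2)]
    square_integrable_smooth[OF torus_smooth_dir_deriv[OF assms(1)]]
    square_integrable_smooth[OF torus_smooth_dir_deriv[OF assms(2)]]
  have "integrable torus_measure (\<lambda>p. dir_deriv d u p * dir_deriv d v p)" for d
    using integrable_inner_torus[OF si(3,4), of d d] by simp
  then show ?thesis
    by (simp add: H1_inner_smooth_def torus_grad_def grad_class_def inner_L2_class si
        partial1_eq_dir_deriv partial2_eq_dir_deriv)
qed

lemma inner_lap: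
  assumes "torus_smooth u" "torus_smooth v"
  shows "inner (L2_class (lap u)) (L2_class v) = - inner (grad_class u) (grad_class v)"
proof -
  have "L2_class (lap u) = L2_class (dir_deriv (1, 0) (dir_deriv (1, 0) u))
      + L2_class (dir_deriv (0, 1) (dir_deriv (0, 1) u))"
    unfolding lap_def[abs_def]
    by (intro L2_class_add[symmetric] square_integrable_smooth torus_smooth_dir_deriv assms)
  then show ?thesis
    by (simp add: inner_add_left inner_dir_deriv_by_parts torus_smooth_dir_deriv assms grad_class_def)
qed

lemma B_smooth_eq:
  assumes "torus_smooth u" "torus_smooth v"
  shows "B_smooth u v = - inner (grad_class u) (grad_class v)"
  using inner_lap[OF assms]
  by (simp add: B_smooth_def laplacian_eq_lap inner_L2_class square_integrable_smooth
      torus_smooth_lap assms)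

text \<open>
  The Sobolev norm is the norm of the pair of \<open>L2_class u\<close> and \<open>grad_class u\<close> in a
  product of complete spaces. Hence a sequence that is Cauchy for it is one along which both
  components converge.
\<close>

lemma H1_represents_iff:
  "H1_represents \<phi> u \<longleftrightarrow> (\<forall>n. torus_smooth (\<phi> n)) \<and> (\<lambda>n. L2_class (\<phi> n)) \<longlonglongrightarrow> u \<and>
    convergent (\<lambda>n. grad_class (\<phi> n))"
proof (cases "\<forall>n. torus_smooth (\<phi> n)")
  case smooth: True
  define J where "J n = (L2_class (\<phi> n), grad_class (\<phi> n))" for n
  have sq: "H1_inner_smooth (\<lambda>p. \<phi> m p - \<phi> n p) (\<lambda>p. \<phi> m p - \<phi> n p) = (dist (J m) (J n))\<^sup>2" for m n
    using smooth
    by (simp add: H1_inner_smooth_eq torus_smooth_diff grad_class_diff L2_class_diff[symmetric]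
        square_integrable_smooth J_def dist_norm power2_norm_eq_inner)
  have "(\<forall>e>0. \<exists>N. \<forall>m\<ge>N. \<forall>n\<ge>N. (dist (J m) (J n))\<^sup>2 < e) \<longleftrightarrow> Cauchy J"
  proof
    assume L: "\<forall>e>0. \<exists>N. \<forall>m\<ge>N. \<forall>n\<ge>N. (dist (J m) (J n))\<^sup>2 < e"
    show "Cauchy J"
    proof (rule metric_CauchyI)
      fix e :: real assume "0 < e"
      then obtain N where "\<And>m n. m \<ge> N \<Longrightarrow> n \<ge> N \<Longrightarrow> (dist (J m) (J n))\<^sup>2 < e\<^sup>2"
        using L by (meson zero_less_power)
      then show "\<exists>N. \<forall>m\<ge>N. \<forall>n\<ge>N. dist (J m) (J n) < e"
        using \<open>0 < e\<close> by (meson less_imp_le power_less_imp_less_base)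
    qed
  next
    assume C: "Cauchy J"
    show "\<forall>e>0. \<exists>N. \<forall>m\<ge>N. \<forall>n\<ge>N. (dist (J m) (J n))\<^sup>2 < e"
    proof (intro allI impI)
      fix e :: real assume "0 < e"
      then obtain N where N: "\<And>m n. m \<ge> N \<Longrightarrow> n \<ge> N \<Longrightarrow> dist (J m) (J n) < sqrt e"
        using metric_CauchyD[OF C, of "sqrt e"] by auto
      have "(dist (J m) (J n))\<^sup>2 < e" if "m \<ge> N" "n \<ge> N" for m n
        using power_strict_mono[OF N[OF that], of 2] \<open>0 < e\<close> by simp
      then show "\<exists>N. \<forall>m\<ge>N. \<forall>n\<ge>N. (dist (J m) (J n))\<^sup>2 < e"
        by blast
    qed
  qed
  moreover have "Cauchy J \<longleftrightarrow> convergent (\<lambda>n. L2_class (\<phi> n)) \<and> convergent (\<lambda>n. grad_class (\<phi> n))"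
  proof
    assume "Cauchy J"
    then obtain l where "J \<longlonglongrightarrow> l"
      unfolding Cauchy_convergent_iff convergent_def by blast
    from tendsto_fst[OF this] tendsto_snd[OF this]
    show "convergent (\<lambda>n. L2_class (\<phi> n)) \<and> convergent (\<lambda>n. grad_class (\<phi> n))"
      unfolding convergent_def J_def fst_conv snd_conv by blast
  next
    assume "convergent (\<lambda>n. L2_class (\<phi> n)) \<and> convergent (\<lambda>n. grad_class (\<phi> n))"
    then obtain a b where "(\<lambda>n. L2_class (\<phi> n)) \<longlonglongrightarrow> a" "(\<lambda>n. grad_class (\<phi> n)) \<longlonglongrightarrow> b"
      by (auto simp: convergent_def)
    from tendsto_Pair[OF this] show "Cauchy J"
      unfolding J_def[abs_def] by (rule LIMSEQ_imp_Cauchy)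
  qed
  ultimately show ?thesis
    using smooth by (auto simp: H1_represents_def sq convergent_def)
next
  case False
  then show ?thesis
    unfolding H1_represents_def by blast
qed

text \<open>
  Tested against smooth functions, the limit of the gradients depends on the limit of the
  functions only.
\<close>

lemma inner_grad_class_limit:
  assumes "\<And>n. torus_smooth (\<phi> n)" "(\<lambda>n. L2_class (\<phi> n)) \<longlonglongrightarrow> u" "(\<lambda>n. grad_class (\<phi> n)) \<longlonglongrightarrow> g"
    and "torus_smooth v" "torus_smooth w"
  shows "inner g (L2_class v, L2_class w)
    = - inner u (L2_class (dir_deriv (1, 0) v) + L2_class (dir_deriv (0, 1) w))"
proof (rule LIMSEQ_unique)
  show "(\<lambda>n. inner (grad_class (\<phi> n)) (L2_class v, L2_class w)) \<longlonglongrightarrow> inner g (L2_class v, L2_class w)"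
    by (intro tendsto_inner assms tendsto_const)
  have "inner (grad_class (\<phi> n)) (L2_class v, L2_class w)
      = - inner (L2_class (\<phi> n)) (L2_class (dir_deriv (1, 0) v) + L2_class (dir_deriv (0, 1) w))" for n
    by (simp add: grad_class_def inner_dir_deriv_by_parts assms inner_add_right)
  moreover have "(\<lambda>n. - inner (L2_class (\<phi> n)) (L2_class (dir_deriv (1, 0) v) + L2_class (dir_deriv (0, 1) w)))
      \<longlonglongrightarrow> - inner u (L2_class (dir_deriv (1, 0) v) + L2_class (dir_deriv (0, 1) w))"
    by (intro tendsto_minus tendsto_inner assms tendsto_const)
  ultimately show "(\<lambda>n. inner (grad_class (\<phi> n)) (L2_class v, L2_class w))
      \<longlonglongrightarrow> - inner u (L2_class (dir_deriv (1, 0) v) + L2_class (dir_deriv (0, 1) w))"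
    by simp
qed

text \<open>
  This is what makes extension by continuity well defined. By the previous lemma \<open>g - h\<close> is
  orthogonal to all smooth gradients; but \<open>g\<close> and \<open>h\<close> are limits of smooth gradients, so
  \<open>g - h\<close> is orthogonal to itself.
\<close>

lemma gradient_closable:
  assumes \<phi>: "H1_represents \<phi> u" "(\<lambda>n. grad_class (\<phi> n)) \<longlonglongrightarrow> g"
    and \<psi>: "H1_represents \<psi> u" "(\<lambda>n. grad_class (\<psi> n)) \<longlonglongrightarrow> h"
  shows "g = h"
proof -
  have orth: "inner (g - h) (grad_class \<eta>) = 0" if "torus_smooth \<eta>" for \<eta>
    using \<phi> \<psi> that torus_smooth_dir_deriv[OF that]
    by (simp add: grad_class_def inner_diff_left inner_grad_class_limit[of \<phi> u g]
        inner_grad_class_limit[of \<psi> u h] H1_represents_iff)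
  have "inner (g - h) l = 0" if "\<And>n. torus_smooth (\<xi> n)" "(\<lambda>n. grad_class (\<xi> n)) \<longlonglongrightarrow> l" for \<xi> l
  proof -
    have "(\<lambda>n. inner (g - h) (grad_class (\<xi> n))) \<longlonglongrightarrow> inner (g - h) l"
      by (intro tendsto_inner tendsto_const that)
    then show ?thesis
      using orth that(1) by (simp add: LIMSEQ_const_iff)
  qed
  from this[of \<phi> g] this[of \<psi> h] \<phi> \<psi> have "inner (g - h) (g - h) = 0"
    by (simp add: inner_diff_right H1_represents_iff)
  then show ?thesis
    by simp
qed

definition weak_grad :: "real torus_L2 \<Rightarrow> real torus_L2 \<times> real torus_L2" where
  "weak_grad u = (THE g. \<exists>\<phi>. H1_represents \<phi> u \<and> (\<lambda>n. grad_class (\<phi> n)) \<longlonglongrightarrow> g)"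

lemma weak_grad_eq:
  assumes "H1_represents \<phi> u" "(\<lambda>n. grad_class (\<phi> n)) \<longlonglongrightarrow> g"
  shows "weak_grad u = g"
  unfolding weak_grad_def using assms gradient_closable by (intro the_equality) blast+

lemma weak_grad_limit:
  assumes "H1_represents \<phi> u"
  shows "(\<lambda>n. grad_class (\<phi> n)) \<longlonglongrightarrow> weak_grad u"
  using assms weak_grad_eq[OF assms] by (auto simp: H1_represents_iff convergent_def)

text \<open>
  Representing sequences exist for members of \<open>H1\<close>, so a limit common to all of them
  is unique.
\<close>

lemma H1_extension_eq:
  assumes "u \<in> H1" "v \<in> H1"
    and "\<And>\<phi> \<psi>. H1_represents \<phi> u \<Longrightarrow> H1_represents \<psi> v \<Longrightarrow> (\<lambda>n. b (\<phi> n) (\<psi> n)) \<longlonglongrightarrow> l"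
  shows "H1_extension b u v = l"
  unfolding H1_extension_def
proof (rule the_equality)
  fix l' assume "\<forall>\<phi> \<psi>. H1_represents \<phi> u \<longrightarrow> H1_represents \<psi> v \<longrightarrow> (\<lambda>n. b (\<phi> n) (\<psi> n)) \<longlonglongrightarrow> l'"
  then show "l' = l"
    using assms unfolding H1_def by (blast intro: LIMSEQ_unique)
qed (use assms in blast)

lemma H1_inner_eq:
  assumes "u \<in> H1" "v \<in> H1"
  shows "H1_inner u v = inner u v + inner (weak_grad u) (weak_grad v)"
  unfolding H1_inner_def
proof (rule H1_extension_eq[OF assms])
  fix \<phi> \<psi> assume r: "H1_represents \<phi> u" "H1_represents \<psi> v"
  then have "(\<lambda>n. inner (L2_class (\<phi> n)) (L2_class (\<psi> n)) + inner (grad_class (\<phi> n)) (grad_class (\<psi> n)))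
      \<longlonglongrightarrow> inner u v + inner (weak_grad u) (weak_grad v)"
    by (intro tendsto_add tendsto_inner weak_grad_limit) (auto simp: H1_represents_iff)
  then show "(\<lambda>n. H1_inner_smooth (\<phi> n) (\<psi> n)) \<longlonglongrightarrow> inner u v + inner (weak_grad u) (weak_grad v)"
    using r by (simp add: H1_inner_smooth_eq H1_represents_iff)
qed

lemma B_form_eq:
  assumes "u \<in> H1" "v \<in> H1"
  shows "B_form u v = - inner (weak_grad u) (weak_grad v)"
  unfolding B_form_def
proof (rule H1_extension_eq[OF assms])
  fix \<phi> \<psi> assume r: "H1_represents \<phi> u" "H1_represents \<psi> v"
  then have "(\<lambda>n. - inner (grad_class (\<phi> n)) (grad_class (\<psi> n))) \<longlonglongrightarrow> - inner (weak_grad u) (weak_grad v)"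
    by (intro tendsto_minus tendsto_inner weak_grad_limit)
  then show "(\<lambda>n. B_smooth (\<phi> n) (\<psi> n)) \<longlonglongrightarrow> - inner (weak_grad u) (weak_grad v)"
    using r by (simp add: B_smooth_eq H1_represents_iff)
qed

lemma H1_diff:
  assumes "u \<in> H1" "v \<in> H1"
  shows "u - v \<in> H1" "weak_grad (u - v) = weak_grad u - weak_grad v"
proof -
  obtain \<phi> \<psi> where r: "H1_represents \<phi> u" "H1_represents \<psi> v"
    using assms by (auto simp: H1_def)
  have "(\<lambda>n. grad_class (\<phi> n) - grad_class (\<psi> n)) \<longlonglongrightarrow> weak_grad u - weak_grad v"
    by (intro tendsto_diff weak_grad_limit r)
  then have lim: "(\<lambda>n. grad_class (\<lambda>p. \<phi> n p - \<psi> n p)) \<longlonglongrightarrow> weak_grad u - weak_grad v"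
    using r by (simp add: grad_class_diff H1_represents_iff)
  have "(\<lambda>n. L2_class (\<phi> n) - L2_class (\<psi> n)) \<longlonglongrightarrow> u - v"
    using r by (intro tendsto_diff) (auto simp: H1_represents_iff)
  then have "(\<lambda>n. L2_class (\<lambda>p. \<phi> n p - \<psi> n p)) \<longlonglongrightarrow> u - v"
    using r by (simp add: L2_class_diff square_integrable_smooth H1_represents_iff)
  then have rep: "H1_represents (\<lambda>n p. \<phi> n p - \<psi> n p) (u - v)"
    using r convergentI[OF lim] by (simp add: H1_represents_iff torus_smooth_diff)
  show "u - v \<in> H1"
    using rep by (auto simp: H1_def)
  show "weak_grad (u - v) = weak_grad u - weak_grad v"
    by (rule weak_grad_eq[OF rep lim])
qed

lemma H1_smooth:
  assumes "torus_smooth f"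
  shows "L2_class f \<in> H1" "weak_grad (L2_class f) = grad_class f"
proof -
  have rep: "H1_represents (\<lambda>n. f) (L2_class f)"
    using assms by (simp add: H1_represents_iff convergent_const)
  then show "L2_class f \<in> H1"
    by (auto simp: H1_def)
  show "weak_grad (L2_class f) = grad_class f"
    by (rule weak_grad_eq[OF rep tendsto_const])
qed

section \<open>The inverse Laplace operator\<close>

text \<open>
  Green's formula with a smooth first argument, extended to \<open>H1\<close> in the second.
\<close>

lemma inner_lap_H1:
  assumes w: "torus_smooth w" and v: "v \<in> H1"
  shows "inner (L2_class (lap w)) v = - inner (grad_class w) (weak_grad v)"
proof -
  obtain \<psi> where r: "H1_represents \<psi> v"
    using v by (auto simp: H1_def)
  have "(\<lambda>n. inner (L2_class (lap w)) (L2_class (\<psi> n))) \<longlonglongrightarrow> inner (L2_class (lap w)) v"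
    using r by (intro tendsto_inner tendsto_const) (simp add: H1_represents_iff)
  moreover have "(\<lambda>n. - inner (grad_class w) (grad_class (\<psi> n))) \<longlonglongrightarrow> - inner (grad_class w) (weak_grad v)"
    by (intro tendsto_minus tendsto_inner tendsto_const weak_grad_limit r)
  ultimately show ?thesis
    using r w by (simp add: inner_lap H1_represents_iff LIMSEQ_unique)
qed

lemma K_space_iff: "u \<in> K_space \<longleftrightarrow> u \<in> H1 \<and> weak_grad u = 0"
proof
  assume "u \<in> K_space"
  then have "u \<in> H1" "B_form u u = 0"
    by (auto simp: K_space_def)
  then show "u \<in> H1 \<and> weak_grad u = 0"
    by (simp add: B_form_eq)
qed (simp add: K_space_def B_form_eq)

lemma K_perp_iff: "u \<in> K_perp \<longleftrightarrow> u \<in> H1 \<and> (\<forall>w\<in>K_space. inner u w = 0)"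
  by (auto simp: K_perp_def H1_inner_eq K_space_iff)

text \<open>
  The functions \<open>q\<close> and \<open>q - a\<close> have the same pairing with \<open>K_perp\<close>, because constants
  lie in \<open>K_space\<close>. That \<open>w\<close> is itself a Laplacian makes it orthogonal to
  \<open>K_space\<close> by Green's formula, since the members of \<open>K_space\<close> have zero gradient.
  For uniqueness, a difference \<open>d\<close> of two
  solutions lies in \<open>K_perp\<close> and satisfies \<open>B_form d d = 0\<close>, hence has zero gradient,
  hence lies in \<open>K_space\<close> as well.
\<close>

lemma Dinv_real_smooth:
  assumes smooth: "torus_smooth q" "torus_smooth w" "torus_smooth z"
    and w: "\<And>p. lap w p = q p - a" and z: "\<And>p. w p = lap z p"
  shows "Dinv_real (L2_class q) = L2_class w"
  unfolding Dinv_real_def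
proof (rule the_equality)
  have "inner (L2_class w) c = 0" if "c \<in> K_space" for c
  proof -
    have "L2_class w = L2_class (lap z)"
      using z by (metis ext)
    then show ?thesis
      using that smooth by (simp add: inner_lap_H1 K_space_iff)
  qed
  then have wK: "L2_class w \<in> K_perp"
    using smooth by (simp add: K_perp_iff H1_smooth)
  have one: "L2_class (\<lambda>p. a) \<in> K_space"
  proof -
    have "dir_deriv d (\<lambda>p. a) = (\<lambda>p. 0)" for d
      using dir_deriv_eq[OF has_derivative_const] by blast
    then show ?thesis
      by (simp add: K_space_iff H1_smooth torus_smooth_const grad_class_def zero_torus_L2_def zero_prod_def)
  qed
  have B: "B_form (L2_class w) v = inner (L2_class q) v" if v: "v \<in> K_perp" for v
  proof -
    have "inner (L2_class (\<lambda>p. a)) v = 0"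
      using v one by (metis K_perp_iff inner_commute)
    moreover have "L2_class (lap w) = L2_class q - L2_class (\<lambda>p. a)"
      using smooth w by (simp add: L2_class_diff square_integrable_smooth torus_smooth_const
          fun_eq_iff flip: w)
    ultimately have "inner (L2_class (lap w)) v = inner (L2_class q) v"
      by (simp add: inner_diff_left)
    then show ?thesis
      using v smooth by (simp add: B_form_eq inner_lap_H1 H1_smooth K_perp_iff)
  qed
  show "L2_class w \<in> K_perp \<and> (\<forall>v\<in>K_perp. B_form (L2_class w) v = inner (L2_class q) v)"
    using wK B by blast
  fix u assume u: "u \<in> K_perp \<and> (\<forall>v\<in>K_perp. B_form u v = inner (L2_class q) v)"
  define d where "d = u - L2_class w"
  have H: "u \<in> H1" "L2_class w \<in> H1"
    using u wK by (auto simp: K_perp_iff)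
  have dK: "d \<in> K_perp"
    using u wK by (auto simp: d_def K_perp_iff H1_diff inner_diff_left)
  have "inner (weak_grad d) (weak_grad d) = 0"
  proof -
    have "B_form u d = B_form (L2_class w) d"
      using u B dK by simp
    then show ?thesis
      using dK H by (simp add: B_form_eq K_perp_iff d_def H1_diff inner_diff_left)
  qed
  then have "d \<in> K_space"
    using dK by (simp add: K_space_iff K_perp_iff)
  then have "inner d d = 0"
    using dK unfolding K_perp_iff by blast
  then show "u = L2_class w"
    by (simp add: d_def)
qed

lemma lap_bounded_linear:
  assumes T: "bounded_linear T" and f: "torus_smooth f"
  shows "lap (\<lambda>p. T (f p)) p = T (lap f p)"
proof -
  have d: "dir_deriv v (\<lambda>p. T (g p)) = (\<lambda>p. T (dir_deriv v g p))" if "torus_smooth g" for v g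
    using that by (intro ext dir_deriv_bounded_linear T torus_smooth_differentiable)
  show ?thesis
    by (simp add: lap_def d f torus_smooth_dir_deriv linear_add[OF bounded_linear.linear[OF T]])
qed

text \<open>
  The Laplacian commutes with taking real and imaginary parts, so both parts of \<open>q\<close> satisfy
  the hypotheses of the real case.
\<close>

lemma Dinv_smooth:
  assumes smooth: "torus_smooth q" "torus_smooth w" "torus_smooth z"
    and w: "\<And>p. lap w p = q p - a" and z: "\<And>p. w p = lap z p"
  shows "Dinv (L2_class q) = L2_class w"
proof -
  have part: "Dinv_real (L2_class (\<lambda>p. T (q p))) = L2_class (\<lambda>p. T (w p))"
    if T: "bounded_linear T" for T :: "complex \<Rightarrow> real"
  proof (rule Dinv_real_smooth)
    show "lap (\<lambda>p. T (w p)) p = T (q p) - T a" for p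
      by (simp add: lap_bounded_linear T smooth w linear_diff[OF bounded_linear.linear[OF T]])
    show "T (w p) = lap (\<lambda>p. T (z p)) p" for p
      by (simp add: lap_bounded_linear T smooth z)
  qed (use smooth T in \<open>auto intro: torus_smooth_bounded_linear\<close>)
  note si = square_integrable_smooth[OF smooth(1)] square_integrable_smooth[OF smooth(2)]
  have "square_integrable (\<lambda>p. Re (w p))" "square_integrable (\<lambda>p. Im (w p))"
    "square_integrable (\<lambda>p. complex_of_real (Re (w p)))"
    "square_integrable (\<lambda>p. complex_of_real (Im (w p)))"
    "square_integrable (\<lambda>p. \<i> * complex_of_real (Im (w p)))"
    using smooth by (auto intro!: square_integrable_smooth torus_smooth_bounded_linear[OF bounded_linear_Re]
        torus_smooth_bounded_linear[OF bounded_linear_Im]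
        torus_smooth_bounded_linear[OF bounded_linear_of_real]
        torus_smooth_bounded_linear[OF bounded_linear_mult_right])
  then show ?thesis
    using si by (simp add: Dinv_def Re_L2.abs_eq Im_L2.abs_eq part[OF bounded_linear_Re]
        part[OF bounded_linear_Im] of_real_L2.abs_eq L2_class_mult L2_class_add complex_eq[symmetric])
qed

text \<open>
  Two smooth representatives of a class have the same derivatives as classes: integration by parts
  shows that the difference of the derivatives is orthogonal to every smooth function, in
  particular to itself.
\<close>

lemma dstar_smooth:
  assumes g: "torus_smooth g"
  shows "dstar (L2_class g) = L2_class (\<lambda>p. dir_deriv (1, 0) g p + dir_deriv (0, 1) g p)"
proof -
  have uniq: "L2_class (dir_deriv d f) = L2_class (dir_deriv d g)"
    if f: "torus_smooth f" "L2_class f = L2_class g" for d f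
  proof -
    let ?x = "L2_class (dir_deriv d f) - L2_class (dir_deriv d g)"
    have orth: "inner ?x (L2_class h) = 0" if "torus_smooth h" for h
      using f g that by (simp add: inner_diff_left inner_dir_deriv_by_parts)
    have "inner ?x ?x = 0"
      using orth[OF torus_smooth_dir_deriv[OF f(1)]] orth[OF torus_smooth_dir_deriv[OF g]]
      by (simp only: inner_diff_right)
    then show ?thesis
      by simp
  qed
  have sum: "L2_class (\<lambda>p. dir_deriv (1, 0) f p + dir_deriv (0, 1) f p)
      = L2_class (dir_deriv (1, 0) f) + L2_class (dir_deriv (0, 1) f)" if "torus_smooth f"
    for f :: "real \<times> real \<Rightarrow> complex"
    using that by (simp add: L2_class_add square_integrable_smooth torus_smooth_dir_deriv)
  show ?thesis
    unfolding dstar_def partial1_eq_dir_deriv partial2_eq_dir_deriv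
  proof (rule the_equality)
    fix h assume "\<exists>f. torus_smooth f \<and> L2_class g = L2_class f \<and>
      h = L2_class (\<lambda>p. dir_deriv (1, 0) f p + dir_deriv (0, 1) f p)"
    then obtain f where f: "torus_smooth f" "L2_class f = L2_class g"
      and h: "h = L2_class (\<lambda>p. dir_deriv (1, 0) f p + dir_deriv (0, 1) f p)"
      by metis
    show "h = L2_class (\<lambda>p. dir_deriv (1, 0) g p + dir_deriv (0, 1) g p)"
      unfolding h sum[OF f(1)] sum[OF g] uniq[OF f] ..
  qed (use g in blast)
qed

section \<open>The operator on the torus\<close>

text \<open>
  At \<open>k = m = 0\<close> the quotient is \<open>0\<close> by the convention on division by zero, in
  accordance with the vanishing of \<open>P_torus\<close> on constants.
\<close>

definition torus_eigenvalue :: "int \<Rightarrow> int \<Rightarrow> complex" where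
  "torus_eigenvalue k m = - \<i> * of_int (k + m) / of_int (k\<^sup>2 + m\<^sup>2)"

lemma dir_deriv_add_smooth:
  "torus_smooth f \<Longrightarrow> torus_smooth g \<Longrightarrow>
    dir_deriv v (\<lambda>p. f p + g p) = (\<lambda>p. dir_deriv v f p + dir_deriv v g p)"
  by (intro ext dir_deriv_add torus_smooth_differentiable)

lemma lap_add:
  "torus_smooth f \<Longrightarrow> torus_smooth g \<Longrightarrow> lap (\<lambda>p. f p + g p) p = lap f p + lap g p"
  by (simp add: lap_def dir_deriv_add_smooth torus_smooth_dir_deriv)

lemma lap_exponential:
  "lap (\<lambda>p. c * torus_exponential k m p) p = - of_int (k\<^sup>2 + m\<^sup>2) * c * torus_exponential k m p"
proof -
  have "lap (\<lambda>p. c * torus_exponential k m p) p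
      = (c * (\<i> * of_int k) * (\<i> * of_int k) + c * (\<i> * of_int m) * (\<i> * of_int m))
        * torus_exponential k m p"
    unfolding lap_def dir_deriv_exponential[abs_def] by (simp add: distrib_right)
  also have "c * (\<i> * of_int k) * (\<i> * of_int k) + c * (\<i> * of_int m) * (\<i> * of_int m)
      = - of_int (k\<^sup>2 + m\<^sup>2) * c"
    by (simp add: power2_eq_square algebra_simps)
  finally show ?thesis .
qed

text \<open>
  The functions \<open>w\<close> and \<open>z\<close> are the solutions of the Poisson equation that the computation
  of \<open>Dinv\<close> calls for. What is asked of them is linear in \<open>q\<close>, so it suffices to treat
  a single exponential.
\<close>

lemma poisson_trig_poly:
  assumes A: "bounded_clinear A"
    and eigen: "\<And>k m. A (exponential_class k m) = torus_eigenvalue k m *\<^sub>C exponential_class k m"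
    and q: "trig_poly q"
  shows "\<exists>w z a. torus_smooth w \<and> torus_smooth z \<and> (\<forall>p. lap w p = q p - a) \<and> (\<forall>p. w p = lap z p) \<and>
    A (L2_class q) = L2_class (\<lambda>p. dir_deriv (1, 0) w p + dir_deriv (0, 1) w p)"
  using q
proof (induction rule: trig_poly.induct)
  case (exponential c k m)
  define r :: complex where "r = of_int (k\<^sup>2 + m\<^sup>2)"
  \<comment> \<open>For \<open>k = m = 0\<close> both functions below are zero, as \<open>r = 0\<close>, and \<open>a\<close> absorbs \<open>q\<close>.\<close>
  let ?w = "\<lambda>p. (- c / r) * torus_exponential k m p"
  let ?z = "\<lambda>p. (c / r\<^sup>2) * torus_exponential k m p"
  have "k\<^sup>2 + m\<^sup>2 = 0 \<longleftrightarrow> k = 0 \<and> m = 0"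
    by (simp add: sum_power2_eq_zero_iff)
  then have r0: "r = 0 \<longleftrightarrow> k = 0 \<and> m = 0"
    unfolding r_def by (metis of_int_eq_0_iff)
  define a where "a = (if r = 0 then c * torus_exponential k m (0, 0) else 0)"
  have "lap ?w p = c * torus_exponential k m p - a" for p
    unfolding lap_exponential r_def[symmetric] a_def using r0
    by (auto simp: torus_exponential_def)
  moreover have "?w p = lap ?z p" for p
    unfolding lap_exponential r_def[symmetric] by (simp add: power2_eq_square)
  moreover have "A (L2_class (\<lambda>p. c * torus_exponential k m p))
      = L2_class (\<lambda>p. dir_deriv (1, 0) ?w p + dir_deriv (0, 1) ?w p)"
  proof -
    have "A (L2_class (\<lambda>p. c * torus_exponential k m p)) = c *\<^sub>C A (exponential_class k m)"
      by (simp add: L2_class_mult[symmetric] square_integrable_exponential bounded_clinear_scaleC[OF A])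
    also have "\<dots> = L2_class (\<lambda>p. (c * torus_eigenvalue k m) * torus_exponential k m p)"
      unfolding eigen scaleC_scaleC by (rule L2_class_mult[OF square_integrable_exponential])
    also have "(\<lambda>p. (c * torus_eigenvalue k m) * torus_exponential k m p)
        = (\<lambda>p. dir_deriv (1, 0) ?w p + dir_deriv (0, 1) ?w p)"
      unfolding dir_deriv_exponential torus_eigenvalue_def r_def[symmetric]
      by (simp add: fun_eq_iff add_divide_distrib diff_divide_distrib algebra_simps)
    finally show ?thesis .
  qed
  ultimately show ?case
    using torus_smooth_exponential[of _ k m] by blast
next
  case (add f g)
  obtain w z a where f: "torus_smooth w" "torus_smooth z" "\<And>p. lap w p = f p - a" "\<And>p. w p = lap z p"
    "A (L2_class f) = L2_class (\<lambda>p. dir_deriv (1, 0) w p + dir_deriv (0, 1) w p)"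
    using add.IH(1) by metis
  obtain w' z' a' where g: "torus_smooth w'" "torus_smooth z'" "\<And>p. lap w' p = g p - a'"
    "\<And>p. w' p = lap z' p"
    "A (L2_class g) = L2_class (\<lambda>p. dir_deriv (1, 0) w' p + dir_deriv (0, 1) w' p)"
    using add.IH(2) by metis
  note si = square_integrable_smooth torus_smooth_add torus_smooth_dir_deriv f(1) g(1)
  let ?d = "\<lambda>w p. dir_deriv (1, 0) w p + dir_deriv (0, 1) w p"
  have "L2_class (\<lambda>p. f p + g p) = L2_class f + L2_class g"
    using add.hyps by (simp add: L2_class_add square_integrable_smooth trig_poly_smooth)
  then have "A (L2_class (\<lambda>p. f p + g p)) = L2_class (?d w) + L2_class (?d w')"
    using f(5) g(5) linear_add[OF bounded_linear.linear[OF bounded_clinear_bounded_linear[OF A]]]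
    by simp
  also have "\<dots> = L2_class (\<lambda>p. ?d w p + ?d w' p)"
    by (intro L2_class_add si)
  also have "(\<lambda>p. ?d w p + ?d w' p) = ?d (\<lambda>p. w p + w' p)"
    by (simp add: dir_deriv_add_smooth f(1) g(1) algebra_simps)
  finally have A_sum: "A (L2_class (\<lambda>p. f p + g p)) = L2_class (?d (\<lambda>p. w p + w' p))" .
  show ?case
  proof (intro exI conjI allI)
    show "torus_smooth (\<lambda>p. w p + w' p)" "torus_smooth (\<lambda>p. z p + z' p)"
      by (intro torus_smooth_add f g)+
    show "lap (\<lambda>p. w p + w' p) p = f p + g p - (a + a')" for p
      by (simp add: lap_add f(1,3) g(1,3))
    show "w p + w' p = lap (\<lambda>p. z p + z' p) p" for p
      by (simp add: lap_add f(2,4) g(2,4))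
  qed (rule A_sum)
qed

text \<open>
  With \<open>r = k\<^sup>2 + m\<^sup>2\<close> one has \<open>(k + m)\<^sup>2 \<le> 2 * r\<close>, and
  \<open>(1 + k\<^sup>2) * (1 + m\<^sup>2) \<le> 3 * r\<^sup>2\<close> because \<open>r \<ge> 1\<close> for integers that
  are not both zero. The fourth power is thus dominated by the general term of a product of two
  convergent series.
\<close>

lemma torus_eigenvalue_bounds:
  "cmod (torus_eigenvalue k m) \<le> 1"
  "cmod (torus_eigenvalue k m) ^ 4 \<le> 12 * (1 / (1 + (of_int k)\<^sup>2) * (1 / (1 + (of_int m)\<^sup>2)))"
proof -
  define x y :: real where "x = of_int k" and "y = of_int m"
  define r where "r = x\<^sup>2 + y\<^sup>2"
  have ev: "cmod (torus_eigenvalue k m) = \<bar>x + y\<bar> / r"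
  proof -
    have eq: "torus_eigenvalue k m = - \<i> * complex_of_real ((x + y) / r)"
      by (simp add: torus_eigenvalue_def x_def y_def r_def)
    show ?thesis
      unfolding eq norm_mult norm_of_real by (simp add: r_def)
  qed
  have int: "\<bar>of_int j\<bar> \<le> (of_int j :: real)\<^sup>2" for j :: int
  proof -
    have "\<bar>j\<bar> * 1 \<le> \<bar>j\<bar> * \<bar>j\<bar>"
    proof (cases "j = 0")
      case False
      then show ?thesis
        by (intro mult_left_mono) auto
    qed simp
    then have "real_of_int \<bar>j\<bar> \<le> real_of_int (j * j)"
      unfolding of_int_le_iff by simp
    then show ?thesis
      by (simp add: power2_eq_square)
  qed
  have sum: "\<bar>x + y\<bar> \<le> r"
    using int[of k] int[of m] abs_triangle_ineq[of x y] unfolding r_def x_def y_def by linarith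
  show "cmod (torus_eigenvalue k m) \<le> 1"
    unfolding ev using sum by (cases "r = 0") (auto simp: divide_le_eq)
  show "cmod (torus_eigenvalue k m) ^ 4 \<le> 12 * (1 / (1 + (of_int k)\<^sup>2) * (1 / (1 + (of_int m)\<^sup>2)))"
  proof (cases "r = 0")
    case False
    have r1: "1 \<le> r"
    proof -
      have "r = of_int (k\<^sup>2 + m\<^sup>2)"
        by (simp add: r_def x_def y_def)
      moreover have "0 \<le> k\<^sup>2 + m\<^sup>2"
        by simp
      ultimately show ?thesis
        using False by (metis (mono_tags) less_le of_int_0 of_int_1_le_iff zless_imp_add1_zle add_0)
    qed
    have s: "(x + y)\<^sup>2 \<le> 2 * r"
      using sum_squares_bound[of x y] by (simp add: r_def power2_sum)
    have "(1 + x\<^sup>2) * (1 + y\<^sup>2) \<le> 3 * r\<^sup>2"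
    proof -
      have "x\<^sup>2 * y\<^sup>2 \<le> r\<^sup>2"
        unfolding r_def by (simp add: power2_sum)
      moreover have "r \<le> r\<^sup>2"
        using mult_left_mono[OF r1, of r] r1 by (simp add: power2_eq_square)
      moreover have "(1 + x\<^sup>2) * (1 + y\<^sup>2) = 1 + r + x\<^sup>2 * y\<^sup>2"
        by (simp add: r_def algebra_simps)
      ultimately show ?thesis
        using r1 by linarith
    qed
    then have den: "1 / (3 * r\<^sup>2) \<le> 1 / ((1 + x\<^sup>2) * (1 + y\<^sup>2))"
      by (intro divide_left_mono) (auto intro!: mult_pos_pos simp: add_pos_nonneg False)
    have "(\<bar>x + y\<bar> / r) ^ 4 = ((x + y)\<^sup>2)\<^sup>2 / r ^ 4"
      by (simp add: power_divide power_even_abs flip: power_mult)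
    also have "\<dots> \<le> (2 * r)\<^sup>2 / r ^ 4"
      using s by (intro divide_right_mono power_mono) auto
    also have "\<dots> = 12 * (1 / (3 * r\<^sup>2))"
      using False by (simp add: field_simps power2_eq_square power4_eq_xxxx)
    also have "\<dots> \<le> 12 * (1 / ((1 + x\<^sup>2) * (1 + y\<^sup>2)))"
      using den by linarith
    finally show ?thesis
      unfolding ev x_def y_def by simp
  qed (simp add: ev)
qed

lemma summable_on_inverse_square_int: "(\<lambda>k :: int. 1 / (1 + (of_int k)\<^sup>2) :: real) summable_on UNIV"
proof -
  have "summable (\<lambda>n. 1 / (1 + (of_nat n)\<^sup>2) :: real)"
  proof (rule summable_comparison_test')
    show "summable (\<lambda>n. inverse (real n ^ 2))"
      by (rule inverse_power_summable) simp
    show "norm (1 / (1 + (real n)\<^sup>2)) \<le> inverse ((real n)\<^sup>2)" if "1 \<le> n" for n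
    proof -
      have pos: "0 < 1 + (real n)\<^sup>2"
        by (simp add: add_pos_nonneg)
      have "1 / (1 + (real n)\<^sup>2) \<le> 1 / (real n)\<^sup>2"
        using that by (intro frac_le) auto
      then show ?thesis
        by (simp add: inverse_eq_divide abs_of_pos[OF pos])
    qed
  qed
  then have nat: "(\<lambda>n. 1 / (1 + (of_nat n)\<^sup>2) :: real) summable_on UNIV"
    by (subst summable_on_UNIV_nonneg_real_iff) auto
  let ?f = "\<lambda>k :: int. 1 / (1 + (of_int k)\<^sup>2) :: real"
  have "?f summable_on range int"
    using nat by (subst summable_on_reindex) (auto simp: o_def)
  moreover have "?f summable_on range (\<lambda>n. - int n)"
    using nat by (subst summable_on_reindex) (auto simp: o_def inj_on_def)
  ultimately have "?f summable_on (range int \<union> range (\<lambda>n. - int n))"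
    by (rule summable_on_union)
  moreover have "range int \<union> range (\<lambda>n. - int n) = UNIV"
    by (auto intro: int_cases2)
  ultimately show ?thesis
    by simp
qed

lemma torus_eigenvalue_power_summable:
  assumes "4 \<le> n"
  shows "(\<lambda>(k, m). cmod (torus_eigenvalue k m ^ n)) summable_on UNIV"
proof (rule summable_on_comparison_test)
  let ?f = "\<lambda>k :: int. 1 / (1 + (of_int k)\<^sup>2) :: real"
  obtain s where s: "(?f has_sum s) UNIV"
    using summable_on_inverse_square_int by (auto simp: summable_on_def)
  have "(\<lambda>(k, m). ?f k * ?f m) summable_on (UNIV \<times> UNIV)"
  proof (rule summable_on_SigmaI[where g = "\<lambda>k. ?f k * s"])
    show "((\<lambda>m. case (k, m) of (k, m) \<Rightarrow> ?f k * ?f m) has_sum ?f k * s) UNIV" for k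
      using has_sum_cmult_right[OF s, of "?f k"] by simp
    show "(\<lambda>k. ?f k * s) summable_on UNIV"
      using has_sum_cmult_left[OF s, of s] by (auto simp: summable_on_def)
  qed auto
  then show "(\<lambda>(k, m). 12 * (?f k * ?f m)) summable_on UNIV"
    using summable_on_cmult_right[of "\<lambda>(k, m). ?f k * ?f m" UNIV 12] by (simp add: case_prod_unfold)
  show "(case p of (k, m) \<Rightarrow> cmod (torus_eigenvalue k m ^ n))
      \<le> (case p of (k, m) \<Rightarrow> 12 * (?f k * ?f m))" for p
  proof (cases p)
    case (Pair k m)
    have "cmod (torus_eigenvalue k m) ^ n \<le> cmod (torus_eigenvalue k m) ^ 4"
      using assms torus_eigenvalue_bounds(1) by (intro power_decreasing) auto
    also have "\<dots> \<le> 12 * (?f k * ?f m)"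
      by (rule torus_eigenvalue_bounds(2))
    finally show ?thesis
      by (simp add: Pair norm_power)
  qed
qed auto

lemma inj_exponential_class: "inj (\<lambda>(k, m). exponential_class k m)"
proof (rule injI, clarify)
  fix k m k' m' assume "exponential_class k m = exponential_class k' m'"
  then have "cinner (exponential_class k m) (exponential_class k' m') = 1"
    using cinner_exponential_class[of k m k m] by simp
  then show "k = k' \<and> m = m'"
    by (simp add: cinner_exponential_class split: if_splits)
qed

definition class_eigenvalue :: "complex torus_L2 \<Rightarrow> complex" where
  "class_eigenvalue x = (case inv (\<lambda>(k, m). exponential_class k m) x of (k, m) \<Rightarrow> torus_eigenvalue k m)"

lemma class_eigenvalue_exponential: "class_eigenvalue (exponential_class k m) = torus_eigenvalue k m"
  using inv_f_f[OF inj_exponential_class, of "(k, m)"] by (simp add: class_eigenvalue_def)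

text \<open>
  The bounded diagonal operator with these eigenvalues agrees with \<open>dstar \<circ> Dinv\<close> on
  \<open>Lambda\<close>. As \<open>Lambda\<close> is dense, it is the only bounded operator that does.
\<close>

theorem P_torus_diagonal: "diagonal_op exponential_classes class_eigenvalue P_torus"
proof -
  obtain A where A: "diagonal_op exponential_classes class_eigenvalue A"
    by (rule diagonal_op_exists[OF exponential_classes_basis, of class_eigenvalue 1])
       (auto simp: class_eigenvalue_exponential torus_eigenvalue_bounds)
  have "bounded_clinear A"
    and eigen: "A (exponential_class k m) = torus_eigenvalue k m *\<^sub>C exponential_class k m" for k m
    using A by (auto simp: diagonal_op_def class_eigenvalue_exponential)
  have A_eq: "A f = dstar (Dinv f)" if f: "f \<in> Lambda" for f
  proof -
    obtain q where q: "trig_poly q" "f = L2_class q"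
      using f unfolding Lambda_eq_trig_poly by blast
    obtain w z a where w: "torus_smooth w" "torus_smooth z" "\<And>p. lap w p = q p - a" "\<And>p. w p = lap z p"
      "A (L2_class q) = L2_class (\<lambda>p. dir_deriv (1, 0) w p + dir_deriv (0, 1) w p)"
      using poisson_trig_poly[OF \<open>bounded_clinear A\<close> eigen q(1)] by metis
    have "Dinv (L2_class q) = L2_class w"
      using w(1-4) trig_poly_smooth[OF q(1)] by (intro Dinv_smooth)
    then show ?thesis
      using w by (simp add: q dstar_smooth)
  qed
  have "P_torus = A"
    unfolding P_torus_def
  proof (rule the_equality)
    fix B assume B: "bounded_clinear B \<and> (\<forall>f\<in>Lambda. B f = dstar (Dinv f))"
    show "B = A"
    proof (rule bounded_clinear_eq_on_dense_span)
      show "closure (cspan exponential_classes) = UNIV"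
        using exponential_classes_basis by (simp add: is_orthonormal_basis_def)
      show "B x = A x" if "x \<in> exponential_classes" for x
        using B A_eq complex_vector.span_base[OF that] by (simp add: Lambda_def)
    qed (use B \<open>bounded_clinear A\<close> in auto)
  qed (use A_eq \<open>bounded_clinear A\<close> in auto)
  with A show ?thesis
    by simp
qed

theorem proposition4p4:
  fixes n :: nat
  assumes "even n" and "n > 2"
  shows "trace_class (P_torus ^^ n) \<and>
    (\<lambda>(k :: int, m :: int). (of_int (k + m)) ^ n / (of_int (k\<^sup>2 + m\<^sup>2)) ^ n :: complex)
      summable_on (UNIV - {(0, 0)}) \<and>
    trace_op (P_torus ^^ n) =
      \<i> ^ n * (\<Sum>\<^sub>\<infinity>(k :: int, m :: int)\<in>UNIV - {(0, 0)}.
        (of_int (k + m)) ^ n / (of_int (k\<^sup>2 + m\<^sup>2)) ^ n)"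
proof -
  let ?t = "\<lambda>(k :: int, m :: int). (of_int (k + m)) ^ n / (of_int (k\<^sup>2 + m\<^sup>2)) ^ n :: complex"
  let ?e = "\<lambda>(k, m). exponential_class k m"
  \<comment> \<open>An even number above \<open>2\<close> is at least \<open>4\<close>, the power that makes the eigenvalues summable.\<close>
  have "4 \<le> n"
    using assms by (auto elim!: evenE)
  note summable = torus_eigenvalue_power_summable[OF this]
  \<comment> \<open>The sign of \<open>- \<i>\<close> disappears in an even power.\<close>
  have eigen: "class_eigenvalue (?e p) ^ n = \<i> ^ n * ?t p" for p
  proof (cases p)
    case (Pair k m)
    show ?thesis
      unfolding Pair prod.case class_eigenvalue_exponential torus_eigenvalue_def
      using \<open>even n\<close> by (simp only: power_divide power_mult_distrib power_minus_even times_divide_eq_right)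
  qed
  have diag: "diagonal_op exponential_classes (\<lambda>x. class_eigenvalue x ^ n) (P_torus ^^ n)"
    by (rule diagonal_op_funpow[OF P_torus_diagonal])
  have norm: "(\<lambda>p. cmod (class_eigenvalue (?e p) ^ n)) summable_on UNIV"
    using summable by (simp add: case_prod_unfold class_eigenvalue_exponential)
  then have abs: "(\<lambda>x. cmod (class_eigenvalue x ^ n)) summable_on exponential_classes"
    by (subst summable_on_reindex[OF inj_exponential_class]) (simp add: o_def)
  have "(\<lambda>p. norm (?t p)) summable_on UNIV"
    using norm unfolding eigen by (simp add: norm_mult norm_power)
  then have sum: "?t summable_on (UNIV - {(0, 0)})"
    using abs_summable_summable summable_on_subset_banach by blast
  have "trace_op (P_torus ^^ n) = (\<Sum>\<^sub>\<infinity>x\<in>exponential_classes. class_eigenvalue x ^ n)"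
    by (rule diagonal_op_trace[OF exponential_classes_basis diag abs])
  also have "\<dots> = (\<Sum>\<^sub>\<infinity>p\<in>UNIV. class_eigenvalue (?e p) ^ n)"
    by (subst infsum_reindex[OF inj_exponential_class]) (simp add: o_def)
  also have "\<dots> = (\<Sum>\<^sub>\<infinity>p\<in>UNIV. \<i> ^ n * ?t p)"
    by (simp only: eigen)
  also have "\<dots> = (\<Sum>\<^sub>\<infinity>p\<in>UNIV - {(0, 0)}. \<i> ^ n * ?t p)"
    using \<open>4 \<le> n\<close> by (intro infsum_cong_neutral) auto
  also have "\<dots> = \<i> ^ n * (\<Sum>\<^sub>\<infinity>p\<in>UNIV - {(0, 0)}. ?t p)"
    using sum by (intro infsum_cmult_right) 
  finally have "trace_op (P_torus ^^ n) = \<i> ^ n * (\<Sum>\<^sub>\<infinity>p\<in>UNIV - {(0, 0)}. ?t p)" .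
  with diagonal_op_trace_class[OF exponential_classes_basis diag abs] sum show ?thesis
    by blast
qed

end
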